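(* Let $Q$ be a quiver of type $ADE$ and let $R$ be its Ringel form. Then $-\varphi_R$ induces an isomorphism of oriented graphs from the Auslander-Reiten quiver $\Gamma_Q$ onto $\tilde{\Gamma}_Q$; that is, the map sending the vertex $[\beta]$ of $\Gamma_Q$ ($\beta\in\Phi^+$) to the weight $-\varphi_R(\beta)$ is a bijection from the vertices of $\Gamma_Q$ to the vertices of $\tilde{\Gamma}_Q$, and there is an arrow $[\alpha]\to[\beta]$ in $\Gamma_Q$ if and only if there is an arrow $-\varphi_R(\alpha)\to-\varphi_R(\beta)$ in $\tilde{\Gamma}_Q$.
   Context: Let $D$ be a Dynkin diagram of type $ADE$ with vertex set $I=\{1,\dots,n\}$, $\Phi$ its root system in the real Euclidean space $E$, $\Phi^+$ the positive roots, $N=|\Phi^+|$, $\alpha_i$ the simple roots, $\omega_i\in E$ the fundamental weights, $W$ the Weyl group with simple reflections $s_i$, and $w_0$ its longest element. A quiver $Q$ of type $ADE$ is an orientation of the edges of such a $D$. Auslander-Reiten quiver. By Gabriel's theorem, isomorphism classes of indecomposable finite dimensional representations of $Q$ over $\mathbb{C}$ are in bijection with $\Phi^+$ via the dimension vector $\dim M=\sum_i(\dim V_i)\alpha_i$; $[\beta]$ denotes the class with dimension vector $\beta$. $\Gamma_Q$ is the oriented graph whose vertices are these classes, with an arrow $[\alpha]\to[\beta]$ iff there is an irreducible morphism from the indecomposable of class $[\alpha]$ to that of class $[\beta]$ (a morphism that is neither a split monomorphism nor a split epimorphism, and such that in any factorization $f=gh$ either $h$ is a split monomorphism or $g$ is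 a split epimorphism). Ringel form. $R$ is the bilinear form on $E$ with $r_{i,j}:=R(\alpha_i,\alpha_j)$ equal to $1$ if $i=j$, to $-1$ if there is an arrow $i\to j$ in $Q$, and to $0$ otherwise. Put $\rho_i=\sum_{l\in I}r_{l,i}\,\omega_l$, and let $\varphi_R:E\to E$ be the linear map with $\varphi_R(\alpha_i)=\rho_i$ for all $i\in I$. Adapted reduced expressions. A vertex $k$ is a sink of $Q$ if all arrows incident to $k$ enter $k$; then $S_kQ$ is obtained from $Q$ by reversing all arrows ending at $k$. A reduced expression $\tilde w_0=s_{i_1}\cdots s_{i_N}$ of $w_0$ is adapted to $Q$ if $i_1$ is a sink of $Q$, $i_2$ a sink of $S_{i_1}Q$, $i_3$ a sink of $S_{i_2}S_{i_1}Q$, and so on. Abstract Auslander-Reiten quiver. For $i\in I$ let $W^{(i)}$ be the subgroup of $W$ generated by the $s_j$, $j\ne i$; it is the stabilizer of $\omega_i$, so a weight $w\omega_i$ is identified with the left class $wW^{(i)}$. Given a reduced expression $\tilde w_0=s_{i_1}\cdots s_{i_N}$ of $w_0$, put $w_k=s_{i_1}\cdots s_{i_k}$ and $\mu_k=w_k\omega_{i_k}$ (identified with $w_kW^{(i_k)}$). The oriented graph $\Gamma_{\tilde w_0}$ has vertices $\mu_1,\dots,\mu_N$, and an arrow $\mu_j\to\mu_k$ iff (i) $i_j$ and $i_k$ are linked in $D$; (ii) $w_jW^{(i_j)}\cap w_kW^{(i_k)}\neq\emptyset$; (iii) $j<k$. This graph depends only on the class of $\tilde w_0$ up to interchanging adjacent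 commuting simple reflections. All reduced expressions adapted to $Q$ belong to the same class, and $\tilde\Gamma_Q$ denotes $\Gamma_{\tilde w_0}$ for any $\tilde w_0$ adapted to $Q$. *)

theory Defs
  imports
    "HOL-Analysis.Analysis"
    "HOL-Library.Function_Algebras"
    "HOL-Algebra.Bij"
    "HOL-Algebra.Coset"
    "HOL-Algebra.Generated_Groups"
    "Graph_Theory.Pair_Digraph"
begin

section \<open>Dynkin diagrams and quivers of type ADE\<close>

text \<open>A diagram on the vertex type \<open>'i\<close> is given by its symmetric adjacency relation. The models
  below list each edge once, on the vertex set \<open>{1..n}\<close>, in the numbering of Bourbaki.\<close>

definition edges_A :: "nat \<Rightarrow> nat rel" where
  "edges_A n = {(k, k + 1) | k. 1 \<le> k \<and> k + 1 \<le> n}"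

definition edges_D :: "nat \<Rightarrow> nat rel" where
  "edges_D n = insert (n - 2, n) {(k, k + 1) | k. 1 \<le> k \<and> k + 2 \<le> n}"

definition edges_E :: "nat \<Rightarrow> nat rel" where
  "edges_E n = {(1, 3), (2, 4)} \<union> {(k, k + 1) | k. 3 \<le> k \<and> k + 1 \<le> n}"

definition ADE_diagram :: "'i rel \<Rightarrow> bool" where
  "ADE_diagram D \<longleftrightarrow>
     (\<exists>n e f. (e = edges_A n \<or> (4 \<le> n \<and> e = edges_D n) \<or> (n \<in> {6, 7, 8} \<and> e = edges_E n)) \<and>
        bij_betw f UNIV {1..n} \<and> D = {(i, j). (f i, f j) \<in> e \<union> e\<inverse>})"

definition orientation_of :: "'i rel \<Rightarrow> 'i rel \<Rightarrow> bool" where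
  "orientation_of D Q \<longleftrightarrow> Q \<union> Q\<inverse> = D \<and> Q \<inter> Q\<inverse> = {}"

definition sink :: "'i rel \<Rightarrow> 'i \<Rightarrow> bool" where
  "sink Q k \<longleftrightarrow> (\<forall>j. (k, j) \<notin> Q)"

definition reverse_at :: "'i \<Rightarrow> 'i rel \<Rightarrow> 'i rel" where
  "reverse_at k Q = {(i, j) \<in> Q. j \<noteq> k} \<union> {(k, i) | i. (i, k) \<in> Q}"

fun adapted :: "'i rel \<Rightarrow> 'i list \<Rightarrow> bool" where
  "adapted Q [] \<longleftrightarrow> True"
| "adapted Q (i # is) \<longleftrightarrow> sink Q i \<and> adapted (reverse_at i Q) is"


section \<open>Root systems and Weyl groups\<close>

definition reflection :: "'e::euclidean_space \<Rightarrow> 'e \<Rightarrow> 'e" where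
  "reflection a v = v - (2 * (v \<bullet> a) / (a \<bullet> a)) *\<^sub>R a"

definition root_system :: "'e::euclidean_space set \<Rightarrow> bool" where
  "root_system \<Phi> \<longleftrightarrow>
     finite \<Phi> \<and> span \<Phi> = UNIV \<and> 0 \<notin> \<Phi> \<and>
     (\<forall>a\<in>\<Phi>. \<forall>c. c *\<^sub>R a \<in> \<Phi> \<longrightarrow> c = 1 \<or> c = - 1) \<and>
     (\<forall>a\<in>\<Phi>. reflection a ` \<Phi> \<subseteq> \<Phi>) \<and>
     (\<forall>a\<in>\<Phi>. \<forall>b\<in>\<Phi>. 2 * (b \<bullet> a) / (a \<bullet> a) \<in> \<int>)"

definition positive_roots :: "'e::euclidean_space set \<Rightarrow> ('i::finite \<Rightarrow> 'e) \<Rightarrow> 'e set" where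
  "positive_roots \<Phi> \<alpha> = {b \<in> \<Phi>. \<exists>c::'i \<Rightarrow> nat. b = (\<Sum>i\<in>UNIV. real (c i) *\<^sub>R \<alpha> i)}"

definition simple_system :: "'e::euclidean_space set \<Rightarrow> ('i::finite \<Rightarrow> 'e) \<Rightarrow> bool" where
  "simple_system \<Phi> \<alpha> \<longleftrightarrow>
     inj \<alpha> \<and> range \<alpha> \<subseteq> \<Phi> \<and> independent (range \<alpha>) \<and>
     (\<forall>b\<in>\<Phi>. b \<in> positive_roots \<Phi> \<alpha> \<or> - b \<in> positive_roots \<Phi> \<alpha>)"

text \<open>Simply laced case: linked simple roots have Cartan integer \<open>-1\<close>, unlinked ones are
  orthogonal. The common length of the roots is not normalized.\<close>

definition has_Dynkin_diagram :: "('i \<Rightarrow> 'e::euclidean_space) \<Rightarrow> 'i rel \<Rightarrow> bool" where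
  "has_Dynkin_diagram \<alpha> D \<longleftrightarrow>
     (\<forall>i j. 2 * (\<alpha> i \<bullet> \<alpha> j) / (\<alpha> j \<bullet> \<alpha> j) = (if i = j then 2 else if (i, j) \<in> D then - 1 else 0))"

definition fundamental_weights :: "('i \<Rightarrow> 'e::euclidean_space) \<Rightarrow> ('i \<Rightarrow> 'e) \<Rightarrow> bool" where
  "fundamental_weights \<alpha> \<omega> \<longleftrightarrow>
     (\<forall>i j. 2 * (\<omega> i \<bullet> \<alpha> j) / (\<alpha> j \<bullet> \<alpha> j) = (if i = j then 1 else 0))"

definition weyl_group :: "('i \<Rightarrow> 'e::euclidean_space) \<Rightarrow> ('e \<Rightarrow> 'e) set" where
  "weyl_group \<alpha> = generate (BijGroup UNIV) (range (\<lambda>i. reflection (\<alpha> i)))"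

definition parabolic :: "('i \<Rightarrow> 'e::euclidean_space) \<Rightarrow> 'i \<Rightarrow> ('e \<Rightarrow> 'e) set" where
  "parabolic \<alpha> i = generate (BijGroup UNIV) ((\<lambda>j. reflection (\<alpha> j)) ` {j. j \<noteq> i})"

definition word_element :: "('i \<Rightarrow> 'e::euclidean_space) \<Rightarrow> 'i list \<Rightarrow> 'e \<Rightarrow> 'e" where
  "word_element \<alpha> is = foldr (\<lambda>i w. reflection (\<alpha> i) \<circ> w) is id"

definition weyl_length :: "('i \<Rightarrow> 'e::euclidean_space) \<Rightarrow> ('e \<Rightarrow> 'e) \<Rightarrow> nat" where
  "weyl_length \<alpha> w = (LEAST l. \<exists>is. length is = l \<and> word_element \<alpha> is = w)"

definition longest_element :: "('i \<Rightarrow> 'e::euclidean_space) \<Rightarrow> 'e \<Rightarrow> 'e" where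
  "longest_element \<alpha> = (ARG_MAX (weyl_length \<alpha>) w. w \<in> weyl_group \<alpha>)"

definition reduced_expression :: "('i \<Rightarrow> 'e::euclidean_space) \<Rightarrow> 'i list \<Rightarrow> ('e \<Rightarrow> 'e) \<Rightarrow> bool" where
  "reduced_expression \<alpha> is w \<longleftrightarrow> word_element \<alpha> is = w \<and> length is = weyl_length \<alpha> w"


section \<open>The Ringel form\<close>

definition ringel_form :: "'i rel \<Rightarrow> ('i \<Rightarrow> 'e::euclidean_space) \<Rightarrow> ('e \<Rightarrow> 'e \<Rightarrow> real) \<Rightarrow> bool" where
  "ringel_form Q \<alpha> R \<longleftrightarrow>
     bilinear R \<and> (\<forall>i j. R (\<alpha> i) (\<alpha> j) = (if i = j then 1 else if (i, j) \<in> Q then - 1 else 0))"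

definition ringel_map ::
  "('i::finite \<Rightarrow> 'e::euclidean_space) \<Rightarrow> ('i \<Rightarrow> 'e) \<Rightarrow> ('e \<Rightarrow> 'e \<Rightarrow> real) \<Rightarrow> ('e \<Rightarrow> 'e) \<Rightarrow> bool" where
  "ringel_map \<alpha> \<omega> R \<phi> \<longleftrightarrow>
     linear \<phi> \<and> (\<forall>i. \<phi> (\<alpha> i) = (\<Sum>l\<in>UNIV. R (\<alpha> l) (\<alpha> i) *\<^sub>R \<omega> l))"


section \<open>The abstract Auslander-Reiten quiver\<close>

text \<open>List positions count from \<open>0\<close>, so \<open>prefix_element \<alpha> is k\<close> is the product of the first
  \<open>k + 1\<close> letters. Vertices are kept as weights; the left class identified with
  \<open>prefix_weight \<alpha> \<omega> is k\<close> is \<open>prefix_coset \<alpha> is k\<close>.\<close>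

definition prefix_element :: "('i \<Rightarrow> 'e::euclidean_space) \<Rightarrow> 'i list \<Rightarrow> nat \<Rightarrow> 'e \<Rightarrow> 'e" where
  "prefix_element \<alpha> is k = word_element \<alpha> (take (Suc k) is)"

definition prefix_weight ::
  "('i \<Rightarrow> 'e::euclidean_space) \<Rightarrow> ('i \<Rightarrow> 'e) \<Rightarrow> 'i list \<Rightarrow> nat \<Rightarrow> 'e" where
  "prefix_weight \<alpha> \<omega> is k = prefix_element \<alpha> is k (\<omega> (is ! k))"

definition prefix_coset :: "('i \<Rightarrow> 'e::euclidean_space) \<Rightarrow> 'i list \<Rightarrow> nat \<Rightarrow> ('e \<Rightarrow> 'e) set" where
  "prefix_coset \<alpha> is k = prefix_element \<alpha> is k <#\<^bsub>BijGroup UNIV\<^esub> parabolic \<alpha> (is ! k)"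

definition abstract_AR_quiver ::
  "'i rel \<Rightarrow> ('i \<Rightarrow> 'e::euclidean_space) \<Rightarrow> ('i \<Rightarrow> 'e) \<Rightarrow> 'i list \<Rightarrow> 'e pair_pre_digraph" where
  "abstract_AR_quiver D \<alpha> \<omega> is =
     \<lparr> pverts = prefix_weight \<alpha> \<omega> is ` {..<length is},
       parcs = {(prefix_weight \<alpha> \<omega> is j, prefix_weight \<alpha> \<omega> is k) | j k.
         j < k \<and> k < length is \<and> (is ! j, is ! k) \<in> D \<and>
         prefix_coset \<alpha> is j \<inter> prefix_coset \<alpha> is k \<noteq> {}} \<rparr>"


section \<open>Representations of quivers over the complex numbers\<close>

text \<open>The vector spaces of a representation are finite dimensional subspaces of the complex vector
  space of all sequences. As every finite dimensional complex vector space is isomorphic to such a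
  subspace, this fixes a universe for isomorphism classes without loss of generality.\<close>

type_synonym cvec = "nat \<Rightarrow> complex"

definition cscale :: "complex \<Rightarrow> cvec \<Rightarrow> cvec" where
  "cscale c v = (\<lambda>n. c * v n)"

interpretation cvec: vector_space cscale
  by unfold_locales (auto simp: cscale_def plus_fun_def algebra_simps)

definition fin_dim_space :: "cvec set \<Rightarrow> bool" where
  "fin_dim_space V \<longleftrightarrow> cvec.subspace V \<and> (\<exists>B. finite B \<and> V = cvec.span B)"

text \<open>Maps are only relevant on their domain \<open>V\<close>; their values elsewhere are arbitrary.\<close>

definition linear_between :: "cvec set \<Rightarrow> cvec set \<Rightarrow> (cvec \<Rightarrow> cvec) \<Rightarrow> bool" where
  "linear_between V W f \<longleftrightarrow>
     (\<forall>x\<in>V. f x \<in> W) \<and> (\<forall>x\<in>V. \<forall>y\<in>V. f (x + y) = f x + f y) \<and>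
     (\<forall>c. \<forall>x\<in>V. f (cscale c x) = cscale c (f x))"

record 'i rep =
  space_at :: "'i \<Rightarrow> cvec set"
  map_along :: "'i \<times> 'i \<Rightarrow> cvec \<Rightarrow> cvec"

definition representation :: "'i rel \<Rightarrow> 'i rep \<Rightarrow> bool" where
  "representation Q M \<longleftrightarrow>
     (\<forall>i. fin_dim_space (space_at M i)) \<and>
     (\<forall>(i, j)\<in>Q. linear_between (space_at M i) (space_at M j) (map_along M (i, j)))"

definition morphism :: "'i rel \<Rightarrow> 'i rep \<Rightarrow> 'i rep \<Rightarrow> ('i \<Rightarrow> cvec \<Rightarrow> cvec) \<Rightarrow> bool" where
  "morphism Q M N f \<longleftrightarrow>
     (\<forall>i. linear_between (space_at M i) (space_at N i) (f i)) \<and>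
     (\<forall>(i, j)\<in>Q. \<forall>x\<in>space_at M i. f j (map_along M (i, j) x) = map_along N (i, j) (f i x))"

definition compose_mor ::
  "('i \<Rightarrow> cvec \<Rightarrow> cvec) \<Rightarrow> ('i \<Rightarrow> cvec \<Rightarrow> cvec) \<Rightarrow> 'i \<Rightarrow> cvec \<Rightarrow> cvec" where
  "compose_mor g h = (\<lambda>i. g i \<circ> h i)"

definition equal_on :: "'i rep \<Rightarrow> ('i \<Rightarrow> cvec \<Rightarrow> cvec) \<Rightarrow> ('i \<Rightarrow> cvec \<Rightarrow> cvec) \<Rightarrow> bool" where
  "equal_on M f g \<longleftrightarrow> (\<forall>i. \<forall>x\<in>space_at M i. f i x = g i x)"

definition split_mono :: "'i rel \<Rightarrow> 'i rep \<Rightarrow> 'i rep \<Rightarrow> ('i \<Rightarrow> cvec \<Rightarrow> cvec) \<Rightarrow> bool" where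
  "split_mono Q M N f \<longleftrightarrow>
     morphism Q M N f \<and> (\<exists>r. morphism Q N M r \<and> equal_on M (compose_mor r f) (\<lambda>i. id))"

definition split_epi :: "'i rel \<Rightarrow> 'i rep \<Rightarrow> 'i rep \<Rightarrow> ('i \<Rightarrow> cvec \<Rightarrow> cvec) \<Rightarrow> bool" where
  "split_epi Q M N f \<longleftrightarrow>
     morphism Q M N f \<and> (\<exists>s. morphism Q N M s \<and> equal_on N (compose_mor f s) (\<lambda>i. id))"

definition irreducible_morphism ::
  "'i rel \<Rightarrow> 'i rep \<Rightarrow> 'i rep \<Rightarrow> ('i \<Rightarrow> cvec \<Rightarrow> cvec) \<Rightarrow> bool" where
  "irreducible_morphism Q M N f \<longleftrightarrow>
     morphism Q M N f \<and> \<not> split_mono Q M N f \<and> \<not> split_epi Q M N f \<and>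
     (\<forall>L g h. representation Q L \<and> morphism Q M L h \<and> morphism Q L N g \<and>
        equal_on M f (compose_mor g h) \<longrightarrow> split_mono Q M L h \<or> split_epi Q L N g)"

definition isomorphic_reps :: "'i rel \<Rightarrow> 'i rep \<Rightarrow> 'i rep \<Rightarrow> bool" where
  "isomorphic_reps Q M N \<longleftrightarrow>
     (\<exists>f g. morphism Q M N f \<and> morphism Q N M g \<and>
        equal_on M (compose_mor g f) (\<lambda>i. id) \<and> equal_on N (compose_mor f g) (\<lambda>i. id))"

definition subrep :: "'i rel \<Rightarrow> 'i rep \<Rightarrow> ('i \<Rightarrow> cvec set) \<Rightarrow> bool" where
  "subrep Q M U \<longleftrightarrow>
     (\<forall>i. cvec.subspace (U i) \<and> U i \<subseteq> space_at M i) \<and>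
     (\<forall>(i, j)\<in>Q. map_along M (i, j) ` U i \<subseteq> U j)"

definition direct_sum_of :: "'i rep \<Rightarrow> ('i \<Rightarrow> cvec set) \<Rightarrow> ('i \<Rightarrow> cvec set) \<Rightarrow> bool" where
  "direct_sum_of M U V \<longleftrightarrow>
     (\<forall>i. space_at M i = {x + y | x y. x \<in> U i \<and> y \<in> V i} \<and> U i \<inter> V i = {0})"

definition indecomposable :: "'i rel \<Rightarrow> 'i rep \<Rightarrow> bool" where
  "indecomposable Q M \<longleftrightarrow>
     representation Q M \<and> (\<exists>i. space_at M i \<noteq> {0}) \<and>
     (\<forall>U V. subrep Q M U \<and> subrep Q M V \<and> direct_sum_of M U V \<longrightarrow>
        (\<forall>i. U i = {0}) \<or> (\<forall>i. V i = {0}))"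

definition dimension_vector :: "('i::finite \<Rightarrow> 'e::euclidean_space) \<Rightarrow> 'i rep \<Rightarrow> 'e" where
  "dimension_vector \<alpha> M = (\<Sum>i\<in>UNIV. real (cvec.dim (space_at M i)) *\<^sub>R \<alpha> i)"


section \<open>The Auslander-Reiten quiver\<close>

definition iso_class :: "'i rel \<Rightarrow> 'i rep \<Rightarrow> 'i rep set" where
  "iso_class Q M = {N. representation Q N \<and> isomorphic_reps Q M N}"

definition AR_quiver :: "'i rel \<Rightarrow> 'i rep set pair_pre_digraph" where
  "AR_quiver Q =
     \<lparr> pverts = {iso_class Q M | M. indecomposable Q M},
       parcs = {(iso_class Q M, iso_class Q N) | M N.
         indecomposable Q M \<and> indecomposable Q N \<and> (\<exists>f. irreducible_morphism Q M N f)} \<rparr>"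

text \<open>\<open>root_class Q \<alpha> b\<close> is the class \<open>[b]\<close>; by Gabriel's theorem it is a single isomorphism class
  for each positive root \<open>b\<close>, and \<open>class_root\<close> is the inverse of the resulting bijection.\<close>

definition root_class :: "'i::finite rel \<Rightarrow> ('i \<Rightarrow> 'e::euclidean_space) \<Rightarrow> 'e \<Rightarrow> 'i rep set" where
  "root_class Q \<alpha> b = {M. indecomposable Q M \<and> dimension_vector \<alpha> M = b}"

definition class_root ::
  "'i::finite rel \<Rightarrow> 'e::euclidean_space set \<Rightarrow> ('i \<Rightarrow> 'e) \<Rightarrow> 'i rep set \<Rightarrow> 'e" where
  "class_root Q \<Phi> \<alpha> = the_inv_into (positive_roots \<Phi> \<alpha>) (root_class Q \<alpha>)"

end

theory Submission
  imports Defs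
begin

text \<open>If \<open>k\<close> is a sink of \<open>Q\<close>, reflecting at \<open>k\<close> identifies the representations of \<open>Q\<close> without direct
  summand concentrated at \<open>k\<close> with the representations of \<open>S\<^sub>k Q\<close> without such a summand; it
  acts on dimension vectors by the simple reflection and preserves indecomposability and
  irreducible morphisms. Reflecting along the adapted word, every indecomposable
  eventually becomes concentrated at the current sink, so the indecomposables are indexed by the
  positions of the word, and the dimension vector at position \<open>j\<close> is the root
  \<open>s\<^bsub>i\<^sub>1\<^esub> \<dots> \<alpha>\<^bsub>i\<^sub>j\<^esub>\<close>; this is the theorem of Gabriel. The same induction gives that
  \<open>- \<phi>\<close> maps this root to the weight at position \<open>j\<close>.

  Irreducible morphisms from position \<open>j\<close> to position \<open>m\<close> can be computed after reflecting the
  common prefix away, that is for the simple representation at a sink \<open>a\<close>. They exist if and only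
  if the target is the indecomposable projective at a neighbour \<open>b\<close> of \<open>a\<close>, which means
  that \<open>m\<close> is the first occurrence of \<open>b\<close> after \<open>j\<close>. Because neighbouring letters alternate in an adapted word, this is
  the condition that \<open>a\<close> does not reappear in between, and it characterizes the intersecting
  cosets: if \<open>a\<close> reappears, the inner product of the two weights differs from that of the two
  fundamental weights.\<close>


section \<open>Roots, words and the longest element\<close>

text \<open>The definition of an irreducible morphism quantifies over factorizations through every
  representation L, while reflection at a sink loses all summands concentrated there. The
  equivalence therefore carries a splitting condition: L has a retract that can be reflected, and
  passing to this retract leaves composites between reflectable representations unchanged, because
  such composites are determined away from the sink. Indecomposability is treated through idempotent
  endomorphisms, which move along the equivalence. The reflections have to stop: the dimension
  vector of an indecomposable surviving the whole word would be the longest element applied to a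
  vector with nonnegative coordinates, so all its coordinates would be at most 0 and the
  representation would vanish. The orientation changes with every letter, so the inductions along an
  adapted word generalize over the quiver, and the Ringel map is written as a function of the
  orientation.\<close>

locale simply_laced_system =
  fixes D :: "'i::finite rel"
    and \<Phi> :: "'e::euclidean_space set"
    and \<alpha> \<omega> :: "'i \<Rightarrow> 'e"
  assumes root_system: "root_system \<Phi>"
    and simple_system: "simple_system \<Phi> \<alpha>"
    and Dynkin: "has_Dynkin_diagram \<alpha> D"
    and weights: "fundamental_weights \<alpha> \<omega>"
    and D_sym: "(i, j) \<in> D \<Longrightarrow> (j, i) \<in> D"
    and D_irrefl: "(i, i) \<notin> D"
begin

abbreviation s :: "'i \<Rightarrow> 'e \<Rightarrow> 'e" where "s i \<equiv> reflection (\<alpha> i)"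
abbreviation word :: "'i list \<Rightarrow> 'e \<Rightarrow> 'e" where "word \<equiv> word_element \<alpha>"
abbreviation pos :: "'e set" where "pos \<equiv> positive_roots \<Phi> \<alpha>"

section \<open>Coordinates with respect to the simple roots\<close>

text \<open>The basis dual to the simple roots consists of the rescaled fundamental weights, so this
  is the coefficient of \<open>\<alpha> i\<close> in \<open>v\<close>. An inner product formula
  makes it a linear functional before the simple roots are known to span.\<close>

definition coord :: "'i \<Rightarrow> 'e \<Rightarrow> real" where
  "coord i v = 2 * (\<omega> i \<bullet> v) / (\<alpha> i \<bullet> \<alpha> i)"

lemma finite_roots: "finite \<Phi>"
  using root_system by (simp add: root_system_def)

lemma simple_root: "\<alpha> i \<in> \<Phi>"
  using simple_system by (auto simp: simple_system_def)

lemma zero_not_root: "0 \<notin> \<Phi>"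
  using root_system by (simp add: root_system_def)

lemma simple_nonzero: "\<alpha> i \<noteq> 0"
  using simple_root zero_not_root by metis

lemma reflection_root: "a \<in> \<Phi> \<Longrightarrow> b \<in> \<Phi> \<Longrightarrow> reflection a b \<in> \<Phi>"
  using root_system unfolding root_system_def by blast

lemma linear_reflection: "linear (reflection (a::'e))"
  unfolding reflection_def
  by (rule linearI) (auto simp: inner_add_left inner_diff_left algebra_simps add_divide_distrib)

lemma reflection_inner: "reflection a v \<bullet> reflection a w = v \<bullet> (w :: 'e)"
proof (cases "a = 0")
  case False
  then have "a \<bullet> a \<noteq> 0" by simp
  then show ?thesis
    by (simp add: reflection_def inner_diff_left inner_diff_right inner_commute field_simps)
qed (simp add: reflection_def)

lemma reflection_invol [simp]: "reflection a (reflection a v) = (v :: 'e)"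
proof (cases "a = 0")
  case False
  then have "a \<bullet> a \<noteq> 0" by simp
  then show ?thesis
    by (simp add: reflection_def inner_diff_left field_simps)
qed (simp add: reflection_def)

lemma s_simple: "s i (\<alpha> i) = - \<alpha> i"
  using simple_nonzero[of i] by (simp add: reflection_def scaleR_2)

lemma coord_linear: "linear (coord i)"
  unfolding coord_def by (rule linearI) (auto simp: inner_add_right add_divide_distrib algebra_simps)

lemmas coord_simps [simp] = linear_0[OF coord_linear] linear_add[OF coord_linear] linear_diff[OF coord_linear]
  linear_neg[OF coord_linear] linear_cmul[OF coord_linear] linear_sum[OF coord_linear]

lemma coord_simple: "coord i (\<alpha> j) = (if i = j then 1 else 0)"
proof -
  have "2 * (\<omega> i \<bullet> \<alpha> j) / (\<alpha> j \<bullet> \<alpha> j) = (if i = j then 1 else 0)"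
    using weights unfolding fundamental_weights_def by blast
  then show ?thesis using simple_nonzero[of j] by (auto simp: coord_def split: if_splits)
qed

lemma positive_rootD: assumes "b \<in> pos" shows "b \<in> \<Phi>" "coord i b \<ge> 0" "b = (\<Sum>i\<in>UNIV. coord i b *\<^sub>R \<alpha> i)"
proof -
  obtain c :: "'i \<Rightarrow> nat" where b: "b \<in> \<Phi>" "b = (\<Sum>i\<in>UNIV. real (c i) *\<^sub>R \<alpha> i)"
    using assms unfolding positive_roots_def by blast
  have c: "coord j b = real (c j)" for j
    by (subst b(2)) (simp add: coord_simple if_distrib cong: if_cong)
  show "b \<in> \<Phi>" "coord i b \<ge> 0" "b = (\<Sum>i\<in>UNIV. coord i b *\<^sub>R \<alpha> i)"
    using b c by auto
qed

lemma root_cases: "b \<in> \<Phi> \<Longrightarrow> b \<in> pos \<or> - b \<in> pos"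
  using simple_system by (auto simp: simple_system_def)

text \<open>The roots span, and each is up to sign a nonnegative combination of simple roots, so the
  simple roots span. Both sides are linear in \<open>v\<close>, which leaves the case of a simple
  root.\<close>

lemma expand: "v = (\<Sum>i\<in>UNIV. coord i v *\<^sub>R \<alpha> i)"
proof -
  have "span (range \<alpha>) = UNIV"
  proof -
    have "b \<in> span (range \<alpha>)" if "b \<in> \<Phi>" for b
    proof -
      have *: "c \<in> span (range \<alpha>)" if "c \<in> pos" for c
        by (subst positive_rootD(3)[OF that]) (intro span_sum span_scale span_base rangeI)
      show ?thesis using root_cases[OF that] *[of b] *[of "- b"] span_neg[of "- b" "range \<alpha>"] by auto
    qed
    then have "span \<Phi> \<subseteq> span (range \<alpha>)" by (simp add: span_minimal subsetI)
    then show ?thesis using root_system by (auto simp: root_system_def)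
  qed
  then have "v \<in> span (range \<alpha>)" by simp
  then show ?thesis
  proof (induction rule: span_induct_alt)
    case (step c x y)
    then obtain j where "x = \<alpha> j" by auto
    then have "(\<Sum>i\<in>UNIV. coord i (c *\<^sub>R x + y) *\<^sub>R \<alpha> i) = c *\<^sub>R (\<Sum>i\<in>UNIV. (if i = j then 1 else 0) *\<^sub>R \<alpha> i) + (\<Sum>i\<in>UNIV. coord i y *\<^sub>R \<alpha> i)"
      by (simp add: coord_simple scaleR_add_left sum.distrib scaleR_sum_right)
    also have "(\<Sum>i\<in>UNIV. (if i = j then 1 else 0) *\<^sub>R \<alpha> i) = \<alpha> j"
      by (simp add: if_distrib[of "\<lambda>c. c *\<^sub>R _"] cong: if_cong)
    finally show ?case using step \<open>x = \<alpha> j\<close> by simp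
  qed simp
qed

lemma coord_eqI: "(\<And>i. coord i v = coord i w) \<Longrightarrow> v = w"
  by (subst (1 2) expand) simp

lemma eq_by_inner: assumes "\<And>j. v \<bullet> \<alpha> j = w \<bullet> \<alpha> j" shows "v = w"
proof -
  have "x \<bullet> (v - w) = 0" for x
    by (subst expand[of x]) (simp add: inner_sum_left inner_diff_right assms inner_commute[of "\<alpha> _"])
  then show ?thesis by (metis eq_iff_diff_eq_0 inner_eq_zero_iff)
qed

lemma cartan: "2 * (\<alpha> i \<bullet> \<alpha> j) / (\<alpha> j \<bullet> \<alpha> j) = (if i = j then 2 else if (i, j) \<in> D then - 1 else 0)"
  using Dynkin unfolding has_Dynkin_diagram_def by blast

text \<open>By symmetry of \<open>D\<close> both Cartan integers of the pair are -1; the two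
  fractions share their numerator, so their denominators agree.\<close>

lemma linked_length: assumes "(i, j) \<in> D" shows "\<alpha> i \<bullet> \<alpha> i = \<alpha> j \<bullet> \<alpha> j"
proof -
  have ne: "i \<noteq> j" using assms D_irrefl by blast
  have "2 * (\<alpha> i \<bullet> \<alpha> j) / (\<alpha> j \<bullet> \<alpha> j) = -1" "2 * (\<alpha> j \<bullet> \<alpha> i) / (\<alpha> i \<bullet> \<alpha> i) = -1"
    unfolding cartan using ne assms D_sym[OF assms] by simp_all
  moreover have "\<alpha> i \<bullet> \<alpha> i \<noteq> 0" "\<alpha> j \<bullet> \<alpha> j \<noteq> 0" using simple_nonzero by simp_all
  ultimately have "2 * (\<alpha> i \<bullet> \<alpha> j) = - (\<alpha> j \<bullet> \<alpha> j)" "2 * (\<alpha> j \<bullet> \<alpha> i) = - (\<alpha> i \<bullet> \<alpha> i)"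
    by (simp_all only: divide_eq_eq split: if_splits)
  then show ?thesis by (simp add: inner_commute)
qed

lemma coroot: "2 * (v \<bullet> \<alpha> k) / (\<alpha> k \<bullet> \<alpha> k) = 2 * coord k v - (\<Sum>j | (j, k) \<in> D. coord j v)"
proof -
  have "2 * (v \<bullet> \<alpha> k) / (\<alpha> k \<bullet> \<alpha> k) = (\<Sum>i\<in>UNIV. coord i v * (2 * (\<alpha> i \<bullet> \<alpha> k) / (\<alpha> k \<bullet> \<alpha> k)))"
    by (subst expand) (simp add: inner_sum_left sum_distrib_left sum_divide_distrib ac_simps)
  also have "\<dots> = (\<Sum>i\<in>UNIV. (if i = k then 2 * coord i v else 0) - (if (i, k) \<in> D then coord i v else 0))"
    by (intro sum.cong refl, subst cartan) (use D_irrefl in auto)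
  finally show ?thesis by (simp add: sum_subtractf sum.If_cases Collect_conj_eq[symmetric])
qed

text \<open>The same arithmetic governs dimensions in the exact sequence attached to a sink, where
  the new dimension at \<open>k\<close> is the sum over the neighbours minus the old one.\<close>

lemma coord_s: "coord i (s k v) = (if i = k then (\<Sum>j | (j, k) \<in> D. coord j v) - coord k v else coord i v)"
proof -
  have "s k v = v - (2 * coord k v - (\<Sum>j | (j, k) \<in> D. coord j v)) *\<^sub>R \<alpha> k"
    unfolding reflection_def coroot ..
  then show ?thesis by (auto simp: coord_simple simp del: linear_sum)
qed

lemma simple_positive: "\<alpha> i \<in> pos"
  unfolding positive_roots_def
  using simple_root[of i]
  by (auto intro!: exI[of _ "\<lambda>j. if j = i then 1 else 0"] simp: if_distrib[of "\<lambda>c. c *\<^sub>R _"] if_distrib[of real] cong: if_cong)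

lemma negative_not_positive: assumes "b \<in> pos" shows "- b \<notin> pos"
proof
  assume "- b \<in> pos"
  then have "coord i b = 0" for i
    using positive_rootD(2)[OF assms, of i] positive_rootD(2)[of "- b" i] by simp
  then have "b = 0" by (intro coord_eqI) simp
  then show False using positive_rootD(1)[OF assms] zero_not_root by simp
qed

text \<open>If the image is negative, the coordinates of \<open>b\<close> away from \<open>k\<close>
  are both nonnegative and nonpositive. Then \<open>b\<close> is a multiple of
  \<open>\<alpha> k\<close>, and the only such roots are \<open>\<alpha> k\<close> and its
  negative.\<close>

lemma s_positive: assumes "b \<in> pos" "b \<noteq> \<alpha> k" shows "s k b \<in> pos"
proof (rule ccontr)
  assume "s k b \<notin> pos"
  then have neg: "- s k b \<in> pos"
    using reflection_root[OF simple_root positive_rootD(1)[OF assms(1)]] root_cases by blast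
  have "coord i b = 0" if "i \<noteq> k" for i
    using positive_rootD(2)[OF neg, of i] positive_rootD(2)[OF assms(1), of i] that by (simp add: coord_s)
  then have "b = coord k b *\<^sub>R \<alpha> k"
    by (intro coord_eqI) (auto simp: coord_simple)
  moreover from this have "coord k b = 1 \<or> coord k b = -1"
    using root_system positive_rootD(1)[OF assms(1)] simple_root[of k] unfolding root_system_def by metis
  ultimately show False using assms(2) positive_rootD(2)[OF assms(1), of k] by auto
qed

section \<open>Words, the exchange argument and length as number of inversions\<close>

lemma word_Nil [simp]: "word [] v = v"
  and word_Cons [simp]: "word (i # u) v = s i (word u v)"
  by (simp_all add: word_element_def)

lemma word_append [simp]: "word (u @ w) v = word u (word w v)"
  by (induction u) auto

lemma linear_word: "linear (word u)"
proof (induction u)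
  case Nil
  then show ?case by (intro linearI) auto
next
  case (Cons i u)
  then show ?case
    by (intro linearI) (simp_all add: linear_add[OF linear_reflection] linear_cmul[OF linear_reflection] linear_add linear_cmul)
qed

lemma word_inner: "word u v \<bullet> word u w = v \<bullet> w"
  by (induction u) (auto simp: reflection_inner)

lemma word_rev [simp]: "word u (word (rev u) v) = v" "word (rev u) (word u v) = v"
  by (induction u arbitrary: v) auto

lemma word_root: "b \<in> \<Phi> \<Longrightarrow> word u b \<in> \<Phi>"
  by (induction u) (auto intro: reflection_root simple_root)

lemma coord_word: "i \<notin> set u \<Longrightarrow> coord i (word u v) = coord i v"
  by (induction u) (auto simp: coord_s)

text \<open>A root-theoretic substitute for being reduced. Quantifying over infixes rather than
  prefixes makes it pass to every infix, in particular to the tail that remains after reflecting at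
  the head of the word.\<close>

definition positive_word :: "'i list \<Rightarrow> bool" where
  "positive_word w \<longleftrightarrow> (\<forall>u v j x. w = u @ v @ j # x \<longrightarrow> word v (\<alpha> j) \<in> pos)"

lemma positive_wordD: "positive_word (u @ v @ j # x) \<Longrightarrow> word v (\<alpha> j) \<in> pos"
  unfolding positive_word_def by blast

lemma positive_word_infix: assumes "positive_word (u @ v @ x)" shows "positive_word v"
  unfolding positive_word_def
proof (intro allI impI)
  fix a b j c assume "v = a @ b @ j # c"
  then show "word b (\<alpha> j) \<in> pos" using positive_wordD[of "u @ a" b j "c @ x"] assms by simp
qed

lemma positive_word_Cons: "positive_word (i # u) \<Longrightarrow> positive_word u"
  using positive_word_infix[of "[i]" u "[]"] by simp

text \<open>The exchange argument. Since \<open>\<alpha> j\<close> is positive and its image is not,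
  some letter \<open>i\<close> changes the sign. A simple reflection makes only its own simple root
  negative, so the root has become \<open>\<alpha> i\<close> at this stage, and conjugation cancels
  \<open>i\<close> against \<open>j\<close>.\<close>

lemma deletion: assumes "word v (\<alpha> j) \<notin> pos"
  obtains x i y where "v = x @ i # y" "\<And>z. word v (s j z) = word x (word y z)" "word y (\<alpha> j) = \<alpha> i"
  using assms
proof (induction v arbitrary: thesis)
  case Nil
  then show ?case using simple_positive by simp
next
  case (Cons k v)
  show ?case
  proof (cases "word v (\<alpha> j) \<in> pos")
    case True
    then have eq: "word v (\<alpha> j) = \<alpha> k" using Cons.prems(2) s_positive by auto
    \<comment> \<open>An isometry conjugates the reflection in a root into the reflection in its
      image, and here \<open>\<alpha> j\<close> has image \<open>\<alpha> k\<close>.\<close>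
    have "s k (word v z) = word v (s j z)" for z
    proof -
      have *: "word v z \<bullet> \<alpha> k = z \<bullet> \<alpha> j" and **: "\<alpha> k \<bullet> \<alpha> k = \<alpha> j \<bullet> \<alpha> j"
        by (simp_all add: eq[symmetric] word_inner)
      show ?thesis
        by (simp add: reflection_def * ** linear_diff[OF linear_word] linear_cmul[OF linear_word] eq)
    qed
    then have "s k (word v (s j z)) = word v z" for z by simp
    then show ?thesis using Cons.prems(1)[of "[]" k v] eq by simp
  next
    case False
    obtain x i y where "v = x @ i # y" "\<And>z. word v (s j z) = word x (word y z)" "word y (\<alpha> j) = \<alpha> i"
      using Cons.IH[OF _ False] by metis
    then show ?thesis using Cons.prems(1)[of "k # x" i y] by simp
  qed
qed

lemma weyl_length_le: "weyl_length \<alpha> (word u) \<le> length u"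
  unfolding weyl_length_def by (rule Least_le) auto

lemma reduced_exists: obtains v where "word v = word u" "length v = weyl_length \<alpha> (word u)"
proof -
  have "\<exists>v. length v = weyl_length \<alpha> (word u) \<and> word v = word u"
    unfolding weyl_length_def by (rule LeastI) auto
  then show ?thesis using that by blast
qed

text \<open>A violation would let two letters be deleted without changing the group element.\<close>

lemma reduced_positive: assumes "length w = weyl_length \<alpha> (word w)" shows "positive_word w"
  unfolding positive_word_def
proof (intro allI impI, rule ccontr)
  fix u v j x assume w: "w = u @ v @ j # x" and n: "word v (\<alpha> j) \<notin> pos"
  obtain a i b where *: "v = a @ i # b" "\<And>z. word v (s j z) = word a (word b z)" using deletion[OF n] by metis
  have "word w = word (u @ a @ b @ x)"
  proof
    fix z show "word w z = word (u @ a @ b @ x) z"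
      using *(2) by (simp add: w)
  qed
  then have "weyl_length \<alpha> (word w) \<le> length (u @ a @ b @ x)" using weyl_length_le[of "u @ a @ b @ x"] by simp
  then show False using assms by (simp add: w *)
qed

definition inversions :: "'i list \<Rightarrow> 'e set" where
  "inversions u = {b \<in> pos. word u b \<notin> pos}"

lemma finite_pos: "finite pos"
  using finite_roots by (simp add: positive_roots_def)

lemma finite_inversions: "finite (inversions u)"
  using finite_pos by (simp add: inversions_def)

lemma inj_s: "inj (s j)"
  by (metis injI reflection_invol)

text \<open>The reflection in \<open>\<alpha> j\<close> permutes the positive roots other than
  \<open>\<alpha> j\<close>, so it carries the inversions of the extended word, apart from
  \<open>\<alpha> j\<close>, to inversions of \<open>u\<close>.\<close>

lemma inversions_snoc_le: "card (inversions (u @ [j])) \<le> Suc (card (inversions u))"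
proof -
  have "inversions (u @ [j]) \<subseteq> insert (\<alpha> j) (s j ` inversions u)"
  proof
    fix b assume b: "b \<in> inversions (u @ [j])"
    show "b \<in> insert (\<alpha> j) (s j ` inversions u)"
    proof (cases "b = \<alpha> j")
      case False
      then have "s j b \<in> inversions u" using b s_positive by (auto simp: inversions_def)
      then show ?thesis by (metis image_eqI insertCI reflection_invol)
    qed simp
  qed
  then have "card (inversions (u @ [j])) \<le> card (insert (\<alpha> j) (s j ` inversions u))"
    by (intro card_mono) (auto simp: finite_inversions)
  also have "\<dots> \<le> Suc (card (s j ` inversions u))" by (simp add: finite_inversions card_insert_if)
  also have "\<dots> \<le> Suc (card (inversions u))" by (simp add: card_image_le finite_inversions)
  finally show ?thesis .
qed

text \<open>Positivity of the image of \<open>\<alpha> j\<close> makes \<open>\<alpha> j\<close> a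
  new inversion, and no old one is lost.\<close>

lemma inversions_snoc:
  assumes "word u (\<alpha> j) \<in> pos"
  shows "card (inversions (u @ [j])) = Suc (card (inversions u))"
proof -
  have "\<alpha> j \<in> inversions (u @ [j])"
    using simple_positive negative_not_positive[OF assms]
    by (auto simp: inversions_def s_simple linear_neg[OF linear_word])
  moreover have "s j b \<in> inversions (u @ [j])" if "b \<in> inversions u" for b
    using that assms s_positive[of b j] by (auto simp: inversions_def)
  ultimately have "insert (\<alpha> j) (s j ` inversions u) \<subseteq> inversions (u @ [j])" by auto
  moreover have "\<alpha> j \<notin> s j ` inversions u"
  proof
    assume "\<alpha> j \<in> s j ` inversions u"
    then obtain b where "b \<in> pos" "\<alpha> j = s j b" by (auto simp: inversions_def)
    then have "b = - \<alpha> j" by (metis reflection_invol s_simple)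
    then show False using \<open>b \<in> pos\<close> negative_not_positive simple_positive by metis
  qed
  ultimately have "Suc (card (inversions u)) \<le> card (inversions (u @ [j]))"
    using card_mono[OF finite_inversions, of "insert (\<alpha> j) (s j ` inversions u)" "u @ [j]"]
    by (simp add: finite_inversions card_image inj_on_subset[OF inj_s])
  then show ?thesis using inversions_snoc_le[of u j] by simp
qed

lemma inversions_positive_word: "positive_word u \<Longrightarrow> card (inversions u) = length u"
proof (induction u rule: rev_induct)
  case Nil
  then show ?case by (simp add: inversions_def)
next
  case (snoc j u)
  have "word u (\<alpha> j) \<in> pos" using positive_wordD[of "[]" u j "[]"] snoc.prems by simp
  moreover have "positive_word u" using positive_word_infix[of "[]" u "[j]"] snoc.prems by simp
  ultimately show ?case using inversions_snoc snoc.IH by simp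
qed

text \<open>Inversions depend only on the group element, so they may be counted on a shortest word,
  which is a positive word.\<close>

lemma weyl_length_inversions: "weyl_length \<alpha> (word u) = card (inversions u)"
proof -
  obtain v where v: "word v = word u" "length v = weyl_length \<alpha> (word u)" by (rule reduced_exists)
  then have "inversions v = inversions u" by (simp add: inversions_def)
  then show ?thesis using v reduced_positive[of v] inversions_positive_word[of v] by simp
qed

lemma weyl_length_le_card: "weyl_length \<alpha> (word u) \<le> card pos"
  unfolding weyl_length_inversions inversions_def by (intro card_mono finite_pos) auto

section \<open>The Weyl group, its parabolic subgroups and the longest element\<close>

lemma reflection_Bij: "s i \<in> carrier (BijGroup UNIV)"
proof -
  have "bij (s i)" by (metis bij_betw_def inj_s reflection_invol surjI)
  then show ?thesis by (simp add: BijGroup_def Bij_def)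
qed

lemma Bij_mult: "f \<in> carrier (BijGroup UNIV) \<Longrightarrow> g \<in> carrier (BijGroup UNIV) \<Longrightarrow>
    f \<otimes>\<^bsub>BijGroup UNIV\<^esub> g = f \<circ> g"
  by (auto simp: BijGroup_def compose_def fun_eq_iff)

lemma Bij_one: "\<one>\<^bsub>BijGroup UNIV\<^esub> = id"
  by (auto simp: BijGroup_def)

lemma Bij_inv_s: "inv\<^bsub>BijGroup UNIV\<^esub> (s i) = s i"
  by (rule group.inv_equality[OF group_BijGroup])
     (simp_all add: Bij_mult reflection_Bij Bij_one fun_eq_iff)

lemma word_Bij: "word u \<in> carrier (BijGroup UNIV)"
proof -
  have "bij (word u)" by (metis bijI' word_rev)
  then show ?thesis by (simp add: BijGroup_def Bij_def)
qed

lemma word_mult: "word u \<otimes>\<^bsub>BijGroup UNIV\<^esub> word v = word (u @ v)"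
  by (simp add: Bij_mult word_Bij fun_eq_iff)

lemma word_one: "\<one>\<^bsub>BijGroup UNIV\<^esub> = word []"
  by (simp add: Bij_one fun_eq_iff)

lemma word_single: "s i = word [i]"
  by (simp add: fun_eq_iff)

text \<open>Simple reflections are involutions, so inverses add nothing to products of generators.
  The parameter \<open>J\<close> serves both the Weyl group and the parabolic subgroups.\<close>

lemma generate_words:
  "generate (BijGroup UNIV) ((\<lambda>j. s j) ` J) = {word u | u. set u \<subseteq> J}"
proof safe
  fix w assume "w \<in> generate (BijGroup UNIV) ((\<lambda>j. s j) ` J)"
  then show "\<exists>u. w = word u \<and> set u \<subseteq> J"
  proof (induction rule: generate.induct)
    case one
    then show ?case by (intro exI[of _ "[]"]) (simp add: word_one)
  next
    case (incl h)
    then obtain j where j: "j \<in> J" "h = s j" by auto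
    then have "h = word [j]" by (simp only: word_single)
    moreover have "set [j] \<subseteq> J" using j by simp
    ultimately show ?case by blast
  next
    case (inv h)
    then obtain j where j: "j \<in> J" "h = s j" by auto
    then have "inv\<^bsub>BijGroup UNIV\<^esub> h = word [j]" by (simp only: Bij_inv_s word_single[symmetric])
    moreover have "set [j] \<subseteq> J" using j by simp
    ultimately show ?case by blast
  next
    case (eng h1 h2)
    then obtain u v where "h1 = word u" "set u \<subseteq> J" "h2 = word v" "set v \<subseteq> J" by blast
    then show ?case by (intro exI[of _ "u @ v"]) (simp add: word_mult)
  qed
next
  fix u assume "set u \<subseteq> J"
  then show "word u \<in> generate (BijGroup UNIV) ((\<lambda>j. s j) ` J)"
  proof (induction u)
    case Nil
    then show ?case using generate.one[of "BijGroup UNIV"] by (metis word_one)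
  next
    case (Cons j u)
    then have "s j \<otimes>\<^bsub>BijGroup UNIV\<^esub> word u \<in> generate (BijGroup UNIV) ((\<lambda>j. s j) ` J)"
      by (intro generate.eng) (auto intro: generate.incl)
    then have "word [j] \<otimes>\<^bsub>BijGroup UNIV\<^esub> word u \<in> generate (BijGroup UNIV) ((\<lambda>j. s j) ` J)"
      by (simp only: word_single)
    then show ?case by (simp only: word_mult append.simps)
  qed
qed

lemma weyl_group_words: "weyl_group \<alpha> = range word"
  unfolding weyl_group_def using generate_words[of UNIV] by auto

text \<open>The choice operator returns a genuine maximum because lengths are bounded by the number
  of positive roots.\<close>

lemma longest_element:
  obtains u where "longest_element \<alpha> = word u"
    "\<And>v. weyl_length \<alpha> (word v) \<le> weyl_length \<alpha> (word u)"
proof -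
  have bound: "weyl_length \<alpha> w < Suc (card pos)" if "w \<in> weyl_group \<alpha>" for w
  proof -
    obtain u where "w = word u" using \<open>w \<in> weyl_group \<alpha>\<close> unfolding weyl_group_words by auto
    then show ?thesis using weyl_length_le_card[of u] by simp
  qed
  have "word [] \<in> weyl_group \<alpha>" unfolding weyl_group_words by blast
  from arg_max_natI[of "\<lambda>w. w \<in> weyl_group \<alpha>", OF this, of "weyl_length \<alpha>" "Suc (card pos)"] bound
  have in_W: "longest_element \<alpha> \<in> weyl_group \<alpha>" by (auto simp: longest_element_def)
  have "weyl_length \<alpha> w \<le> weyl_length \<alpha> (longest_element \<alpha>)" if "w \<in> weyl_group \<alpha>" for w
    unfolding longest_element_def
    using arg_max_nat_le[of "\<lambda>w. w \<in> weyl_group \<alpha>", OF that, of "weyl_length \<alpha>" "Suc (card pos)"] bound by auto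
  note max = this
  obtain u where u: "longest_element \<alpha> = word u" using in_W unfolding weyl_group_words by auto
  have "weyl_length \<alpha> (word v) \<le> weyl_length \<alpha> (word u)" for v
    using max[of "word v"] u unfolding weyl_group_words by simp
  then show ?thesis using that u by metis
qed

text \<open>If a simple root stayed positive, appending its letter would increase the length. Hence
  all simple roots become negative, and with them their nonnegative combinations.\<close>

lemma longest_negative:
  assumes "b \<in> pos" shows "- longest_element \<alpha> b \<in> pos"
proof -
  obtain u where u: "longest_element \<alpha> = word u" "\<And>v. weyl_length \<alpha> (word v) \<le> weyl_length \<alpha> (word u)"
    using longest_element by metis
  have neg: "- word u (\<alpha> j) \<in> pos" for j
  proof (rule ccontr)
    assume "- word u (\<alpha> j) \<notin> pos"
    then have "word u (\<alpha> j) \<in> pos" using root_cases[OF word_root[OF simple_root]] by metis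
    then show False using inversions_snoc[of u j] u(2)[of "u @ [j]"] by (simp add: weyl_length_inversions)
  qed
  have "coord i (word u b) \<le> 0" for i
  proof -
    have "coord i (word u b) = (\<Sum>j\<in>UNIV. coord j b * coord i (word u (\<alpha> j)))"
      using arg_cong[OF expand[of b], of "\<lambda>b. coord i (word u b)"]
      by (simp add: linear_sum[OF linear_word] linear_cmul[OF linear_word])
    also have "\<dots> \<le> 0"
    proof (intro sum_nonpos mult_nonneg_nonpos)
      fix j show "0 \<le> coord j b" by (rule positive_rootD(2)[OF assms])
      show "coord i (word u (\<alpha> j)) \<le> 0" using positive_rootD(2)[OF neg[of j], of i] by simp
    qed
    finally show ?thesis .
  qed
  note nonpos = this
  have root: "word u b \<in> \<Phi>" using word_root positive_rootD(1)[OF assms] by blast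
  have "word u b \<notin> pos"
  proof
    assume "word u b \<in> pos"
    then have "coord i (word u b) = coord i 0" for i
      using nonpos[of i] positive_rootD(2)[of "word u b" i] by simp
    then show False using coord_eqI root zero_not_root by metis
  qed
  then show ?thesis using root_cases[OF root] u by simp
qed

end


section \<open>Adapted words and the abstract quiver\<close>

lemma orientation_irrefl: "orientation_of D Q \<Longrightarrow> (i, i) \<notin> Q"
  by (auto simp: orientation_of_def)

lemma orientation_linked: "orientation_of D Q \<Longrightarrow> (i, j) \<in> D \<longleftrightarrow> (i, j) \<in> Q \<or> (j, i) \<in> Q"
  by (auto simp: orientation_of_def)

lemma reverse_at_iff:
  "(i, j) \<in> reverse_at k Q \<longleftrightarrow> (i, j) \<in> Q \<and> j \<noteq> k \<or> i = k \<and> (j, k) \<in> Q"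
  by (auto simp: reverse_at_def)

lemma orientation_reverse_at:
  assumes "orientation_of D Q" shows "orientation_of D (reverse_at k Q)"
  using assms by (fastforce simp: orientation_of_def reverse_at_def set_eq_iff)

lemma adapted_append: "adapted Q (u @ v) \<longleftrightarrow> adapted Q u \<and> adapted (fold reverse_at u Q) v"
  by (induction u arbitrary: Q) auto

lemma orientation_fold:
  "orientation_of D Q \<Longrightarrow> orientation_of D (fold reverse_at u Q)"
  by (induction u arbitrary: Q) (auto intro: orientation_reverse_at)

text \<open>As long as the arrow from \<open>a\<close> to \<open>b\<close> persists,
  \<open>a\<close> is no sink and cannot be the next letter; only a reversal at \<open>b\<close>
  turns this arrow around.\<close>

lemma neighbour_between_aux:
  "adapted Q (u @ [a]) \<Longrightarrow> (a, b) \<in> Q \<Longrightarrow> b \<in> set u"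
proof (induction u arbitrary: Q)
  case Nil
  then show ?case by (auto simp: sink_def)
next
  case (Cons c u)
  then have "c \<noteq> a" by (auto simp: sink_def)
  show ?case
  proof (cases "c = b")
    case False
    then have "(a, b) \<in> reverse_at c Q" using Cons.prems by (simp add: reverse_at_iff)
    then show ?thesis using Cons.IH[of "reverse_at c Q"] Cons.prems by simp
  qed simp
qed

text \<open>Reversal at the sink \<open>a\<close> makes all its arrows point outwards, so each
  neighbour has to be used before \<open>a\<close> is a sink again.\<close>

lemma neighbour_between:
  assumes "orientation_of D Q" "adapted Q (a # u @ [a])" "(a, b) \<in> D" shows "b \<in> set u"
proof -
  have "(b, a) \<in> Q" using assms by (auto simp: orientation_linked sink_def)
  then have "(a, b) \<in> reverse_at a Q" by (simp add: reverse_at_iff)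
  then show ?thesis using neighbour_between_aux[of "reverse_at a Q" u a b] assms(2) by simp
qed

text \<open>Linked letters alternate: a second \<open>a\<close> needs a \<open>b\<close> in between,
  and an earlier \<open>b\<close> needs an \<open>a\<close> before the final \<open>b\<close>. This
  exchanges the condition on \<open>b\<close> that representations see for the condition on
  \<open>a\<close> that cosets see.\<close>

lemma gap_symmetric:
  assumes "orientation_of D Q" "adapted Q (a # u @ b # x)" "(a, b) \<in> D"
  shows "a \<in> set u \<longleftrightarrow> b \<in> set u"
proof
  assume "a \<in> set u"
  then obtain u1 u2 where u: "u = u1 @ a # u2" by (meson split_list)
  have "(a # u1 @ [a]) @ (u2 @ b # x) = a # u @ b # x" by (simp add: u)
  then have "adapted Q (a # u1 @ [a])" using assms(2) by (metis adapted_append)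
  then show "b \<in> set u" using neighbour_between[OF assms(1) _ assms(3)] u by auto
next
  assume "b \<in> set u"
  then obtain u1 u2 where u: "u = u1 @ b # u2" by (meson split_list)
  have eq: "(a # u1) @ (b # u2 @ [b]) @ x = a # u @ b # x" by (simp add: u)
  then have "adapted (fold reverse_at (a # u1) Q) (b # u2 @ [b])" using assms(2) by (metis adapted_append)
  moreover have "(b, a) \<in> D" using assms(1,3) by (auto simp: orientation_of_def)
  ultimately show "a \<in> set u"
    using neighbour_between[OF orientation_fold[OF assms(1)], of "a # u1" b u2 a] u by auto
qed

context simply_laced_system
begin

section \<open>The Ringel map and its behaviour under reflections\<close>

text \<open>Pairing with the simple coroot, equivalently the coordinate along
  \<open>\<omega> j\<close>. The Ringel map is computed from \<open>coord\<close> on its domain to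
  \<open>pair\<close> on its range.\<close>

definition pair :: "'i \<Rightarrow> 'e \<Rightarrow> real" where
  "pair j v = 2 * (v \<bullet> \<alpha> j) / (\<alpha> j \<bullet> \<alpha> j)"

lemma pair_linear: "linear (pair j)"
  unfolding pair_def by (rule linearI) (auto simp: inner_add_left add_divide_distrib algebra_simps)

lemmas pair_simps [simp] = linear_0[OF pair_linear] linear_add[OF pair_linear] linear_diff[OF pair_linear]
  linear_neg[OF pair_linear] linear_cmul[OF pair_linear] linear_sum[OF pair_linear]

lemma pair_weight: "pair j (\<omega> i) = (if i = j then 1 else 0)"
  using weights by (simp add: fundamental_weights_def pair_def)

lemma pair_simple: "pair j (\<alpha> i) = (if i = j then 2 else if (i, j) \<in> D then - 1 else 0)"
  using cartan by (simp add: pair_def)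

lemma pair_eqI: assumes "\<And>j. pair j v = pair j w" shows "v = w"
proof (rule eq_by_inner)
  fix j
  have "\<alpha> j \<bullet> \<alpha> j \<noteq> 0" using simple_nonzero by simp
  then show "v \<bullet> \<alpha> j = w \<bullet> \<alpha> j" using assms[of j] by (simp add: pair_def)
qed

lemma s_pair: "s k v = v - pair k v *\<^sub>R \<alpha> k"
  by (simp add: reflection_def pair_def)

lemma s_weight: "s k (\<omega> i) = (if i = k then \<omega> i - \<alpha> i else \<omega> i)"
  by (simp add: s_pair pair_weight)

lemma word_weight: "i \<notin> set u \<Longrightarrow> word u (\<omega> i) = \<omega> i"
  by (induction u) (auto simp: s_weight)

text \<open>The coefficient of \<open>\<omega> l\<close> is the Ringel form of
  \<open>\<alpha> l\<close> with \<open>v\<close>. Writing it through the orientation gives one such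
  map for each quiver met along an adapted word.\<close>

definition ringel :: "'i rel \<Rightarrow> 'e \<Rightarrow> 'e" where
  "ringel Q v = (\<Sum>l\<in>UNIV. (coord l v - (\<Sum>j | (l, j) \<in> Q. coord j v)) *\<^sub>R \<omega> l)"

lemma pair_ringel: "pair l (ringel Q v) = coord l v - (\<Sum>j | (l, j) \<in> Q. coord j v)"
  by (simp add: ringel_def pair_weight if_distrib cong: if_cong)

lemma ringel_linear: "linear (ringel Q)"
  by (rule linearI; rule pair_eqI)
     (simp_all add: pair_ringel sum.distrib sum_distrib_left right_diff_distrib del: linear_sum)

text \<open>In weight coordinates only the arrows at \<open>k\<close> matter. The row of
  \<open>k\<close> is empty at the sink and contains all neighbours after reversal, while the row of
  a neighbour loses the entry \<open>k\<close>; subtracting \<open>pair k\<close> times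
  \<open>\<alpha> k\<close> accounts for both.\<close>

lemma ringel_s:
  assumes "orientation_of D Q" "sink Q k"
  shows "ringel Q (s k v) = s k (ringel (reverse_at k Q) v)"
proof (rule pair_eqI)
  fix l
  let ?Q = "reverse_at k Q"
  have out_k: "{j. (k, j) \<in> ?Q} = {j. (j, k) \<in> D}"
    using assms by (auto simp: reverse_at_iff orientation_linked sink_def)
  have sink_k: "{j. (k, j) \<in> Q} = {}" using assms(2) by (auto simp: sink_def)
  show "pair l (ringel Q (s k v)) = pair l (s k (ringel ?Q v))"
  proof (cases "l = k")
    case True
    then show ?thesis
      by (simp add: s_pair[of k "ringel ?Q v"] pair_ringel pair_simple coord_s out_k sink_k)
  next
    case False
    have k_D: "(l, k) \<in> Q \<longleftrightarrow> (k, l) \<in> D"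
      using assms by (auto simp: orientation_linked sink_def)
    have "{j. (l, j) \<in> ?Q} = {j. (l, j) \<in> Q} - {k}" using False by (auto simp: reverse_at_iff)
    then have "(\<Sum>j | (l, j) \<in> Q. coord j (s k v)) =
        (\<Sum>j | (l, j) \<in> ?Q. coord j (s k v)) + (if (l, k) \<in> Q then coord k (s k v) else 0)"
      by (auto simp: sum.remove[of "{j. (l, j) \<in> Q}" k])
    also have "(\<Sum>j | (l, j) \<in> ?Q. coord j (s k v)) = (\<Sum>j | (l, j) \<in> ?Q. coord j v)"
      using False by (intro sum.cong refl) (auto simp: coord_s reverse_at_iff)
    finally show ?thesis using False k_D
      by (simp add: s_pair[of k "ringel ?Q v"] pair_ringel pair_simple coord_s out_k)
  qed
qed

text \<open>All neighbours of a sink \<open>i\<close> have arrows into \<open>i\<close>, so the map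
  sends \<open>\<alpha> i\<close> to \<open>\<omega> i\<close> minus the neighbouring weights. This
  is \<open>\<alpha> i - \<omega> i\<close>, the negative of the reflected weight. The preceding
  letters pass through the map by \<open>ringel_s\<close>.\<close>

lemma ringel_word:
  "orientation_of D Q \<Longrightarrow> adapted Q (u @ [i]) \<Longrightarrow>
    - ringel Q (word u (\<alpha> i)) = word (u @ [i]) (\<omega> i)"
proof (induction u arbitrary: Q)
  case Nil
  show ?case
  proof (rule pair_eqI)
    fix l
    have "{j. (l, j) \<in> Q \<and> j = i} = (if (l, i) \<in> Q then {i} else {})" by auto
    moreover have "l \<noteq> i \<Longrightarrow> (l, i) \<in> Q \<longleftrightarrow> (i, l) \<in> D"
      using Nil by (auto simp: orientation_linked sink_def)
    moreover have "(i, i) \<notin> Q" using Nil by (auto simp: sink_def)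
    ultimately show "pair l (- ringel Q (word [] (\<alpha> i))) = pair l (word ([] @ [i]) (\<omega> i))"
      by (auto simp: pair_ringel coord_simple s_weight pair_weight pair_simple sum.If_cases Collect_conj_eq[symmetric])
  qed
next
  case (Cons k u)
  have "- ringel Q (word (k # u) (\<alpha> i)) = - s k (ringel (reverse_at k Q) (word u (\<alpha> i)))"
    using Cons.prems by (simp add: ringel_s)
  also have "\<dots> = s k (- ringel (reverse_at k Q) (word u (\<alpha> i)))"
    by (simp add: linear_neg[OF linear_reflection])
  also have "\<dots> = word ((k # u) @ [i]) (\<omega> i)"
    using Cons.IH[of "reverse_at k Q"] Cons.prems orientation_reverse_at[of D Q k] by simp
  finally show ?case .
qed

lemma ringel_map_unique:
  assumes "orientation_of D Q" "ringel_form Q \<alpha> R" "ringel_map \<alpha> \<omega> R \<phi>"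
  shows "\<phi> = ringel Q"
proof
  fix v
  have lin: "linear \<phi>" using assms(3) by (simp add: ringel_map_def)
  have "\<phi> (\<alpha> i) = ringel Q (\<alpha> i)" for i
  proof -
    have "{j. (l, j) \<in> Q \<and> j = i} = (if (l, i) \<in> Q then {i} else {})" for l by auto
    then have "R (\<alpha> l) (\<alpha> i) = coord l (\<alpha> i) - (\<Sum>j | (l, j) \<in> Q. coord j (\<alpha> i))" for l
      using assms(2) orientation_irrefl[OF assms(1)]
      by (auto simp: ringel_form_def coord_simple sum.If_cases Collect_conj_eq[symmetric])
    then show ?thesis using assms(3) by (simp add: ringel_map_def ringel_def)
  qed
  then show "\<phi> v = ringel Q v"
    using arg_cong[OF expand[of v], of \<phi>] arg_cong[OF expand[of v], of "ringel Q"]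
    by (simp add: linear_sum[OF lin] linear_cmul[OF lin] linear_sum[OF ringel_linear] linear_cmul[OF ringel_linear])
qed

text \<open>At a sink the weight coordinate of the image is the root coordinate of \<open>v\<close>,
  which therefore vanishes, and the reflected vector lies in the kernel for the next orientation.
  Coordinates away from the sink survive the reflection, so each letter of the word kills its own
  coordinate.\<close>

lemma ringel_kernel:
  "orientation_of D Q \<Longrightarrow> adapted Q w \<Longrightarrow> ringel Q v = 0 \<Longrightarrow> i \<in> set w \<Longrightarrow> coord i v = 0"
proof (induction w arbitrary: Q v)
  case (Cons k w)
  have "pair k (ringel Q v) = coord k v"
    using Cons.prems(2) by (simp add: pair_ringel sink_def)
  then have k: "coord k v = 0" using Cons.prems(3) by simp
  have "s k (ringel (reverse_at k Q) (s k v)) = 0"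
    using ringel_s[of Q k "s k v"] Cons.prems by simp
  then have "ringel (reverse_at k Q) (s k v) = 0"
    using arg_cong[of _ 0 "s k"] by (metis reflection_invol linear_0[OF linear_reflection])
  then have "i \<in> set w \<Longrightarrow> coord i (s k v) = 0"
    using Cons.IH[of "reverse_at k Q" "s k v"] Cons.prems orientation_reverse_at[of D Q k] by simp
  then show ?case using k Cons.prems(4) by (cases "i = k") (auto simp: coord_s)
qed simp

section \<open>Roots and weights along a word\<close>

text \<open>Undoing the letters one at a time ends outside the positive roots. Just before
  positivity is lost the root is the simple root of the letter concerned.\<close>

lemma root_in_word:
  "b \<in> pos \<Longrightarrow> word (rev w) b \<notin> pos \<Longrightarrow> \<exists>u i x. w = u @ i # x \<and> b = word u (\<alpha> i)"
proof (induction w arbitrary: b)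
  case (Cons k w)
  show ?case
  proof (cases "b = \<alpha> k")
    case True
    then show ?thesis by (intro exI[of _ "[]"]) simp
  next
    case False
    then obtain u i x where *: "w = u @ i # x" "s k b = word u (\<alpha> i)"
      using Cons.IH[of "s k b"] Cons.prems s_positive by auto
    then have "b = word (k # u) (\<alpha> i)" using reflection_invol[of "\<alpha> k" b] by simp
    then show ?thesis using * by (intro exI[of _ "k # u"]) auto
  qed
qed simp

text \<open>Cancelling \<open>u\<close> and the letter \<open>a\<close> from an equality would give
  \<open>- \<alpha> a\<close> as the image of \<open>\<alpha> b\<close> under \<open>v\<close>,
  against positivity.\<close>

lemma roots_distinct:
  assumes "positive_word (u @ a # v @ b # x)" shows "word u (\<alpha> a) \<noteq> word (u @ a # v) (\<alpha> b)"
proof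
  assume "word u (\<alpha> a) = word (u @ a # v) (\<alpha> b)"
  then have "word (rev u) (word u (\<alpha> a)) = word (rev u) (word u (s a (word v (\<alpha> b))))" by simp
  then have "\<alpha> a = s a (word v (\<alpha> b))" by simp
  then have "s a (\<alpha> a) = word v (\<alpha> b)" using reflection_invol by metis
  then have "word v (\<alpha> b) = - \<alpha> a" by (simp add: s_simple)
  moreover have "word v (\<alpha> b) \<in> pos" using positive_wordD[of "u @ [a]" v b x] assms by simp
  ultimately show False using negative_not_positive[OF simple_positive[of a]] by simp
qed

text \<open>A root has the length of every simple root in its support, which makes the Cartan integers
  of roots available without assuming the diagram connected.\<close>

lemma support_length:
  "coord j (word u (\<alpha> i)) \<noteq> 0 \<Longrightarrow> \<alpha> j \<bullet> \<alpha> j = \<alpha> i \<bullet> \<alpha> i"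
proof (induction u arbitrary: j)
  case Nil
  then show ?case by (auto simp: coord_simple split: if_splits)
next
  case (Cons k u)
  show ?case
  proof (cases "coord j (word u (\<alpha> i)) = 0")
    case True
    then have "j = k" "(\<Sum>l | (l, k) \<in> D. coord l (word u (\<alpha> i))) \<noteq> 0"
      using Cons.prems by (auto simp: coord_s split: if_splits)
    then obtain l where "(l, k) \<in> D" "coord l (word u (\<alpha> i)) \<noteq> 0"
      by (metis (no_types, lifting) mem_Collect_eq sum.neutral)
    then show ?thesis using Cons.IH[of l] linked_length[of l k] \<open>j = k\<close> by simp
  qed (use Cons.IH in simp)
qed

text \<open>The sum is minus the Cartan integer of the root with \<open>\<alpha> k\<close>. If it is
  nonzero, the two roots have equal length, and roots of equal length that are not opposite have
  Cartan integer greater than -2.\<close>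

lemma neighbour_sum_le_1:
  assumes "word u (\<alpha> i) \<in> pos" "coord k (word u (\<alpha> i)) = 0"
  shows "(\<Sum>l | (l, k) \<in> D. coord l (word u (\<alpha> i))) \<le> 1"
proof (cases "(\<Sum>l | (l, k) \<in> D. coord l (word u (\<alpha> i))) = 0")
  case False
  let ?b = "word u (\<alpha> i)"
  obtain l where "(l, k) \<in> D" "coord l ?b \<noteq> 0"
    using False by (metis (no_types, lifting) mem_Collect_eq sum.neutral)
  then have len: "\<alpha> k \<bullet> \<alpha> k = ?b \<bullet> ?b"
    using linked_length[of l k] support_length[of l u i] by (simp add: word_inner)
  have root: "?b \<in> \<Phi>" using word_root simple_root by blast
  have sum: "2 * (?b \<bullet> \<alpha> k) / (\<alpha> k \<bullet> \<alpha> k) = - (\<Sum>l | (l, k) \<in> D. coord l ?b)"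
    using coroot assms(2) by simp
  have "2 * (?b \<bullet> \<alpha> k) / (\<alpha> k \<bullet> \<alpha> k) \<in> \<int>"
    using root_system root simple_root[of k] unfolding root_system_def by blast
  then obtain n where n: "2 * (?b \<bullet> \<alpha> k) / (\<alpha> k \<bullet> \<alpha> k) = of_int n" by (elim Ints_cases)
  have "?b + \<alpha> k \<noteq> 0"
  proof
    assume "?b + \<alpha> k = 0"
    then have "coord k (?b + \<alpha> k) = 0" by simp
    then show False using assms(2) by (simp add: coord_simple)
  qed
  \<comment> \<open>For vectors of equal length this is the strict Cauchy-Schwarz bound.\<close>
  then have "(?b + \<alpha> k) \<bullet> (?b + \<alpha> k) > 0" by simp
  then have "- (\<alpha> k \<bullet> \<alpha> k) < ?b \<bullet> \<alpha> k"
    by (simp add: inner_add_left inner_add_right inner_commute len)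
  moreover have "\<alpha> k \<bullet> \<alpha> k > 0" using simple_nonzero by simp
  ultimately have "2 * (?b \<bullet> \<alpha> k) / (\<alpha> k \<bullet> \<alpha> k) > - 2" by (simp add: field_simps)
  then have "n > - 2" using n by linarith
  then have "- 1 \<le> n" by simp
  then have "- 1 \<le> real_of_int n" by linarith
  then show ?thesis using n sum by linarith
qed simp

text \<open>Only the letters \<open>b\<close> of \<open>x\<close> move the weight, and each of them
  subtracts a root that is positive because the word is.\<close>

lemma coord_weight_antimono:
  "positive_word (t @ x) \<Longrightarrow> coord a (word (t @ x) (\<omega> b)) \<le> coord a (word t (\<omega> b))"
proof (induction x rule: rev_induct)
  case (snoc j x)
  have "coord a (word (t @ x @ [j]) (\<omega> b)) \<le> coord a (word (t @ x) (\<omega> b))"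
  proof (cases "j = b")
    case True
    have "word (t @ x) (\<alpha> b) \<in> pos" using positive_wordD[of "[]" "t @ x" b "[]"] snoc.prems True by simp
    then have "coord a (word (t @ x) (\<alpha> b)) \<ge> 0" by (rule positive_rootD)
    then show ?thesis using True by (simp add: s_weight linear_diff[OF linear_word])
  qed (simp add: s_weight)
  also have "\<dots> \<le> coord a (word t (\<omega> b))"
    using snoc.IH positive_word_infix[of "[]" "t @ x" "[j]"] snoc.prems by simp
  finally show ?case .
qed simp

text \<open>The first \<open>b\<close> forces strictness: the root subtracted there is
  \<open>s a\<close> applied to a positive root with coefficient 0 at \<open>a\<close> and
  coefficient 1 at the neighbour \<open>b\<close>, so its coefficient at \<open>a\<close> is
  positive. Later letters cannot undo this, by monotonicity.\<close>

lemma coord_weight_less: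
  assumes "orientation_of D Q" "adapted Q (a # z @ [b])" "positive_word (a # z @ [b])" "(a, b) \<in> D"
  shows "coord a (word (a # z @ [b]) (\<omega> b)) < coord a (\<omega> b)"
proof -
  have ab: "a \<noteq> b" using assms(4) D_irrefl by blast
  obtain z1 z2 where z: "z @ [b] = z1 @ b # z2" "b \<notin> set z1"
    using split_list_first[of b "z @ [b]"] by auto
  have "a \<notin> set z1" using gap_symmetric[of D Q a z1 b z2] assms z by simp
  let ?x = "word z1 (\<alpha> b)"
  have "?x \<in> pos" using positive_wordD[of "[a]" z1 b z2] assms(3) z(1) by simp
  then have nonneg: "coord j ?x \<ge> 0" for j by (rule positive_rootD)
  have "coord a ?x = 0" "coord b ?x = 1"
    using \<open>a \<notin> set z1\<close> z(2) ab by (auto simp: coord_word coord_simple)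
  moreover have "coord b ?x \<le> (\<Sum>j | (j, a) \<in> D. coord j ?x)"
    using D_sym[OF assms(4)] nonneg by (intro member_le_sum) auto
  ultimately have pos: "coord a (s a ?x) > 0" by (simp add: coord_s)
  have "positive_word ((a # z1 @ [b]) @ z2)" using assms(3) z(1) by simp
  then have "coord a (word ((a # z1 @ [b]) @ z2) (\<omega> b)) \<le> coord a (word (a # z1 @ [b]) (\<omega> b))"
    by (rule coord_weight_antimono)
  also have "word (a # z1 @ [b]) (\<omega> b) = \<omega> b - s a ?x"
    using word_weight[of b "a # z1"] z(2) ab
    by (simp add: s_weight linear_diff[OF linear_word] linear_diff[OF linear_reflection])
  finally show ?thesis using pos z(1) by simp
qed

lemma parabolic_words: "parabolic \<alpha> i = {word u | u. i \<notin> set u}"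
  unfolding parabolic_def using generate_words[of "{j. j \<noteq> i}"] by auto

text \<open>Word form of the left class, by which a common element of two classes becomes an
  equality between words.\<close>

lemma prefix_coset_iff:
  "f \<in> prefix_coset \<alpha> (u @ i # x) (length u) \<longleftrightarrow> (\<exists>y. i \<notin> set y \<and> f = word ((u @ [i]) @ y))"
proof -
  have "prefix_coset \<alpha> (u @ i # x) (length u) = word (u @ [i]) <#\<^bsub>BijGroup UNIV\<^esub> parabolic \<alpha> i"
    by (simp add: prefix_coset_def prefix_element_def)
  then show ?thesis
    unfolding l_coset_def parabolic_words by (auto simp: word_mult simp del: append_assoc word_append)
qed

lemma prefix_cosets_meet:
  assumes "orientation_of D Q" "adapted Q (u @ a # v @ b # x)" "positive_word (u @ a # v @ b # x)" "(a, b) \<in> D"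
  shows "prefix_coset \<alpha> (u @ a # v @ b # x) (length u) \<inter>
      prefix_coset \<alpha> (u @ a # v @ b # x) (length (u @ a # v)) \<noteq> {} \<longleftrightarrow> a \<notin> set v"
proof
  have ab: "a \<noteq> b" using assms(4) D_irrefl by blast
  have second: "f \<in> prefix_coset \<alpha> (u @ a # v @ b # x) (length (u @ a # v)) \<longleftrightarrow>
      (\<exists>y. b \<notin> set y \<and> f = word (((u @ a # v) @ [b]) @ y))" for f
    using prefix_coset_iff[of f "u @ a # v" b x] by simp
  {
    assume "a \<notin> set v"
    \<comment> \<open>The word up to and including the later letter lies in both classes.\<close>
    then have "word ((u @ [a]) @ (v @ [b])) \<in> prefix_coset \<alpha> (u @ a # v @ b # x) (length u)"
      unfolding prefix_coset_iff using ab by (intro exI[of _ "v @ [b]"]) auto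
    moreover have "word (((u @ a # v) @ [b]) @ []) \<in> prefix_coset \<alpha> (u @ a # v @ b # x) (length (u @ a # v))"
      unfolding second by (intro exI[of _ "[]"]) auto
    ultimately show "prefix_coset \<alpha> (u @ a # v @ b # x) (length u) \<inter>
      prefix_coset \<alpha> (u @ a # v @ b # x) (length (u @ a # v)) \<noteq> {}" by auto
  }
  assume "prefix_coset \<alpha> (u @ a # v @ b # x) (length u) \<inter>
      prefix_coset \<alpha> (u @ a # v @ b # x) (length (u @ a # v)) \<noteq> {}"
  then obtain y z where yz: "a \<notin> set y" "b \<notin> set z" "word ((u @ [a]) @ y) = word (((u @ a # v) @ [b]) @ z)"
    unfolding prefix_coset_iff second disjoint_iff by metis
  have "word (u @ [a]) (word y t) = word (u @ [a]) (word (v @ [b]) (word z t))" for t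
    using fun_cong[OF yz(3), of t] by simp
  then have eq: "word y t = word (v @ [b]) (word z t)" for t
    by (metis word_rev(2))
  \<comment> \<open>The isometry given by \<open>y\<close> fixes \<open>\<omega> a\<close>; the
    second description of the common element evaluates it at \<open>\<omega> b\<close>, which
    \<open>z\<close> fixes.\<close>
  have "\<omega> a \<bullet> \<omega> b = word y (\<omega> a) \<bullet> word y (\<omega> b)" by (simp only: word_inner)
  also have "\<dots> = \<omega> a \<bullet> word (v @ [b]) (\<omega> b)"
    using eq[of "\<omega> b"] word_weight[OF yz(1)] word_weight[OF yz(2)] by simp
  finally have inner: "coord a (word (v @ [b]) (\<omega> b)) = coord a (\<omega> b)" by (simp add: coord_def)
  show "a \<notin> set v"
  proof
    assume "a \<in> set v"
    \<comment> \<open>Letters before the first \<open>a\<close> of \<open>v\<close> do not change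
      the coordinate at \<open>a\<close>, so the comparison can start at this letter.\<close>
    then obtain v1 v2 where v: "v = v1 @ a # v2" "a \<notin> set v1" by (meson split_list_first)
    have "adapted (fold reverse_at (u @ a # v1) Q) (a # v2 @ [b])"
      using assms(2) adapted_append[of Q "u @ a # v1" "(a # v2 @ [b]) @ x"]
        adapted_append[of _ "a # v2 @ [b]" x] by (simp add: v(1))
    moreover have "positive_word (a # v2 @ [b])"
      using positive_word_infix[of "u @ a # v1" "a # v2 @ [b]" x] assms(3) by (simp add: v(1))
    ultimately have "coord a (word (a # v2 @ [b]) (\<omega> b)) < coord a (\<omega> b)"
      using coord_weight_less[OF orientation_fold[OF assms(1)]] assms(4) by blast
    moreover have "coord a (word (v @ [b]) (\<omega> b)) = coord a (word (a # v2 @ [b]) (\<omega> b))"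
      using v coord_word[of a v1 "word (a # v2 @ [b]) (\<omega> b)"] by simp
    ultimately show False using inner by simp
  qed
qed

end


section \<open>Finite dimensional spaces of sequences\<close>

declare plus_fun_apply [simp del] zero_fun_apply [simp del] minus_apply [simp del] uminus_apply [simp del]

abbreviation clinear :: "(cvec \<Rightarrow> cvec) \<Rightarrow> bool" where
  "clinear \<equiv> Vector_Spaces.linear cscale cscale"

interpretation cvec_pair: vector_space_pair cscale cscale
  by unfold_locales

lemma clinearI: "(\<And>x y. f (x + y) = f x + f y) \<Longrightarrow> (\<And>c x. f (cscale c x) = cscale c (f x)) \<Longrightarrow> clinear f"
  unfolding Vector_Spaces.linear_iff using cvec.vector_space_axioms by blast

lemma clinear_between: "clinear f \<Longrightarrow> (\<And>x. x \<in> V \<Longrightarrow> f x \<in> W) \<Longrightarrow> linear_between V W f"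
  by (simp add: linear_between_def cvec_pair.linear_add cvec_pair.linear_scale)

lemma linear_betweenD:
  assumes "linear_between V W f"
  shows "x \<in> V \<Longrightarrow> f x \<in> W" "x \<in> V \<Longrightarrow> y \<in> V \<Longrightarrow> f (x + y) = f x + f y"
    "x \<in> V \<Longrightarrow> f (cscale c x) = cscale c (f x)"
  using assms by (auto simp: linear_between_def)

lemma linear_between_zero: "linear_between V W f \<Longrightarrow> cvec.subspace V \<Longrightarrow> f 0 = 0"
  using linear_betweenD(2)[of V W f 0 0] cvec.subspace_0[of V] by simp

lemma linear_between_diff:
  assumes "linear_between V W f" "cvec.subspace V" "x \<in> V" "y \<in> V" shows "f (x - y) = f x - f y"
proof -
  have "f ((x - y) + y) = f (x - y) + f y"
    using assms by (intro linear_betweenD(2)[OF assms(1)] cvec.subspace_diff)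
  then show ?thesis by (simp add: algebra_simps)
qed

lemma linear_between_sum:
  assumes "linear_between V W f" "cvec.subspace V" "\<And>i. i \<in> I \<Longrightarrow> y i \<in> V"
  shows "f (sum y I) = (\<Sum>i\<in>I. f (y i))"
  using assms(3)
proof (induction I rule: infinite_finite_induct)
  case (insert i I)
  then have "sum y I \<in> V" by (intro cvec.subspace_sum[OF assms(2)]) auto
  then show ?case using insert linear_betweenD(2)[OF assms(1)] by simp
qed (simp_all add: linear_between_zero[OF assms(1,2)])

lemma linear_between_compose:
  "linear_between U V f \<Longrightarrow> linear_between V W g \<Longrightarrow> linear_between U W (\<lambda>x. g (f x))"
  by (simp add: linear_between_def)

lemma linear_between_mono:
  "linear_between V W f \<Longrightarrow> V' \<subseteq> V \<Longrightarrow> (\<And>x. x \<in> V' \<Longrightarrow> f x \<in> W') \<Longrightarrow> linear_between V' W' f"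
  unfolding linear_between_def by (meson subsetD)

lemma linear_between_kernel:
  assumes "linear_between V W f" "cvec.subspace V" shows "cvec.subspace {x \<in> V. f x = 0}"
  using assms linear_between_zero[OF assms]
  by (auto simp: cvec.subspace_def linear_betweenD[OF assms(1)])

lemma linear_between_image:
  assumes "linear_between V W f" "cvec.subspace V" shows "cvec.subspace (f ` V)"
  unfolding cvec.subspace_def
proof (intro conjI ballI allI)
  show "0 \<in> f ` V" using linear_between_zero[OF assms] cvec.subspace_0[OF assms(2)] by (metis imageI)
  fix x y assume "x \<in> f ` V" "y \<in> f ` V"
  then obtain a b where "a \<in> V" "b \<in> V" "x = f a" "y = f b" by auto
  then show "x + y \<in> f ` V"
    using linear_betweenD(2)[OF assms(1), of a b] cvec.subspace_add[OF assms(2), of a b] by (metis imageI)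
next
  fix c x assume "x \<in> f ` V"
  then obtain a where "a \<in> V" "x = f a" by auto
  then show "cscale c x \<in> f ` V"
    using linear_betweenD(3)[OF assms(1), of a c] cvec.subspace_scale[OF assms(2), of a c] by (metis imageI)
qed

text \<open>Obtained as a left inverse of the identity on \<open>S\<close>. The splittings of
  representations below come from such projections.\<close>

lemma projection_exists:
  assumes "cvec.subspace S"
  obtains p where "clinear p" "\<And>x. p x \<in> S" "\<And>x. x \<in> S \<Longrightarrow> p x = x"
proof -
  have "clinear id" using cvec.module_hom_id cvec.linear_id by blast
  from cvec_pair.linear_exists_left_inverse_on[OF this assms] obtain p
    where "range p \<subseteq> S" "clinear p" "\<forall>v\<in>S. p (id v) = v" by auto
  then show ?thesis using that[of p] by auto
qed

text \<open>Maps of a representation are constrained only on their domain; precomposing with a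
  projection gives a globally linear map, to which the general theory of linear maps
  applies.\<close>

lemma linear_between_extend:
  assumes "linear_between V W f" "cvec.subspace V"
  obtains F where "clinear F" "\<And>x. x \<in> V \<Longrightarrow> F x = f x"
proof -
  obtain p where p: "clinear p" "\<And>x. p x \<in> V" "\<And>x. x \<in> V \<Longrightarrow> p x = x"
    using projection_exists[OF assms(2)] by blast
  have "clinear (\<lambda>x. f (p x))"
    by (rule clinearI)
      (simp_all add: p(2) cvec_pair.linear_add[OF p(1)] cvec_pair.linear_scale[OF p(1)] linear_betweenD[OF assms(1)])
  then show ?thesis using that p(3) by simp
qed

lemma line_map_exists:
  assumes "x \<noteq> 0" obtains h where "clinear h" "h x = y"
proof -
  have "cvec.independent {x}" using assms by (simp add: cvec.dependent_single)
  then show ?thesis using cvec_pair.linear_independent_extend[of "{x}" "\<lambda>_. y"] that by auto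
qed

lemma fin_dim_spaceD: "fin_dim_space V \<Longrightarrow> cvec.subspace V"
  by (simp add: fin_dim_space_def)

lemma fin_dim_space_subset:
  assumes "cvec.subspace V" "V \<subseteq> cvec.span B" "finite B" shows "fin_dim_space V"
proof -
  obtain C where C: "C \<subseteq> V" "cvec.independent C" "V \<subseteq> cvec.span C"
    using cvec.maximal_independent_subset by blast
  then have "finite C" using cvec.independent_span_bound[OF assms(3) C(2)] assms(2) by auto
  moreover have "V = cvec.span C" using C assms(1) cvec.span_minimal by blast
  ultimately show ?thesis using assms(1) by (auto simp: fin_dim_space_def)
qed

lemma fin_dim_subspace:
  assumes "fin_dim_space V" "cvec.subspace U" "U \<subseteq> V" shows "fin_dim_space U"
  using assms fin_dim_space_subset[of U] by (auto simp: fin_dim_space_def)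

lemma fin_dim_zero: "fin_dim_space {0}"
  using fin_dim_space_subset[of "{0}" "{}"] by simp

lemma fin_dim_span1: "fin_dim_space (cvec.span {x})"
  unfolding fin_dim_space_def by (auto intro!: exI[of _ "{x}"])

lemma fin_dim_image:
  assumes "linear_between V W f" "fin_dim_space V" shows "fin_dim_space (f ` V)"
proof -
  obtain F where F: "clinear F" "\<And>x. x \<in> V \<Longrightarrow> F x = f x"
    using linear_between_extend[OF assms(1)] assms(2) fin_dim_spaceD by blast
  obtain B where B: "finite B" "V = cvec.span B" using assms(2) by (auto simp: fin_dim_space_def)
  have "f ` V = F ` V" using F by auto
  also have "\<dots> = cvec.span (F ` B)" by (simp add: B cvec_pair.linear_span_image[OF F(1)])
  finally show ?thesis using B(1) by (auto simp: fin_dim_space_def intro!: exI[of _ "F ` B"])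
qed

text \<open>A basis \<open>A\<close> of the kernel is extended to a basis \<open>B\<close> of
  \<open>V\<close>; the added vectors \<open>C\<close> are mapped injectively onto a basis of the
  image.\<close>

lemma rank_nullity:
  assumes "fin_dim_space V" "linear_between V W f"
  shows "cvec.dim V = cvec.dim {x \<in> V. f x = 0} + cvec.dim (f ` V)"
proof -
  have V: "cvec.subspace V" using assms(1) fin_dim_spaceD by blast
  obtain F where F: "clinear F" "\<And>x. x \<in> V \<Longrightarrow> F x = f x"
    using linear_between_extend[OF assms(2) V] by blast
  let ?K = "{x \<in> V. f x = 0}"
  obtain A where A: "A \<subseteq> ?K" "cvec.independent A" "?K \<subseteq> cvec.span A" "card A = cvec.dim ?K"
    using cvec.basis_exists by blast
  then obtain B where B: "A \<subseteq> B" "B \<subseteq> V" "cvec.independent B" "V \<subseteq> cvec.span B"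
    using cvec.maximal_independent_subset_extend[of A V] by (metis (no_types, lifting) mem_Collect_eq subset_eq)
  have "finite B"
    using assms(1) B(2) cvec.independent_span_bound[OF _ B(3)] by (auto simp: fin_dim_space_def)
  define C where "C = B - A"
  have fin: "finite A" "finite C" using \<open>finite B\<close> B(1) C_def finite_subset by auto
  have C: "C \<subseteq> V" "cvec.independent C" using B cvec.independent_mono[OF B(3)] by (auto simp: C_def)
  \<comment> \<open>Expanding \<open>x\<close> over \<open>A\<close> as a kernel vector and over
    \<open>C\<close> as a vector of its span yields a relation among the vectors of
    \<open>B\<close>.\<close>
  have ker0: "x = 0" if x: "x \<in> cvec.span C" "F x = 0" for x
  proof -
    have "x \<in> V" using x(1) cvec.span_minimal[OF C(1) V] by blast
    then have "x \<in> cvec.span A" using A(3) F x(2) by auto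
    then obtain u where u: "x = (\<Sum>v\<in>A. cscale (u v) v)" using cvec.span_finite[OF fin(1)] by auto
    obtain w where w: "x = (\<Sum>v\<in>C. cscale (w v) v)" using cvec.span_finite[OF fin(2)] x(1) by auto
    let ?c = "\<lambda>v. if v \<in> A then u v else - w v"
    have "B = A \<union> C" "A \<inter> C = {}" using B(1) by (auto simp: C_def)
    then have "(\<Sum>v\<in>B. cscale (?c v) v) = (\<Sum>v\<in>A. cscale (?c v) v) + (\<Sum>v\<in>C. cscale (?c v) v)"
      using fin by (simp add: sum.union_disjoint)
    also have "(\<Sum>v\<in>A. cscale (?c v) v) = x" unfolding u by (intro sum.cong) auto
    also have "(\<Sum>v\<in>C. cscale (?c v) v) = - x"
      unfolding w sum_negf[symmetric] by (intro sum.cong) (auto simp: C_def cvec.scale_minus_left)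
    finally have "(\<Sum>v\<in>B. cscale (?c v) v) = 0" by simp
    then have "\<And>v. v \<in> B \<Longrightarrow> ?c v = 0"
      using cvec.independentD[OF B(3) \<open>finite B\<close> order_refl, of ?c] by blast
    then have "\<And>v. v \<in> A \<Longrightarrow> u v = 0" using B(1) by (metis subsetD)
    then show "x = 0" by (simp add: u)
  qed
  have inj: "inj_on F (cvec.span C)"
    using ker0 cvec_pair.linear_inj_on_iff_eq_0[OF F(1) cvec.subspace_span] by blast
  have indep: "cvec.independent (F ` C)"
    using cvec_pair.linear_independent_injective_image[OF F(1) C(2) inj] .
  have img: "f ` V = F ` V" using F(2) by auto
  have "F ` V \<subseteq> cvec.span (F ` B)" using cvec_pair.linear_spans_image[OF F(1) B(4)] .
  also have "\<dots> \<subseteq> cvec.span (insert 0 (F ` C))"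
  proof (rule cvec.span_mono, safe)
    fix b assume "b \<in> B" "F b \<notin> F ` C"
    then have "b \<in> A" by (auto simp: C_def)
    then show "F b = 0" using A(1) F(2) by auto
  qed
  finally have "f ` V \<subseteq> cvec.span (F ` C)" by (simp add: img)
  moreover have "F ` C \<subseteq> f ` V" using C(1) img by auto
  ultimately have "card (F ` C) = cvec.dim (f ` V)" using indep cvec.basis_card_eq_dim by blast
  moreover have "card (F ` C) = card C"
    using inj by (intro card_image) (meson cvec.span_superset inj_on_subset)
  moreover have "card B = cvec.dim V" using B cvec.basis_card_eq_dim by blast
  moreover have "card B = card A + card C" using B(1) fin \<open>finite B\<close> by (simp add: C_def card_Diff_subset card_mono)
  ultimately show ?thesis using A(4) by simp
qed

lemma dim_zero: "cvec.dim {0} = 0"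
  using cvec.dim_eq_card[of "{}" "{0}"] cvec.independent_empty by simp

lemma dim_eq_0D:
  assumes "fin_dim_space V" "cvec.dim V = 0" shows "V = {0}"
proof -
  obtain B where B: "B \<subseteq> V" "cvec.independent B" "V \<subseteq> cvec.span B" "card B = cvec.dim V"
    using cvec.basis_exists by blast
  then have "finite B" using cvec.independent_span_bound[OF _ B(2)] assms(1) by (auto simp: fin_dim_space_def)
  then have "B = {}" using B assms(2) by simp
  then show ?thesis using B(3) cvec.subspace_0[OF fin_dim_spaceD[OF assms(1)]] by auto
qed

lemma dim_span1: "x \<noteq> 0 \<Longrightarrow> cvec.dim (cvec.span {x}) = 1"
  using cvec.dim_span_eq_card_independent[of "{x}"] by (simp add: cvec.dependent_single)

lemma dim_eq_1D:
  assumes "fin_dim_space V" "cvec.dim V = 1" obtains x where "x \<noteq> 0" "V = cvec.span {x}"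
proof -
  obtain B where B: "B \<subseteq> V" "cvec.independent B" "V \<subseteq> cvec.span B" "card B = cvec.dim V"
    using cvec.basis_exists by blast
  then obtain x where "B = {x}" using assms(2) card_1_singletonE by metis
  then show ?thesis using that[of x] B cvec.dependent_single fin_dim_spaceD[OF assms(1)]
      cvec.span_minimal[OF B(1)] by auto
qed

lemma span1_iff: "v \<in> cvec.span {x} \<longleftrightarrow> (\<exists>c. v = cscale c x)"
  by (auto simp: cvec.span_singleton)

lemma span1_eq:
  assumes "x \<in> cvec.span {y}" "x \<noteq> 0" shows "cvec.span {x} = cvec.span {y}"
proof -
  obtain c where c: "x = cscale c y" using assms(1) span1_iff by auto
  then have "c \<noteq> 0" using assms(2) by auto
  then have "y = cscale (1 / c) x" by (simp add: c)
  then have "y \<in> cvec.span {x}" unfolding span1_iff by blast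
  then show ?thesis using assms(1) cvec.span_eq[of "{x}" "{y}"] by simp
qed

section \<open>Finite direct sums inside the space of sequences\<close>

definition idx :: "'i::finite \<Rightarrow> nat" where
  "idx = (SOME f. inj f)"

lemma inj_idx: "inj (idx :: 'i::finite \<Rightarrow> nat)"
proof -
  have "\<exists>f :: 'i \<Rightarrow> nat. inj f" using finite_imp_inj_to_nat_seg[of "UNIV :: 'i set"] by auto
  then show ?thesis unfolding idx_def by (rule someI_ex)
qed

text \<open>Direct sums have to stay inside the one space of sequences in which all representations
  live. A family is stored as a single sequence: entry \<open>m\<close> of component
  \<open>i\<close> goes to the position encoding the pair of \<open>idx i\<close> and
  \<open>m\<close>.\<close>

definition pack :: "('i::finite \<Rightarrow> cvec) \<Rightarrow> cvec" where
  "pack y = (\<lambda>n. case prod_decode n of (p, m) \<Rightarrow>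
     if p \<in> range (idx :: 'i \<Rightarrow> nat) then y (inv_into UNIV idx p) m else 0)"

definition unpack :: "cvec \<Rightarrow> 'i::finite \<Rightarrow> cvec" where
  "unpack x i = (\<lambda>m. x (prod_encode (idx i, m)))"

definition single :: "'i \<Rightarrow> cvec \<Rightarrow> 'i \<Rightarrow> cvec" where
  "single l v = (\<lambda>i. if i = l then v else 0)"

lemma unpack_pack [simp]: "unpack (pack y) = y"
  by (auto simp: unpack_def pack_def fun_eq_iff inv_f_f[OF inj_idx])

lemma pack_inject [simp]: "pack y = pack z \<longleftrightarrow> y = z"
  by (metis unpack_pack)

lemma pack_0: "pack (\<lambda>i. 0) = 0"
  by (auto simp: pack_def fun_eq_iff plus_fun_apply zero_fun_apply split: prod.splits)

lemma pack_add: "pack y + pack z = pack (\<lambda>i. y i + z i)"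
  by (auto simp: pack_def fun_eq_iff plus_fun_apply zero_fun_apply split: prod.splits)

lemma pack_scale: "cscale c (pack y) = pack (\<lambda>i. cscale c (y i))"
  by (auto simp: pack_def fun_eq_iff cscale_def zero_fun_apply split: prod.splits)

lemma pack_eq_0: "pack (y :: 'i::finite \<Rightarrow> cvec) = 0 \<longleftrightarrow> (\<forall>i. y i = 0)"
proof -
  have "pack y = 0 \<longleftrightarrow> pack y = pack (\<lambda>i::'i. 0)" by (simp only: pack_0)
  then show ?thesis by (simp only: pack_inject fun_eq_iff[of y])
qed

lemma clinear_unpack: "clinear (\<lambda>x. unpack x i)"
  by (rule clinearI) (auto simp: unpack_def cscale_def fun_eq_iff plus_fun_apply)

lemma clinear_pack_single: "clinear (\<lambda>x. pack (single l x))"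
  by (rule clinearI) (auto simp: pack_add pack_scale single_def intro!: arg_cong[of _ _ pack])

lemma pack_sum: "pack (\<lambda>i. \<Sum>l\<in>L. y l i) = (\<Sum>l\<in>L. pack (y l))" if "finite L"
  using that by (induction L) (auto simp: pack_0 pack_add[symmetric])

lemma pack_singles:
  assumes "\<And>l. l \<notin> L \<Longrightarrow> y l = 0" shows "pack y = (\<Sum>l\<in>L. pack (single l (y l)))"
proof -
  have "y = (\<lambda>i. \<Sum>l\<in>L. single l (y l) i)"
  proof
    fix i
    have "(\<Sum>l\<in>L. single l (y l) i) = (\<Sum>l\<in>L. if l = i then y l else 0)"
      by (intro sum.cong) (auto simp: single_def)
    then show "y i = (\<Sum>l\<in>L. single l (y l) i)"
      using assms[of i] by (auto simp: sum.delta)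
  qed
  then have "pack y = pack (\<lambda>i. \<Sum>l\<in>L. single l (y l) i)" by simp
  also have "\<dots> = (\<Sum>l\<in>L. pack (single l (y l)))" by (rule pack_sum) simp
  finally show ?thesis .
qed

text \<open>Model of the direct sum over \<open>L\<close>. Components outside \<open>L\<close> must
  vanish, so that an element is determined by those in \<open>L\<close>.\<close>

definition sum_space :: "'i::finite set \<Rightarrow> ('i \<Rightarrow> cvec set) \<Rightarrow> cvec set" where
  "sum_space L V = {pack y | y. (\<forall>l\<in>L. y l \<in> V l) \<and> (\<forall>l. l \<notin> L \<longrightarrow> y l = 0)}"

lemma pack_in_sum_space:
  "pack y \<in> sum_space L V \<longleftrightarrow> (\<forall>l\<in>L. y l \<in> V l) \<and> (\<forall>l. l \<notin> L \<longrightarrow> y l = 0)"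
  by (auto simp: sum_space_def)

lemma sum_spaceE:
  fixes L :: "'i::finite set"
  assumes "x \<in> sum_space L V" obtains y :: "'i \<Rightarrow> cvec" where "x = pack y"
  using assms unfolding sum_space_def by blast

lemma fin_dim_sum_space:
  fixes L :: "'i::finite set"
  assumes "\<And>l. l \<in> L \<Longrightarrow> fin_dim_space (V l)" shows "fin_dim_space (sum_space L V)"
proof -
  have sub: "cvec.subspace (V l)" if "l \<in> L" for l using assms that fin_dim_spaceD by blast
  have "\<forall>l\<in>L. \<exists>B. finite B \<and> V l = cvec.span B" using assms by (simp add: fin_dim_space_def)
  then obtain B where B: "\<And>l. l \<in> L \<Longrightarrow> finite (B l) \<and> V l = cvec.span (B l)" by metis
  let ?B = "\<Union>l\<in>L. (\<lambda>x. pack (single l x)) ` B l"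
  have "sum_space L V \<subseteq> cvec.span ?B"
  proof
    fix x assume "x \<in> sum_space L V"
    then obtain y where y: "x = pack y" "\<And>l. l \<in> L \<Longrightarrow> y l \<in> V l" "\<And>l. l \<notin> L \<Longrightarrow> y l = 0"
      by (auto simp: sum_space_def)
    have "pack (single l (y l)) \<in> cvec.span ?B" if "l \<in> L" for l
    proof -
      have "pack (single l (y l)) \<in> (\<lambda>x. pack (single l x)) ` cvec.span (B l)" using y(2) B that by blast
      also have "\<dots> = cvec.span ((\<lambda>x. pack (single l x)) ` B l)"
        by (rule cvec_pair.linear_span_image[OF clinear_pack_single, symmetric])
      also have "\<dots> \<subseteq> cvec.span ?B" using that by (intro cvec.span_mono) auto
      finally show ?thesis .
    qed
    then show "x \<in> cvec.span ?B" unfolding y(1) by (subst pack_singles[OF y(3)]) (auto intro: cvec.span_sum)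
  qed
  moreover have "cvec.subspace (sum_space L V)"
    unfolding cvec.subspace_def
  proof (intro conjI ballI allI)
    have "pack (\<lambda>i::'i. 0) \<in> sum_space L V"
      unfolding pack_in_sum_space using sub cvec.subspace_0 by auto
    then show "0 \<in> sum_space L V" by (simp only: pack_0)
    fix x y assume "x \<in> sum_space L V" "y \<in> sum_space L V"
    then obtain y1 y2 :: "'i \<Rightarrow> cvec" where y: "x = pack y1" "y = pack y2" and
      *: "pack y1 \<in> sum_space L V" "pack y2 \<in> sum_space L V" unfolding sum_space_def by blast
    have "pack (\<lambda>i. y1 i + y2 i) \<in> sum_space L V"
      using * cvec.subspace_add[OF sub] unfolding pack_in_sum_space by simp
    then show "x + y \<in> sum_space L V" by (simp only: pack_add y)
  next
    fix c x assume "x \<in> sum_space L V"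
    then obtain y :: "'i \<Rightarrow> cvec" where y: "x = pack y" "pack y \<in> sum_space L V" unfolding sum_space_def by blast
    have "pack (\<lambda>i. cscale c (y i)) \<in> sum_space L V"
      using y(2) cvec.subspace_scale[OF sub] unfolding pack_in_sum_space by simp
    then show "cscale c x \<in> sum_space L V" by (simp only: pack_scale y)
  qed
  moreover have "finite ?B" using B by auto
  ultimately show ?thesis using fin_dim_space_subset by blast
qed

text \<open>The projection to a new component is onto, and its kernel is the sum over the old
  ones.\<close>

lemma dim_sum_space:
  fixes L :: "'i::finite set"
  assumes "\<And>l. l \<in> L \<Longrightarrow> fin_dim_space (V l)"
  shows "cvec.dim (sum_space L V) = (\<Sum>l\<in>L. cvec.dim (V l))"
  using finite[of L] assms
proof (induction L)
  case empty
  have "(\<forall>l. y l = 0) \<longleftrightarrow> y = (\<lambda>i. 0)" for y :: "'i \<Rightarrow> cvec" by (simp only: fun_eq_iff[of y])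
  then have "sum_space {} V = {pack (\<lambda>i::'i. 0)}" by (simp add: sum_space_def)
  then have "sum_space {} V = {0}" by (simp only: pack_0)
  then show ?case by (simp add: dim_zero)
next
  case (insert l L)
  let ?S = "sum_space (insert l L) V"
  have sub: "cvec.subspace (V i)" if "i \<in> insert l L" for i
    using insert.prems that fin_dim_spaceD by blast
  have lin: "linear_between ?S (V l) (\<lambda>x. unpack x l)"
    by (rule clinear_between[OF clinear_unpack]) (auto simp: sum_space_def)
  have zero: "0 \<in> V i" if "i \<in> insert l L" for i using sub[OF that] by (rule cvec.subspace_0)
  have "pack y \<in> ?S \<and> unpack (pack y) l = 0 \<longleftrightarrow> pack y \<in> sum_space L V" for y :: "'i \<Rightarrow> cvec"
    unfolding pack_in_sum_space unpack_pack using zero[of l] insert.hyps(2) by auto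
  then have "x \<in> ?S \<and> unpack x l = 0 \<longleftrightarrow> x \<in> sum_space L V" for x
    using sum_spaceE by metis
  then have ker: "{x \<in> ?S. unpack x l = 0} = sum_space L V" by blast
  have img: "(\<lambda>x. unpack x l) ` ?S = V l"
  proof (intro equalityI subsetI)
    fix v assume "v \<in> (\<lambda>x. unpack x l) ` ?S" then show "v \<in> V l" by (auto simp: sum_space_def)
  next
    fix v assume "v \<in> V l"
    then have "pack (single l v) \<in> ?S" unfolding pack_in_sum_space using zero by (auto simp: single_def)
    then have "unpack (pack (single l v)) l \<in> (\<lambda>x. unpack x l) ` ?S" by blast
    then show "v \<in> (\<lambda>x. unpack x l) ` ?S" by (simp add: single_def)
  qed
  have "cvec.dim ?S = cvec.dim (sum_space L V) + cvec.dim (V l)"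
    using rank_nullity[OF fin_dim_sum_space lin] insert.prems by (simp add: ker img)
  then show ?case using insert by simp
qed


section \<open>Representations, idempotents and equivalences\<close>

lemma representation_space:
  "representation Q M \<Longrightarrow> fin_dim_space (space_at M i)"
  "representation Q M \<Longrightarrow> cvec.subspace (space_at M i)"
  by (auto simp: representation_def fin_dim_spaceD)

lemma representation_map:
  "representation Q M \<Longrightarrow> (i, j) \<in> Q \<Longrightarrow> linear_between (space_at M i) (space_at M j) (map_along M (i, j))"
  by (auto simp: representation_def)

lemma representation_zero: "representation Q M \<Longrightarrow> 0 \<in> space_at M i"
  by (rule cvec.subspace_0[OF representation_space(2)])

lemma morphism_linear:
  "morphism Q M N f \<Longrightarrow> linear_between (space_at M i) (space_at N i) (f i)"
  by (simp add: morphism_def)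

lemma morphism_in: "morphism Q M N f \<Longrightarrow> x \<in> space_at M i \<Longrightarrow> f i x \<in> space_at N i"
  by (rule linear_betweenD(1)[OF morphism_linear])

lemma morphism_commute:
  "morphism Q M N f \<Longrightarrow> (i, j) \<in> Q \<Longrightarrow> x \<in> space_at M i \<Longrightarrow>
    f j (map_along M (i, j) x) = map_along N (i, j) (f i x)"
  by (auto simp: morphism_def)

lemma morphismI:
  assumes "\<And>i. linear_between (space_at M i) (space_at N i) (f i)"
    and "\<And>i j x. (i, j) \<in> Q \<Longrightarrow> x \<in> space_at M i \<Longrightarrow> f j (map_along M (i, j) x) = map_along N (i, j) (f i x)"
  shows "morphism Q M N f"
  using assms by (auto simp: morphism_def)

lemma compose_mor_apply [simp]: "compose_mor g f i x = g i (f i x)"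
  by (simp add: compose_mor_def)

lemma morphism_compose:
  assumes "morphism Q M N f" "morphism Q N L g" shows "morphism Q M L (compose_mor g f)"
proof (rule morphismI)
  fix i
  have "linear_between (space_at M i) (space_at L i) (\<lambda>x. g i (f i x))"
    by (rule linear_between_compose[OF morphism_linear[OF assms(1)] morphism_linear[OF assms(2)]])
  then show "linear_between (space_at M i) (space_at L i) (compose_mor g f i)"
    by (simp add: compose_mor_def o_def)
next
  fix i j x assume "(i, j) \<in> Q" "x \<in> space_at M i"
  then show "compose_mor g f j (map_along M (i, j) x) = map_along L (i, j) (compose_mor g f i x)"
    using assms by (simp add: morphism_commute morphism_in)
qed

lemma morphism_id: "morphism Q M M (\<lambda>i. id)"
  by (rule morphismI) (auto simp: linear_between_def)

definition zero_mor :: "'i \<Rightarrow> cvec \<Rightarrow> cvec" where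
  "zero_mor = (\<lambda>i x. 0)"

lemma zero_mor_apply [simp]: "zero_mor i x = 0"
  by (simp add: zero_mor_def)

lemma morphism_zero:
  assumes "representation Q N" shows "morphism Q M N zero_mor"
proof (rule morphismI)
  fix i show "linear_between (space_at M i) (space_at N i) (zero_mor i)"
    using representation_zero[OF assms] by (simp add: linear_between_def)
next
  fix i j x assume "(i, j) \<in> Q"
  then show "zero_mor j (map_along M (i, j) x) = map_along N (i, j) (zero_mor i x)"
    using linear_between_zero[OF representation_map[OF assms] representation_space(2)[OF assms]] by simp
qed

lemma equal_onD: "equal_on M f g \<Longrightarrow> x \<in> space_at M i \<Longrightarrow> f i x = g i x"
  by (simp add: equal_on_def)

lemma equal_onI: "(\<And>i x. x \<in> space_at M i \<Longrightarrow> f i x = g i x) \<Longrightarrow> equal_on M f g"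
  by (simp add: equal_on_def)

lemma split_monoI:
  "morphism Q M N f \<Longrightarrow> morphism Q N M r \<Longrightarrow> (\<And>i x. x \<in> space_at M i \<Longrightarrow> r i (f i x) = x) \<Longrightarrow> split_mono Q M N f"
  unfolding split_mono_def equal_on_def by (auto intro!: exI[of _ r])

lemma split_monoD:
  "split_mono Q M N f \<Longrightarrow> \<exists>r. morphism Q N M r \<and> (\<forall>i. \<forall>x\<in>space_at M i. r i (f i x) = x)"
  unfolding split_mono_def equal_on_def by auto

lemma split_epiI:
  "morphism Q M N f \<Longrightarrow> morphism Q N M s \<Longrightarrow> (\<And>i x. x \<in> space_at N i \<Longrightarrow> f i (s i x) = x) \<Longrightarrow> split_epi Q M N f"
  unfolding split_epi_def equal_on_def by (auto intro!: exI[of _ s])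

lemma split_epiD:
  "split_epi Q M N f \<Longrightarrow> \<exists>s. morphism Q N M s \<and> (\<forall>i. \<forall>x\<in>space_at N i. f i (s i x) = x)"
  unfolding split_epi_def equal_on_def by auto

lemma isomorphic_repsI:
  "morphism Q M N f \<Longrightarrow> morphism Q N M g \<Longrightarrow> (\<And>i x. x \<in> space_at M i \<Longrightarrow> g i (f i x) = x) \<Longrightarrow>
    (\<And>i x. x \<in> space_at N i \<Longrightarrow> f i (g i x) = x) \<Longrightarrow> isomorphic_reps Q M N"
  unfolding isomorphic_reps_def equal_on_def by (rule exI[of _ f], rule exI[of _ g]) auto

lemma isomorphic_repsE:
  assumes "isomorphic_reps Q M N"
  obtains f g where "morphism Q M N f" "morphism Q N M g"
    "\<And>i x. x \<in> space_at M i \<Longrightarrow> g i (f i x) = x" "\<And>i x. x \<in> space_at N i \<Longrightarrow> f i (g i x) = x"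
  using assms unfolding isomorphic_reps_def equal_on_def by auto

lemma irreducibleI:
  assumes "morphism Q M N f" "\<not> split_mono Q M N f" "\<not> split_epi Q M N f"
    "\<And>L g h. representation Q L \<Longrightarrow> morphism Q M L h \<Longrightarrow> morphism Q L N g \<Longrightarrow>
      (\<And>i x. x \<in> space_at M i \<Longrightarrow> f i x = g i (h i x)) \<Longrightarrow> split_mono Q M L h \<or> split_epi Q L N g"
  shows "irreducible_morphism Q M N f"
  using assms unfolding irreducible_morphism_def equal_on_def by auto

lemma irreducibleD:
  assumes "irreducible_morphism Q M N f"
  shows "morphism Q M N f" "\<not> split_mono Q M N f" "\<not> split_epi Q M N f"
    "representation Q L \<Longrightarrow> morphism Q M L h \<Longrightarrow> morphism Q L N g \<Longrightarrow>
      (\<And>i x. x \<in> space_at M i \<Longrightarrow> f i x = g i (h i x)) \<Longrightarrow> split_mono Q M L h \<or> split_epi Q L N g"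
  using assms unfolding irreducible_morphism_def equal_on_def by auto

lemma iso_dim:
  assumes "representation Q M" "isomorphic_reps Q M N"
  shows "cvec.dim (space_at M i) = cvec.dim (space_at N i)"
proof -
  obtain f g where 1: "morphism Q M N f" "morphism Q N M g"
    "\<And>i x. x \<in> space_at M i \<Longrightarrow> g i (f i x) = x" "\<And>i x. x \<in> space_at N i \<Longrightarrow> f i (g i x) = x"
    using isomorphic_repsE[OF assms(2)] by blast
  have zero: "f i 0 = 0" "g i 0 = 0"
    using linear_between_zero[OF morphism_linear[OF 1(1)] representation_space(2)[OF assms(1)]]
    by (simp, metis 1(3) representation_zero[OF assms(1)])
  have "x = 0" if "x \<in> space_at M i" "f i x = 0" for x
    using 1(3)[OF that(1)] that(2) zero(2) by simp
  then have "{x \<in> space_at M i. f i x = 0} = {0}"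
    using zero(1) representation_zero[OF assms(1), of i] by auto
  moreover have "f i ` space_at M i = space_at N i"
  proof (intro equalityI subsetI)
    fix y assume "y \<in> f i ` space_at M i" then show "y \<in> space_at N i" using morphism_in[OF 1(1)] by auto
  next
    fix y assume y: "y \<in> space_at N i"
    then show "y \<in> f i ` space_at M i" using 1(4)[OF y] morphism_in[OF 1(2) y] by (metis imageI)
  qed
  ultimately show ?thesis
    using rank_nullity[OF representation_space(1)[OF assms(1)] morphism_linear[OF 1(1)], of i] by (simp add: dim_zero)
qed

section \<open>Direct sum decompositions and idempotent endomorphisms\<close>

text \<open>Decompositions correspond to idempotent endomorphisms. This formulation speaks of
  morphisms only and can be carried along an equivalence that changes the spaces.\<close>

definition trivial_idempotents :: "'i rel \<Rightarrow> 'i rep \<Rightarrow> bool" where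
  "trivial_idempotents Q M \<longleftrightarrow> (\<forall>e. morphism Q M M e \<and> equal_on M (compose_mor e e) e \<longrightarrow>
     equal_on M e zero_mor \<or> equal_on M e (\<lambda>i. id))"

text \<open>Image and kernel of an idempotent endomorphism are complementary
  subrepresentations.\<close>

lemma indecomposable_imp_trivial_idempotents:
  assumes "indecomposable Q M" shows "trivial_idempotents Q M"
  unfolding trivial_idempotents_def
proof (intro allI impI, elim conjE)
  fix e assume e: "morphism Q M M e" and idem: "equal_on M (compose_mor e e) e"
  have M: "representation Q M" using assms by (simp add: indecomposable_def)
  have ee: "e i (e i x) = e i x" if "x \<in> space_at M i" for i x
    using equal_onD[OF idem that] by simp
  let ?U = "\<lambda>i. e i ` space_at M i" and ?V = "\<lambda>i. {x \<in> space_at M i. e i x = 0}"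
  have lin: "linear_between (space_at M i) (space_at M i) (e i)" for i using morphism_linear[OF e] .
  have sub: "cvec.subspace (space_at M i)" for i using representation_space(2)[OF M] .
  have zero: "e i 0 = 0" for i using linear_between_zero[OF lin sub] .
  have in_M: "e i x \<in> space_at M i" if "x \<in> space_at M i" for i x using morphism_in[OF e that] .
  have "subrep Q M ?U"
    unfolding subrep_def
  proof (intro conjI allI ballI)
    fix i show "cvec.subspace (?U i)" using linear_between_image[OF lin sub] .
    show "?U i \<subseteq> space_at M i" using in_M by auto
  next
    fix a assume "a \<in> Q"
    then obtain i j where a: "a = (i, j)" "(i, j) \<in> Q" by (cases a) auto
    have "map_along M (i, j) (e i x) \<in> ?U j" if "x \<in> space_at M i" for x
      using morphism_commute[OF e a(2) that] linear_betweenD(1)[OF representation_map[OF M a(2)] that]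
      by (metis imageI)
    then show "case a of (i, j) \<Rightarrow> map_along M (i, j) ` ?U i \<subseteq> ?U j" using a(1) by auto
  qed
  moreover have "subrep Q M ?V"
    unfolding subrep_def
  proof (intro conjI allI ballI)
    fix i show "cvec.subspace (?V i)" using linear_between_kernel[OF lin sub] .
    show "?V i \<subseteq> space_at M i" by auto
  next
    fix a assume "a \<in> Q"
    then obtain i j where a: "a = (i, j)" "(i, j) \<in> Q" by (cases a) auto
    have "map_along M (i, j) x \<in> ?V j" if "x \<in> space_at M i" "e i x = 0" for x
      using morphism_commute[OF e a(2) that(1)] linear_betweenD(1)[OF representation_map[OF M a(2)] that(1)]
        linear_between_zero[OF representation_map[OF M a(2)] sub] that(2) by simp
    then show "case a of (i, j) \<Rightarrow> map_along M (i, j) ` ?V i \<subseteq> ?V j" using a(1) by auto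
  qed
  moreover have "direct_sum_of M ?U ?V"
    unfolding direct_sum_of_def
  proof (intro allI conjI equalityI subsetI)
    fix i x assume x: "x \<in> space_at M i"
    have "e i (x - e i x) = 0" using linear_between_diff[OF lin sub x in_M[OF x]] ee[OF x] by simp
    moreover have "x - e i x \<in> space_at M i" using cvec.subspace_diff[OF sub x in_M[OF x]] .
    moreover have "x = e i x + (x - e i x)" by simp
    ultimately show "x \<in> {x + y |x y. x \<in> ?U i \<and> y \<in> ?V i}" using x by blast
  next
    fix i x assume "x \<in> {x + y |x y. x \<in> ?U i \<and> y \<in> ?V i}"
    then show "x \<in> space_at M i" using in_M cvec.subspace_add[OF sub] by auto
  next
    fix i x assume "x \<in> ?U i \<inter> ?V i"
    then show "x \<in> {0}" using ee by auto
  next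
    fix i x assume "x \<in> {0::cvec}"
    then show "x \<in> ?U i \<inter> ?V i" using zero cvec.subspace_0[OF sub] by (auto simp: image_iff)
  qed
  ultimately consider "\<And>i. ?U i = {0}" | "\<And>i. ?V i = {0}"
    using assms unfolding indecomposable_def by meson
  then show "equal_on M e zero_mor \<or> equal_on M e (\<lambda>i. id)"
  proof cases
    case 1
    then have "equal_on M e zero_mor" by (intro equal_onI) (auto simp: zero_mor_def)
    then show ?thesis by blast
  next
    case 2
    have "equal_on M e (\<lambda>i. id)"
    proof (rule equal_onI)
      fix i x assume x: "x \<in> space_at M i"
      have "e i (x - e i x) = 0" using linear_between_diff[OF lin sub x in_M[OF x]] ee[OF x] by simp
      then have "x - e i x \<in> ?V i" using cvec.subspace_diff[OF sub x in_M[OF x]] by simp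
      then show "e i x = id x" using 2 by simp
    qed
    then show ?thesis by blast
  qed
qed

text \<open>A decomposition yields the projection to one summand along the other, an idempotent
  endomorphism that is zero or the identity only if a summand vanishes.\<close>

lemma trivial_idempotents_imp_indecomposable:
  assumes M: "representation Q M" and "\<exists>i. space_at M i \<noteq> {0}" and triv: "trivial_idempotents Q M"
  shows "indecomposable Q M"
  unfolding indecomposable_def
proof (intro conjI allI impI, fact, fact, elim conjE)
  fix U V assume U: "subrep Q M U" and V: "subrep Q M V" and UV: "direct_sum_of M U V"
  have sU: "cvec.subspace (U i)" and sV: "cvec.subspace (V i)" for i
    using U V by (auto simp: subrep_def)
  have sum: "\<exists>u v. u \<in> U i \<and> v \<in> V i \<and> x = u + v" if "x \<in> space_at M i" for i x
    using UV that unfolding direct_sum_of_def by blast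
  have int: "x = 0" if "x \<in> U i" "x \<in> V i" for i x
    using UV that unfolding direct_sum_of_def by blast
  have UM: "U i \<subseteq> space_at M i" and VM: "V i \<subseteq> space_at M i" for i
    using U V by (auto simp: subrep_def)
  have ex: "\<exists>u. u \<in> U i \<and> x - u \<in> V i" if "x \<in> space_at M i" for i x
    using sum[OF that] by (metis add_diff_cancel_left')
  \<comment> \<open>The component in \<open>U i\<close>. It is unique because \<open>U i\<close> and
    \<open>V i\<close> meet in 0, and uniqueness gives both linearity and compatibility with the
    arrows.\<close>
  define e where "e = (\<lambda>i x. SOME u. u \<in> U i \<and> x - u \<in> V i)"
  have e: "e i x \<in> U i" "x - e i x \<in> V i" if "x \<in> space_at M i" for i x
    using someI_ex[OF ex[OF that]] by (simp_all add: e_def)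
  have uniq: "e i x = u" if "x \<in> space_at M i" "u \<in> U i" "x - u \<in> V i" for i x u
  proof -
    have "(x - u) - (x - e i x) \<in> V i" by (rule cvec.subspace_diff[OF sV that(3) e(2)[OF that(1)]])
    then have "e i x - u \<in> V i" by simp
    moreover have "e i x - u \<in> U i" by (rule cvec.subspace_diff[OF sU e(1)[OF that(1)] that(2)])
    ultimately have "e i x - u = 0" using int by metis
    then show ?thesis by simp
  qed
  have mor: "morphism Q M M e"
  proof (rule morphismI)
    fix i
    note sM = representation_space(2)[OF M, of i]
    show "linear_between (space_at M i) (space_at M i) (e i)"
      unfolding linear_between_def
    proof (intro conjI ballI allI)
      fix x assume "x \<in> space_at M i" then show "e i x \<in> space_at M i" using e(1) UM by blast
    next
      fix x y assume x: "x \<in> space_at M i" and y: "y \<in> space_at M i"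
      have "(x - e i x) + (y - e i y) \<in> V i" by (rule cvec.subspace_add[OF sV e(2)[OF x] e(2)[OF y]])
      then have "x + y - (e i x + e i y) \<in> V i" by (simp add: algebra_simps)
      then show "e i (x + y) = e i x + e i y"
        by (rule uniq[OF cvec.subspace_add[OF sM x y] cvec.subspace_add[OF sU e(1)[OF x] e(1)[OF y]]])
    next
      fix c x assume x: "x \<in> space_at M i"
      have "cscale c (x - e i x) \<in> V i" by (rule cvec.subspace_scale[OF sV e(2)[OF x]])
      then have "cscale c x - cscale c (e i x) \<in> V i" by (simp add: cvec.scale_right_diff_distrib)
      then show "e i (cscale c x) = cscale c (e i x)"
        by (rule uniq[OF cvec.subspace_scale[OF sM x] cvec.subspace_scale[OF sU e(1)[OF x]]])
    qed
  next
    fix i j x assume ij: "(i, j) \<in> Q" and x: "x \<in> space_at M i"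
    note lin = representation_map[OF M ij]
    have "map_along M (i, j) (e i x) \<in> U j" "map_along M (i, j) (x - e i x) \<in> V j"
      using U V ij e[OF x] unfolding subrep_def by blast+
    moreover have "map_along M (i, j) (x - e i x) = map_along M (i, j) x - map_along M (i, j) (e i x)"
      by (rule linear_between_diff[OF lin representation_space(2)[OF M] x subsetD[OF UM e(1)[OF x]]])
    ultimately show "e j (map_along M (i, j) x) = map_along M (i, j) (e i x)"
      using uniq linear_betweenD(1)[OF lin x] by simp
  qed
  have e_U: "e i x = x" if "x \<in> U i" for i x
    using uniq[of x i x] that UM cvec.subspace_0[OF sV] by auto
  have e_V: "e i x = 0" if "x \<in> V i" for i x
    using uniq[of x i 0] that VM cvec.subspace_0[OF sU] by auto
  have "equal_on M (compose_mor e e) e"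
    using e_U e(1) by (intro equal_onI) simp
  then consider "equal_on M e zero_mor" | "equal_on M e (\<lambda>i. id)"
    using triv mor unfolding trivial_idempotents_def by blast
  then show "(\<forall>i. U i = {0}) \<or> (\<forall>i. V i = {0})"
  proof cases
    case 1
    have "x = 0" if "x \<in> U i" for i x
      using equal_onD[OF 1, of x i] e_U[OF that] UM that by auto
    then show ?thesis using cvec.subspace_0[OF sU] by blast
  next
    case 2
    have "x = 0" if "x \<in> V i" for i x
      using equal_onD[OF 2, of x i] e_V[OF that] VM that by auto
    then show ?thesis using cvec.subspace_0[OF sV] by blast
  qed
qed

lemma indecomposable_idempotent:
  assumes "indecomposable Q M" "morphism Q M M e" "\<And>i x. x \<in> space_at M i \<Longrightarrow> e i (e i x) = e i x"
  shows "(\<forall>i. \<forall>x\<in>space_at M i. e i x = 0) \<or> (\<forall>i. \<forall>x\<in>space_at M i. e i x = x)"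
proof -
  have "equal_on M (compose_mor e e) e" using assms(3) by (intro equal_onI) simp
  then show ?thesis
    using indecomposable_imp_trivial_idempotents[OF assms(1)] assms(2)
    unfolding trivial_idempotents_def equal_on_def zero_mor_def by auto
qed

section \<open>Transfer along an equivalence that is the identity away from one vertex\<close>

text \<open>At \<open>k\<close> the representations of the two quivers have different spaces, so
  equality away from \<open>k\<close> is the comparison available between their morphisms.\<close>

definition agree_off :: "'i \<Rightarrow> 'i rep \<Rightarrow> ('i \<Rightarrow> cvec \<Rightarrow> cvec) \<Rightarrow> ('i \<Rightarrow> cvec \<Rightarrow> cvec) \<Rightarrow> bool" where
  "agree_off k M f g \<longleftrightarrow> (\<forall>i. i \<noteq> k \<longrightarrow> (\<forall>x\<in>space_at M i. f i x = g i x))"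

text \<open>Interface of the reflections. In the application \<open>P\<close> matches
  representations without summand concentrated at \<open>k\<close>; morphisms correspond and are
  determined away from \<open>k\<close>. As composites through an arbitrary \<open>L\<close> have to
  be transferred, the last two conditions supply a retract of \<open>L\<close> on the matched side
  through which composites between matched representations can be rerouted.\<close>

locale rep_equivalence =
  fixes Q1 Q2 :: "'i rel" and k :: 'i and P :: "'i rep \<Rightarrow> 'i rep \<Rightarrow> bool"
  assumes rep1: "P M M' \<Longrightarrow> representation Q1 M" and rep2: "P M M' \<Longrightarrow> representation Q2 M'"
    and spaces: "P M M' \<Longrightarrow> i \<noteq> k \<Longrightarrow> space_at M i = space_at M' i"
    and forward: "P M M' \<Longrightarrow> P N N' \<Longrightarrow> morphism Q1 M N f \<Longrightarrow> \<exists>f'. morphism Q2 M' N' f' \<and> agree_off k M f f'"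
    and backward: "P M M' \<Longrightarrow> P N N' \<Longrightarrow> morphism Q2 M' N' f' \<Longrightarrow> \<exists>f. morphism Q1 M N f \<and> agree_off k M f f'"
    and unique1: "P M M' \<Longrightarrow> P N N' \<Longrightarrow> morphism Q1 M N f \<Longrightarrow> morphism Q1 M N g \<Longrightarrow> agree_off k M f g \<Longrightarrow> equal_on M f g"
    and unique2: "P M M' \<Longrightarrow> P N N' \<Longrightarrow> morphism Q2 M' N' f' \<Longrightarrow> morphism Q2 M' N' g' \<Longrightarrow> agree_off k M' f' g' \<Longrightarrow> equal_on M' f' g'"
    and summand1: "representation Q1 L \<Longrightarrow> \<exists>L1 L1' \<iota> \<pi>. P L1 L1' \<and> morphism Q1 L1 L \<iota> \<and> morphism Q1 L L1 \<pi> \<and>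
      equal_on L1 (compose_mor \<pi> \<iota>) (\<lambda>i. id) \<and> (\<forall>M M' N N' g h. P M M' \<longrightarrow> P N N' \<longrightarrow> morphism Q1 M L h \<longrightarrow> morphism Q1 L N g \<longrightarrow>
        equal_on M (compose_mor g h) (compose_mor (compose_mor g \<iota>) (compose_mor \<pi> h)))"
    and summand2: "representation Q2 L' \<Longrightarrow> \<exists>L1 L1' \<iota> \<pi>. P L1 L1' \<and> morphism Q2 L1' L' \<iota> \<and> morphism Q2 L' L1' \<pi> \<and>
      equal_on L1' (compose_mor \<pi> \<iota>) (\<lambda>i. id) \<and> (\<forall>M M' N N' g h. P M M' \<longrightarrow> P N N' \<longrightarrow> morphism Q2 M' L' h \<longrightarrow> morphism Q2 L' N' g \<longrightarrow>
        equal_on M' (compose_mor g h) (compose_mor (compose_mor g \<iota>) (compose_mor \<pi> h)))"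
begin

text \<open>The conditions are symmetric in the two sides, so each transfer result also holds in the
  reverse direction.\<close>

lemma opposite: "rep_equivalence Q2 Q1 k (\<lambda>M' M. P M M')"
proof (unfold_locales, goal_cases)
  case (4 M M' N N' f)
  then obtain f1 where "morphism Q1 M' N' f1" "agree_off k M' f1 f" using backward[of M' M N' N f] by blast
  moreover have "agree_off k M f f1"
    using \<open>agree_off k M' f1 f\<close> spaces[OF 4(1)] unfolding agree_off_def by fastforce
  ultimately show ?case by blast
next
  case (5 M M' N N' f)
  then obtain f1 where "morphism Q2 M N f1" "agree_off k M' f f1" using forward[of M' M N' N f] by blast
  moreover have "agree_off k M f1 f"
    using \<open>agree_off k M' f f1\<close> spaces[OF 5(1)] unfolding agree_off_def by fastforce
  ultimately show ?case by blast
next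
  case (8 L)
  from summand2[OF this] show ?case by blast
next
  case (9 L)
  from summand1[OF this] show ?case by blast
next
  case (1 M M') then show ?case by (rule rep2)
next
  case (2 M M') then show ?case by (rule rep1)
next
  case (3 M M' i) then show ?case using spaces[of M' M i] by simp
next
  case (6 M M' N N' f g) then show ?case using unique2[of M' M N' N f g] by simp
next
  case (7 M M' N N' f g) then show ?case using unique1[of M' M N' N f g] by simp
qed

lemma agree_flip: "P M M' \<Longrightarrow> agree_off k M f g \<longleftrightarrow> agree_off k M' g f"
  using spaces[of M M'] unfolding agree_off_def by fastforce

lemma agree_compose:
  assumes "P M M'" "P N N'" "morphism Q1 M N f" "agree_off k M f f'" "agree_off k N g g'"
  shows "agree_off k M (compose_mor g f) (compose_mor g' f')"
  unfolding agree_off_def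
proof (intro allI impI ballI)
  fix i x assume "i \<noteq> k" "x \<in> space_at M i"
  then show "compose_mor g f i x = compose_mor g' f' i x"
    using assms(4,5) morphism_in[OF assms(3), of x i] by (simp add: agree_off_def)
qed

text \<open>The composite agrees away from \<open>k\<close> with one that is the identity, and by
  uniqueness it is then the identity at \<open>k\<close> as well.\<close>

lemma inverse_transfer:
  assumes P: "P M M'" "P N N'" and f: "morphism Q1 M N f" and g: "morphism Q1 N M g"
    and f': "morphism Q2 M' N' f'" and g': "morphism Q2 N' M' g'"
    and "agree_off k M f f'" "agree_off k N g g'"
    and inv: "\<And>i x. x \<in> space_at M' i \<Longrightarrow> g' i (f' i x) = x"
    and x: "x \<in> space_at M i"
  shows "g i (f i x) = x"
proof -
  have "agree_off k M (compose_mor g f) (compose_mor g' f')" by (rule agree_compose[OF P f assms(7,8)])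
  then have "agree_off k M (compose_mor g f) (\<lambda>i. id)"
    using inv spaces[OF P(1)] unfolding agree_off_def by simp
  then have "equal_on M (compose_mor g f) (\<lambda>i. id)"
    by (rule unique1[OF P(1) P(1) morphism_compose[OF f g] morphism_id])
  from equal_onD[OF this x] show ?thesis by simp
qed

text \<open>If \<open>M\<close> vanished, the identity and zero on \<open>M'\<close> would agree
  away from \<open>k\<close>, hence also at \<open>k\<close>.\<close>

lemma nonzero_transfer:
  assumes P: "P M M'" and "\<exists>i. space_at M' i \<noteq> {0}" shows "\<exists>i. space_at M i \<noteq> {0}"
proof (rule ccontr)
  assume "\<not> (\<exists>i. space_at M i \<noteq> {0})"
  then have "agree_off k M' (\<lambda>i. id) zero_mor"
    using spaces[OF P] unfolding agree_off_def by auto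
  then have "equal_on M' (\<lambda>i. id) zero_mor"
    by (rule unique2[OF P P morphism_id morphism_zero[OF rep2[OF P]]])
  then have "x = 0" if "x \<in> space_at M' i" for i x using equal_onD[OF _ that] by fastforce
  then show False using assms(2) representation_zero[OF rep2[OF P]] by blast
qed

lemma iso_transfer:
  assumes P: "P M M'" "P N N'" and "isomorphic_reps Q2 M' N'" shows "isomorphic_reps Q1 M N"
proof -
  obtain f' g' where 1: "morphism Q2 M' N' f'" "morphism Q2 N' M' g'"
    "\<And>i x. x \<in> space_at M' i \<Longrightarrow> g' i (f' i x) = x" "\<And>i x. x \<in> space_at N' i \<Longrightarrow> f' i (g' i x) = x"
    using isomorphic_repsE[OF assms(3)] by blast
  obtain f where f: "morphism Q1 M N f" "agree_off k M f f'" using backward[OF P 1(1)] by blast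
  obtain g where g: "morphism Q1 N M g" "agree_off k N g g'" using backward[OF P(2,1) 1(2)] by blast
  show ?thesis
    by (rule isomorphic_repsI[OF f(1) g(1)])
      (use inverse_transfer[OF P f(1) g(1) 1(1,2) f(2) g(2) 1(3)] inverse_transfer[OF P(2,1) g(1) f(1) 1(2,1) g(2) f(2) 1(4)] in auto)
qed

lemma trivial_idempotents_transfer:
  assumes P: "P M M'" and triv: "trivial_idempotents Q2 M'" shows "trivial_idempotents Q1 M"
  unfolding trivial_idempotents_def
proof (intro allI impI, elim conjE)
  fix e assume e: "morphism Q1 M M e" and idem: "equal_on M (compose_mor e e) e"
  obtain e' where e': "morphism Q2 M' M' e'" "agree_off k M e e'" using forward[OF P P e] by blast
  have "agree_off k M (compose_mor e e) (compose_mor e' e')" using agree_compose[OF P P e e'(2) e'(2)] .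
  then have "agree_off k M' (compose_mor e' e') e'"
    unfolding agree_off_def
  proof (intro allI impI ballI)
    fix i x assume "i \<noteq> k" "x \<in> space_at M' i"
      and *: "\<forall>i. i \<noteq> k \<longrightarrow> (\<forall>x\<in>space_at M i. compose_mor e e i x = compose_mor e' e' i x)"
    then have x: "x \<in> space_at M i" using spaces[OF P] by simp
    have "compose_mor e' e' i x = compose_mor e e i x" using * \<open>i \<noteq> k\<close> x by simp
    also have "\<dots> = e i x" by (rule equal_onD[OF idem x])
    also have "\<dots> = e' i x" using e'(2) \<open>i \<noteq> k\<close> x by (simp add: agree_off_def)
    finally show "compose_mor e' e' i x = e' i x" .
  qed
  then have "equal_on M' (compose_mor e' e') e'"
    by (rule unique2[OF P P morphism_compose[OF e'(1) e'(1)] e'(1)])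
  then consider "equal_on M' e' zero_mor" | "equal_on M' e' (\<lambda>i. id)"
    using triv[unfolded trivial_idempotents_def, rule_format, of e'] e'(1) by blast
  then show "equal_on M e zero_mor \<or> equal_on M e (\<lambda>i. id)"
  proof cases
    case 1
    then have "agree_off k M e zero_mor" using e'(2) equal_onD[OF 1] spaces[OF P] unfolding agree_off_def by simp
    then show ?thesis using unique1[OF P P e morphism_zero[OF rep1[OF P]]] by simp
  next
    case 2
    then have "agree_off k M e (\<lambda>i. id)" using e'(2) equal_onD[OF 2] spaces[OF P] unfolding agree_off_def by simp
    then show ?thesis using unique1[OF P P e morphism_id] by simp
  qed
qed

lemma indecomposable_transfer:
  assumes P: "P M M'" and "indecomposable Q2 M'" shows "indecomposable Q1 M"
proof (rule trivial_idempotents_imp_indecomposable)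
  show "representation Q1 M" using rep1 P by blast
  show "\<exists>i. space_at M i \<noteq> {0}" using nonzero_transfer[OF P] assms(2) by (simp add: indecomposable_def)
  show "trivial_idempotents Q1 M"
    using trivial_idempotents_transfer[OF P] indecomposable_imp_trivial_idempotents assms(2) by blast
qed

text \<open>The middle term \<open>L\<close> of a factorization need not be matched by
  \<open>P\<close>, so the factorization is rerouted through the retract \<open>L1\<close> and
  transferred there. A retraction of the map into \<open>L1\<close>, composed with
  \<open>\<pi>\<close>, is one for the map into \<open>L\<close>; a section is composed with
  \<open>\<iota>\<close>.\<close>

lemma irreducible_transfer:
  assumes P: "P M M'" "P N N'" and "irreducible_morphism Q2 M' N' f'"
  shows "\<exists>f. irreducible_morphism Q1 M N f"
proof -
  note f'D = irreducibleD[OF assms(3)]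
  obtain f where f: "morphism Q1 M N f" "agree_off k M f f'" using backward[OF P f'D(1)] by blast
  interpret op: rep_equivalence Q2 Q1 k "\<lambda>M' M. P M M'" by (rule opposite)
  have f'_f: "agree_off k M' f' f" using f(2) agree_flip[OF P(1)] by blast
  have "irreducible_morphism Q1 M N f"
  proof (rule irreducibleI)
    show "morphism Q1 M N f" by (fact f(1))
    show "\<not> split_mono Q1 M N f"
    proof
      assume "split_mono Q1 M N f"
      then obtain r where r: "morphism Q1 N M r" "\<And>i x. x \<in> space_at M i \<Longrightarrow> r i (f i x) = x"
        by (blast dest: split_monoD)
      obtain r' where r': "morphism Q2 N' M' r'" "agree_off k N' r' r" using op.backward[OF P(2,1) r(1)] by blast
      have "r' i (f' i x) = x" if "x \<in> space_at M' i" for i x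
        using op.inverse_transfer[OF P f'D(1) r'(1) f(1) r(1) f'_f r'(2) r(2) that] .
      then have "split_mono Q2 M' N' f'" by (rule split_monoI[OF f'D(1) r'(1)])
      then show False using f'D(2) by blast
    qed
    show "\<not> split_epi Q1 M N f"
    proof
      assume "split_epi Q1 M N f"
      then obtain r where r: "morphism Q1 N M r" "\<And>i x. x \<in> space_at N i \<Longrightarrow> f i (r i x) = x"
        by (blast dest: split_epiD)
      obtain r' where r': "morphism Q2 N' M' r'" "agree_off k N' r' r" using op.backward[OF P(2,1) r(1)] by blast
      have "f' i (r' i x) = x" if "x \<in> space_at N' i" for i x
        using op.inverse_transfer[OF P(2,1) r'(1) f'D(1) r(1) f(1) r'(2) f'_f r(2) that] .
      then have "split_epi Q2 M' N' f'" by (rule split_epiI[OF f'D(1) r'(1)])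
      then show False using f'D(3) by blast
    qed
    fix L g h assume L: "representation Q1 L" and h: "morphism Q1 M L h" and g: "morphism Q1 L N g"
      and eq: "\<And>i x. x \<in> space_at M i \<Longrightarrow> f i x = g i (h i x)"
    obtain L1 L1' \<iota> \<pi> where L1: "P L1 L1'" and \<iota>: "morphism Q1 L1 L \<iota>" and \<pi>: "morphism Q1 L L1 \<pi>"
      and \<pi>\<iota>: "equal_on L1 (compose_mor \<pi> \<iota>) (\<lambda>i. id)"
      and fac_all: "\<forall>M M' N N' g h. P M M' \<longrightarrow> P N N' \<longrightarrow> morphism Q1 M L h \<longrightarrow> morphism Q1 L N g \<longrightarrow>
        equal_on M (compose_mor g h) (compose_mor (compose_mor g \<iota>) (compose_mor \<pi> h))"
      using summand1[OF L] by blast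
    have fac: "equal_on M (compose_mor g h) (compose_mor (compose_mor g \<iota>) (compose_mor \<pi> h))"
      using fac_all P h g by blast
    let ?h = "compose_mor \<pi> h" and ?g = "compose_mor g \<iota>"
    have h1: "morphism Q1 M L1 ?h" and g1: "morphism Q1 L1 N ?g"
      using morphism_compose[OF h \<pi>] morphism_compose[OF \<iota> g] .
    obtain h' where h': "morphism Q2 M' L1' h'" "agree_off k M' h' ?h" using op.backward[OF P(1) L1 h1] by blast
    obtain g' where g': "morphism Q2 L1' N' g'" "agree_off k L1' g' ?g" using op.backward[OF L1 P(2) g1] by blast
    have "agree_off k M' (compose_mor g' h') (compose_mor ?g ?h)"
      using op.agree_compose[OF P(1) L1 h'(1) h'(2) g'(2)] .
    then have "agree_off k M' f' (compose_mor g' h')"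
      using f'_f eq equal_onD[OF fac] spaces[OF P(1)] unfolding agree_off_def by simp
    then have "equal_on M' f' (compose_mor g' h')"
      by (rule unique2[OF P f'D(1) morphism_compose[OF h'(1) g'(1)]])
    then have "f' i x = g' i (h' i x)" if "x \<in> space_at M' i" for i x
      using equal_onD[OF _ that] by simp
    from f'D(4)[OF rep2[OF L1] h'(1) g'(1) this]
    have "split_mono Q2 M' L1' h' \<or> split_epi Q2 L1' N' g'" by blast
    moreover have "split_mono Q1 M L h" if *: "split_mono Q2 M' L1' h'"
    proof -
      obtain r' where r': "morphism Q2 L1' M' r'" "\<And>i x. x \<in> space_at M' i \<Longrightarrow> r' i (h' i x) = x"
        using * by (blast dest: split_monoD)
      obtain r where r: "morphism Q1 L1 M r" "agree_off k L1 r r'" using backward[OF L1 P(1) r'(1)] by blast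
      have "agree_off k M ?h h'" using h'(2) agree_flip[OF P(1)] by blast
      then have "r i (?h i x) = x" if "x \<in> space_at M i" for i x
        by (rule inverse_transfer[OF P(1) L1 h1 r(1) h'(1) r'(1) _ r(2) r'(2) that])
      then show ?thesis by (intro split_monoI[OF h morphism_compose[OF \<pi> r(1)]]) simp
    qed
    moreover have "split_epi Q1 L N g" if *: "split_epi Q2 L1' N' g'"
    proof -
      obtain r' where r': "morphism Q2 N' L1' r'" "\<And>i x. x \<in> space_at N' i \<Longrightarrow> g' i (r' i x) = x"
        using * by (blast dest: split_epiD)
      obtain r where r: "morphism Q1 N L1 r" "agree_off k N r r'" using backward[OF P(2) L1 r'(1)] by blast
      have "agree_off k L1 ?g g'" using g'(2) agree_flip[OF L1] by blast
      then have "?g i (r i x) = x" if "x \<in> space_at N i" for i x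
        by (rule inverse_transfer[OF P(2) L1 r(1) g1 r'(1) g'(1) r(2) _ r'(2) that])
      then show ?thesis by (intro split_epiI[OF g morphism_compose[OF r(1) \<iota>]]) simp
    qed
    ultimately show "split_mono Q1 M L h \<or> split_epi Q1 L N g" by blast
  qed
  then show ?thesis by blast
qed

end


section \<open>Reflection at a sink\<close>

definition concentrated :: "'i \<Rightarrow> 'i rep \<Rightarrow> bool" where
  "concentrated k M \<longleftrightarrow> (\<forall>i. i \<noteq> k \<longrightarrow> space_at M i = {0}) \<and> (\<exists>x. x \<noteq> 0 \<and> space_at M k = cvec.span {x})"

text \<open>The projection onto a line in the space at \<open>k\<close> is an endomorphism, because
  all other spaces vanish and there is no loop at \<open>k\<close>. Being idempotent and nonzero it
  is the identity, so the space is this line.\<close>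

lemma concentrated_indecomposable:
  assumes M: "indecomposable Q M" and "(k, k) \<notin> Q" and off: "\<And>i. i \<noteq> k \<Longrightarrow> space_at M i = {0}"
  shows "concentrated k M"
proof -
  have rep: "representation Q M" using M by (simp add: indecomposable_def)
  obtain i where "space_at M i \<noteq> {0}" using M by (auto simp: indecomposable_def)
  then have "space_at M k \<noteq> {0}" using off by (cases "i = k") auto
  then obtain x where x: "x \<in> space_at M k" "x \<noteq> 0" using representation_zero[OF rep, of k] by auto
  have sub: "cvec.span {x} \<subseteq> space_at M k"
    using x(1) cvec.span_minimal[OF _ representation_space(2)[OF rep]] by simp
  obtain p where p: "clinear p" "\<And>y. p y \<in> cvec.span {x}" "\<And>y. y \<in> cvec.span {x} \<Longrightarrow> p y = y"
    using projection_exists[OF cvec.subspace_span] by blast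
  define e where "e = (\<lambda>i. if i = k then p else id)"
  have "morphism Q M M e"
  proof (rule morphismI)
    fix i show "linear_between (space_at M i) (space_at M i) (e i)"
      using clinear_between[OF p(1), of "space_at M k" "space_at M k"] p(2) sub
      by (auto simp: e_def linear_between_def)
  next
    fix i j y assume ij: "(i, j) \<in> Q" and y: "y \<in> space_at M i"
    note lin = representation_map[OF rep ij]
    have z: "map_along M (i, j) 0 = 0" by (rule linear_between_zero[OF lin representation_space(2)[OF rep]])
    show "e j (map_along M (i, j) y) = map_along M (i, j) (e i y)"
    proof (cases "j = k")
      case True
      then have "i \<noteq> k" using ij assms(2) by auto
      then have "y = 0" using y off by auto
      then show ?thesis using z \<open>i \<noteq> k\<close> cvec_pair.linear_0[OF p(1)] True by (simp add: e_def)
    next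
      case False
      have "e i y \<in> space_at M i" using y p(2) sub by (auto simp: e_def)
      then have "map_along M (i, j) (e i y) \<in> {0}" "map_along M (i, j) y \<in> {0}"
        using linear_betweenD(1)[OF lin] y off[OF False] by auto
      then show ?thesis using False by (simp add: e_def)
    qed
  qed
  moreover have "e i (e i y) = e i y" for i y using p by (simp add: e_def)
  ultimately have "(\<forall>i. \<forall>y\<in>space_at M i. e i y = 0) \<or> (\<forall>i. \<forall>y\<in>space_at M i. e i y = y)"
    by (rule indecomposable_idempotent[OF M])
  moreover have "e k x = x" using p(3) cvec.span_base[of x "{x}"] by (simp add: e_def)
  ultimately have "\<forall>y\<in>space_at M k. e k y = y" using x by auto
  then have "space_at M k \<subseteq> cvec.span {x}" using p(2) by (auto simp: e_def) (metis)
  then show ?thesis using sub off x(2) by (auto simp: concentrated_def)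
qed

lemma dimension_concentrated:
  assumes "concentrated k M" shows "dimension_vector \<alpha> M = \<alpha> k"
proof -
  have "cvec.dim (space_at M i) = (if i = k then 1 else 0)" for i
    using assms dim_span1 dim_zero by (auto simp: concentrated_def)
  then have "dimension_vector \<alpha> M = (\<Sum>i\<in>UNIV. (if i = k then 1 else 0) *\<^sub>R \<alpha> i)"
    unfolding dimension_vector_def by (intro sum.cong) auto
  also have "\<dots> = \<alpha> k" by (simp add: if_distrib[of "\<lambda>c. c *\<^sub>R _"] cong: if_cong)
  finally show ?thesis .
qed

locale sink_reflection =
  fixes Q :: "'i::finite rel" and k :: 'i
  assumes sink_k: "sink Q k"
begin

abbreviation Q' :: "'i rel" where "Q' \<equiv> reverse_at k Q"
abbreviation preds :: "'i set" where "preds \<equiv> {l. (l, k) \<in> Q}"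

lemma not_out: "(k, l) \<notin> Q"
  using sink_k by (simp add: sink_def)

lemma pred_neq: "(l, k) \<in> Q \<Longrightarrow> l \<noteq> k"
  using not_out by blast

lemma Q'_iff: "(i, j) \<in> Q' \<longleftrightarrow> (i, j) \<in> Q \<and> i \<noteq> k \<and> j \<noteq> k \<or> i = k \<and> (j, k) \<in> Q"
  using not_out by (auto simp: reverse_at_iff)

text \<open>Elements of the direct sum over the arrows into \<open>k\<close>; values at other
  vertices are left free.\<close>

definition family :: "'i rep \<Rightarrow> ('i \<Rightarrow> cvec) \<Rightarrow> bool" where
  "family M y \<longleftrightarrow> (\<forall>l. (l, k) \<in> Q \<longrightarrow> y l \<in> space_at M l)"

text \<open>The canonical map of the direct sum to the space at \<open>k\<close>, whose kernel is
  the space at \<open>k\<close> after reflection.\<close>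

definition inflow :: "'i rep \<Rightarrow> ('i \<Rightarrow> cvec) \<Rightarrow> cvec" where
  "inflow M y = (\<Sum>l\<in>preds. map_along M (l, k) (y l))"

text \<open>Excludes a summand concentrated at the sink: a complement of the image would split off
  as a sum of such.\<close>

definition onto_at :: "'i rep \<Rightarrow> bool" where
  "onto_at M \<longleftrightarrow> (\<forall>x\<in>space_at M k. \<exists>y. family M y \<and> x = inflow M y)"

text \<open>The dual condition at a source, where the common kernel of the outgoing maps would split
  off.\<close>

definition into_at :: "'i rep \<Rightarrow> bool" where
  "into_at M \<longleftrightarrow> (\<forall>x\<in>space_at M k. (\<forall>l. (l, k) \<in> Q \<longrightarrow> map_along M (k, l) x = 0) \<longrightarrow> x = 0)"

text \<open>The last three conjuncts say that the sequence \<open>0 \<rightarrow> M' k \<rightarrow> (\<Oplus>l. M l) \<rightarrow> M k \<rightarrow> 0\<close>, with \<open>l\<close>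
  ranging over the neighbours of \<open>k\<close>, is exact. This relation replaces the pair of reflection
  functors of Bernstein, Gelfand and Ponomarev.\<close>

definition reflects :: "'i rep \<Rightarrow> 'i rep \<Rightarrow> bool" where
  "reflects M M' \<longleftrightarrow> representation Q M \<and> representation Q' M' \<and>
     (\<forall>i. i \<noteq> k \<longrightarrow> space_at M i = space_at M' i) \<and>
     (\<forall>i j. (i, j) \<in> Q \<longrightarrow> j \<noteq> k \<longrightarrow> (\<forall>x\<in>space_at M i. map_along M (i, j) x = map_along M' (i, j) x)) \<and>
     onto_at M \<and> into_at M' \<and>
     (\<forall>y. family M y \<longrightarrow> (inflow M y = 0 \<longleftrightarrow>
        (\<exists>x\<in>space_at M' k. \<forall>l. (l, k) \<in> Q \<longrightarrow> map_along M' (k, l) x = y l)))"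

lemma reflectsD:
  assumes "reflects M M'"
  shows "representation Q M" "representation Q' M'" "i \<noteq> k \<Longrightarrow> space_at M i = space_at M' i"
    "(i, j) \<in> Q \<Longrightarrow> j \<noteq> k \<Longrightarrow> x \<in> space_at M i \<Longrightarrow> map_along M (i, j) x = map_along M' (i, j) x"
    "onto_at M" "into_at M'"
    "family M y \<Longrightarrow> inflow M y = 0 \<longleftrightarrow> (\<exists>x\<in>space_at M' k. \<forall>l. (l, k) \<in> Q \<longrightarrow> map_along M' (k, l) x = y l)"
  using assms unfolding reflects_def by simp_all

lemma inflow_cong: "(\<And>l. (l, k) \<in> Q \<Longrightarrow> y l = z l) \<Longrightarrow> inflow M y = inflow M z"
  unfolding inflow_def by (intro sum.cong) auto

lemma inflow_single:
  assumes "representation Q M" "(i, k) \<in> Q"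
  shows "inflow M (single i v) = map_along M (i, k) v"
proof -
  have "inflow M (single i v) = (\<Sum>l\<in>preds. if l = i then map_along M (i, k) v else 0)"
    unfolding inflow_def using linear_between_zero[OF representation_map[OF assms(1)] representation_space(2)[OF assms(1)]]
    by (intro sum.cong) (auto simp: single_def)
  then show ?thesis using assms(2) by simp
qed

lemma inflow_in:
  assumes "representation Q M" "family M y" shows "inflow M y \<in> space_at M k"
  unfolding inflow_def
proof (rule cvec.subspace_sum[OF representation_space(2)[OF assms(1)]])
  fix l assume "l \<in> preds"
  then have l: "(l, k) \<in> Q" by simp
  show "map_along M (l, k) (y l) \<in> space_at M k"
    using linear_betweenD(1)[OF representation_map[OF assms(1) l]] assms(2) l by (simp add: family_def)
qed

lemma family_add: "representation Q M \<Longrightarrow> family M y \<Longrightarrow> family M z \<Longrightarrow> family M (\<lambda>l. y l + z l)"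
  using cvec.subspace_add[OF representation_space(2)[of Q M]] unfolding family_def by blast

lemma family_diff: "representation Q M \<Longrightarrow> family M y \<Longrightarrow> family M z \<Longrightarrow> family M (\<lambda>l. y l - z l)"
  using cvec.subspace_diff[OF representation_space(2)[of Q M]] unfolding family_def by blast

lemma family_scale: "representation Q M \<Longrightarrow> family M y \<Longrightarrow> family M (\<lambda>l. cscale c (y l))"
  using cvec.subspace_scale[OF representation_space(2)[of Q M]] unfolding family_def by blast

lemma inflow_add:
  assumes "representation Q M" "family M y" "family M z"
  shows "inflow M (\<lambda>l. y l + z l) = inflow M y + inflow M z"
  unfolding inflow_def sum.distrib[symmetric]
proof (rule sum.cong[OF refl])
  fix l assume "l \<in> preds"
  then show "map_along M (l, k) (y l + z l) = map_along M (l, k) (y l) + map_along M (l, k) (z l)"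
    using linear_betweenD(2)[OF representation_map[OF assms(1)]] assms(2,3) by (simp add: family_def)
qed

lemma inflow_diff:
  assumes "representation Q M" "family M y" "family M z"
  shows "inflow M (\<lambda>l. y l - z l) = inflow M y - inflow M z"
  unfolding inflow_def sum_subtractf[symmetric]
proof (rule sum.cong[OF refl])
  fix l assume "l \<in> preds"
  then show "map_along M (l, k) (y l - z l) = map_along M (l, k) (y l) - map_along M (l, k) (z l)"
    using linear_between_diff[OF representation_map[OF assms(1)] representation_space(2)[OF assms(1)]] assms(2,3)
    by (simp add: family_def)
qed

lemma inflow_scale:
  assumes "representation Q M" "family M y"
  shows "inflow M (\<lambda>l. cscale c (y l)) = cscale c (inflow M y)"
  unfolding inflow_def cvec.scale_sum_right
proof (rule sum.cong[OF refl])
  fix l assume "l \<in> preds"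
  then show "map_along M (l, k) (cscale c (y l)) = cscale c (map_along M (l, k) (y l))"
    using linear_betweenD(3)[OF representation_map[OF assms(1)]] assms(2) by (simp add: family_def)
qed

lemma family_morphism: "morphism Q M N f \<Longrightarrow> family M y \<Longrightarrow> family N (\<lambda>l. f l (y l))"
  using morphism_in[of Q M N f] unfolding family_def by blast

lemma inflow_morphism:
  assumes "representation Q M" "morphism Q M N f" "family M y"
  shows "f k (inflow M y) = inflow N (\<lambda>l. f l (y l))"
proof -
  have y: "y l \<in> space_at M l" if "l \<in> preds" for l using assms(3) that by (simp add: family_def)
  have "map_along M (l, k) (y l) \<in> space_at M k" if "l \<in> preds" for l
    using linear_betweenD(1)[OF representation_map[OF assms(1)]] y[OF that] that by simp
  then have "f k (inflow M y) = (\<Sum>l\<in>preds. f k (map_along M (l, k) (y l)))"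
    unfolding inflow_def
    by (rule linear_between_sum[OF morphism_linear[OF assms(2)] representation_space(2)[OF assms(1)]])
  also have "\<dots> = inflow N (\<lambda>l. f l (y l))"
    unfolding inflow_def using morphism_commute[OF assms(2)] y by (intro sum.cong) auto
  finally show ?thesis .
qed

text \<open>Each vector at \<open>k\<close> is the inflow of a family, and a morphism moves the
  family by its components away from \<open>k\<close>.\<close>

lemma unique_onto:
  assumes "representation Q M" "onto_at M" "morphism Q M N f" "morphism Q M N g" "agree_off k M f g"
  shows "equal_on M f g"
proof (rule equal_onI)
  fix i x assume x: "x \<in> space_at M i"
  show "f i x = g i x"
  proof (cases "i = k")
    case True
    then obtain y where y: "family M y" "x = inflow M y" using x assms(2) by (auto simp: onto_at_def)
    have "inflow N (\<lambda>l. f l (y l)) = inflow N (\<lambda>l. g l (y l))"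
      using y(1) assms(5) pred_neq by (intro inflow_cong) (simp add: family_def agree_off_def)
    then show ?thesis
      using inflow_morphism[OF assms(1,3) y(1)] inflow_morphism[OF assms(1,4) y(1)] y(2) True by simp
  qed (use assms(5) x in \<open>simp add: agree_off_def\<close>)
qed

lemma into_eqI:
  assumes "representation Q' N" "into_at N" "x \<in> space_at N k" "y \<in> space_at N k"
    "\<And>l. (l, k) \<in> Q \<Longrightarrow> map_along N (k, l) x = map_along N (k, l) y"
  shows "x = y"
proof -
  note sub = representation_space(2)[OF assms(1), of k]
  have "map_along N (k, l) (x - y) = 0" if "(l, k) \<in> Q" for l
  proof -
    have "(k, l) \<in> Q'" using that by (simp add: Q'_iff)
    from linear_between_diff[OF representation_map[OF assms(1) this] sub assms(3,4)]
    show ?thesis using assms(5)[OF that] by simp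
  qed
  then have "x - y = 0" using assms(2) cvec.subspace_diff[OF sub assms(3,4)] unfolding into_at_def by blast
  then show ?thesis by simp
qed

lemma unique_into:
  assumes "representation Q' N" "into_at N" "morphism Q' M N f" "morphism Q' M N g" "agree_off k M f g"
    and M: "representation Q' M"
  shows "equal_on M f g"
proof (rule equal_onI)
  fix i x assume x: "x \<in> space_at M i"
  show "f i x = g i x"
  proof (cases "i = k")
    case True
    have "f k x = g k x"
    proof (rule into_eqI[OF assms(1,2)])
      show "f k x \<in> space_at N k" "g k x \<in> space_at N k"
        using morphism_in[OF assms(3)] morphism_in[OF assms(4)] x True by auto
      fix l assume l: "(l, k) \<in> Q"
      then have kl: "(k, l) \<in> Q'" by (simp add: Q'_iff)
      have "map_along M (k, l) x \<in> space_at M l"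
        using linear_betweenD(1)[OF representation_map[OF M kl]] x True by simp
      then have "f l (map_along M (k, l) x) = g l (map_along M (k, l) x)"
        using assms(5) pred_neq[OF l] by (simp add: agree_off_def)
      then show "map_along N (k, l) (f k x) = map_along N (k, l) (g k x)"
        using morphism_commute[OF assms(3) kl] morphism_commute[OF assms(4) kl] x True by simp
    qed
    then show ?thesis using True by simp
  qed (use assms(5) x in \<open>simp add: agree_off_def\<close>)
qed

text \<open>A vector of \<open>M'\<close> at \<open>k\<close> gives a family with zero inflow;
  \<open>f\<close> carries it to such a family of \<open>N\<close>, and this comes from exactly one
  vector of \<open>N'\<close> at \<open>k\<close>.\<close>

lemma reflect_forward:
  assumes M: "reflects M M'" and N: "reflects N N'" and f: "morphism Q M N f"
  shows "\<exists>f'. morphism Q' M' N' f' \<and> agree_off k M f f'"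
proof -
  note MD = reflectsD[OF M] and ND = reflectsD[OF N]
  have fam: "family M (\<lambda>l. map_along M' (k, l) x)" if "x \<in> space_at M' k" for x
    unfolding family_def
  proof (intro allI impI)
    fix l assume l: "(l, k) \<in> Q"
    then have "(k, l) \<in> Q'" by (simp add: Q'_iff)
    from linear_betweenD(1)[OF representation_map[OF MD(2) this] that]
    show "map_along M' (k, l) x \<in> space_at M l" using MD(3)[OF pred_neq[OF l]] by simp
  qed
  have ex: "\<exists>z\<in>space_at N' k. \<forall>l. (l, k) \<in> Q \<longrightarrow> map_along N' (k, l) z = f l (map_along M' (k, l) x)"
    if x: "x \<in> space_at M' k" for x
  proof -
    have "inflow M (\<lambda>l. map_along M' (k, l) x) = 0" using MD(7)[OF fam[OF x]] x by blast
    then have "inflow N (\<lambda>l. f l (map_along M' (k, l) x)) = 0"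
      using inflow_morphism[OF MD(1) f fam[OF x]]
        linear_between_zero[OF morphism_linear[OF f] representation_space(2)[OF MD(1)]] by metis
    then show ?thesis using ND(7)[OF family_morphism[OF f fam[OF x]]] by blast
  qed
  \<comment> \<open>Linearity of this choice follows from uniqueness, that is from joint injectivity
    of the maps out of \<open>k\<close>.\<close>
  define g where "g x = (SOME z. z \<in> space_at N' k \<and> (\<forall>l. (l, k) \<in> Q \<longrightarrow> map_along N' (k, l) z = f l (map_along M' (k, l) x)))" for x
  have g: "g x \<in> space_at N' k" "(l, k) \<in> Q \<Longrightarrow> map_along N' (k, l) (g x) = f l (map_along M' (k, l) x)"
    if "x \<in> space_at M' k" for x l
    using someI_ex[OF ex[OF that, unfolded Bex_def]] by (simp_all add: g_def)
  have g_eq: "g x = z" if "x \<in> space_at M' k" "z \<in> space_at N' k"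
    "\<And>l. (l, k) \<in> Q \<Longrightarrow> map_along N' (k, l) z = f l (map_along M' (k, l) x)" for x z
    by (rule into_eqI[OF ND(2,6) g(1)[OF that(1)] that(2)]) (simp add: g(2) that)
  note sM = representation_space(2)[OF MD(2), of k] and sN = representation_space(2)[OF ND(2), of k]
  have lin_g: "linear_between (space_at M' k) (space_at N' k) g"
    unfolding linear_between_def
  proof (intro conjI ballI allI)
    fix x assume "x \<in> space_at M' k" then show "g x \<in> space_at N' k" by (rule g)
  next
    fix x y assume x: "x \<in> space_at M' k" and y: "y \<in> space_at M' k"
    show "g (x + y) = g x + g y"
    proof (rule g_eq)
      show "x + y \<in> space_at M' k" "g x + g y \<in> space_at N' k"
        using cvec.subspace_add[OF sM x y] cvec.subspace_add[OF sN g(1)[OF x] g(1)[OF y]] .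
      fix l assume l: "(l, k) \<in> Q"
      then have kl: "(k, l) \<in> Q'" by (simp add: Q'_iff)
      have "map_along M' (k, l) x \<in> space_at M l" "map_along M' (k, l) y \<in> space_at M l"
        using fam[OF x] fam[OF y] l by (auto simp: family_def)
      then show "map_along N' (k, l) (g x + g y) = f l (map_along M' (k, l) (x + y))"
        using linear_betweenD(2)[OF representation_map[OF MD(2) kl] x y] linear_betweenD(2)[OF morphism_linear[OF f]]
          linear_betweenD(2)[OF representation_map[OF ND(2) kl] g(1)[OF x] g(1)[OF y]] g(2)[OF x l] g(2)[OF y l] by simp
    qed
  next
    fix c x assume x: "x \<in> space_at M' k"
    show "g (cscale c x) = cscale c (g x)"
    proof (rule g_eq)
      show "cscale c x \<in> space_at M' k" "cscale c (g x) \<in> space_at N' k"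
        using cvec.subspace_scale[OF sM x] cvec.subspace_scale[OF sN g(1)[OF x]] .
      fix l assume l: "(l, k) \<in> Q"
      then have kl: "(k, l) \<in> Q'" by (simp add: Q'_iff)
      have "map_along M' (k, l) x \<in> space_at M l"
        using fam[OF x] l by (auto simp: family_def)
      then show "map_along N' (k, l) (cscale c (g x)) = f l (map_along M' (k, l) (cscale c x))"
        using linear_betweenD(3)[OF representation_map[OF MD(2) kl] x] linear_betweenD(3)[OF morphism_linear[OF f]]
          linear_betweenD(3)[OF representation_map[OF ND(2) kl] g(1)[OF x]] g(2)[OF x l] by simp
    qed
  qed
  let ?f' = "f(k := g)"
  have "morphism Q' M' N' ?f'"
  proof (rule morphismI)
    fix i show "linear_between (space_at M' i) (space_at N' i) (?f' i)"
      using lin_g morphism_linear[OF f, of i] MD(3)[of i] ND(3)[of i] by (cases "i = k") auto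
  next
    fix i j x assume ij: "(i, j) \<in> Q'" and x: "x \<in> space_at M' i"
    show "?f' j (map_along M' (i, j) x) = map_along N' (i, j) (?f' i x)"
    proof (cases "i = k")
      case True
      then have jk: "(j, k) \<in> Q" using ij by (auto simp: Q'_iff)
      then show ?thesis using g(2)[of x j] x pred_neq[OF jk] True by simp
    next
      case False
      then have ij: "(i, j) \<in> Q" "j \<noteq> k" using ij by (auto simp: Q'_iff)
      have x: "x \<in> space_at M i" using x MD(3)[OF False] by simp
      show ?thesis
        using morphism_commute[OF f ij(1) x] MD(4)[OF ij x] ND(4)[OF ij morphism_in[OF f x]] False ij(2) by simp
    qed
  qed
  moreover have "agree_off k M f ?f'" by (simp add: agree_off_def)
  ultimately show ?thesis by blast
qed

text \<open>The space of \<open>M\<close> at \<open>k\<close> is a quotient of the direct sum: a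
  vector is lifted to a family, \<open>f\<close> is applied to the components, and the result is
  summed up in \<open>N\<close>.\<close>

lemma reflect_backward:
  assumes M: "reflects M M'" and N: "reflects N N'" and f: "morphism Q' M' N' f"
  shows "\<exists>f'. morphism Q M N f' \<and> agree_off k M f' f"
proof -
  note MD = reflectsD[OF M] and ND = reflectsD[OF N]
  have fl: "f l y \<in> space_at N l" if "(l, k) \<in> Q" "y \<in> space_at M l" for l y
    using morphism_in[OF f, of y l] that MD(3)[OF pred_neq[OF that(1)]] ND(3)[OF pred_neq[OF that(1)]] by simp
  have lin_l: "linear_between (space_at M l) (space_at N l) (f l)" if "(l, k) \<in> Q" for l
    using morphism_linear[OF f, of l] MD(3)[OF pred_neq[OF that]] ND(3)[OF pred_neq[OF that]] by simp
  have fam: "family N (\<lambda>l. f l (y l))" if "family M y" for y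
    using that fl by (simp add: family_def)
  define g where "g x = inflow N (\<lambda>l. f l ((SOME y. family M y \<and> x = inflow M y) l))" for x
  \<comment> \<open>Independence of the lift: a family with zero inflow comes from a vector
    \<open>x\<close> of \<open>M'\<close> at \<open>k\<close>, and \<open>f k x\<close> shows that
    the image family has zero inflow too.\<close>
  have vanish: "inflow N (\<lambda>l. f l (y l)) = 0" if y: "family M y" "inflow M y = 0" for y
  proof -
    obtain x where x: "x \<in> space_at M' k" "\<And>l. (l, k) \<in> Q \<Longrightarrow> map_along M' (k, l) x = y l"
      using MD(7)[OF y(1)] y(2) by auto
    have "map_along N' (k, l) (f k x) = f l (y l)" if "(l, k) \<in> Q" for l
    proof -
      have "(k, l) \<in> Q'" using that by (simp add: Q'_iff)
      from morphism_commute[OF f this x(1)] show ?thesis using x(2)[OF that] by simp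
    qed
    then show ?thesis using ND(7)[OF fam[OF y(1)]] morphism_in[OF f x(1)] by blast
  qed
  have g_eq: "g x = inflow N (\<lambda>l. f l (y l))" if y: "family M y" and xy: "x = inflow M y" for x y
  proof -
    let ?z = "SOME y. family M y \<and> x = inflow M y"
    have z: "family M ?z \<and> x = inflow M ?z"
      by (rule someI[of "\<lambda>y. family M y \<and> x = inflow M y" y]) (use y xy in simp)
    have d: "family M (\<lambda>l. ?z l - y l)" "inflow M (\<lambda>l. ?z l - y l) = 0"
      using family_diff[OF MD(1)] inflow_diff[OF MD(1)] z y xy by auto
    have "inflow N (\<lambda>l. f l (?z l - y l)) = inflow N (\<lambda>l. f l (?z l) - f l (y l))"
    proof (rule inflow_cong)
      fix l assume l: "(l, k) \<in> Q"
      show "f l (?z l - y l) = f l (?z l) - f l (y l)"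
        by (rule linear_between_diff[OF lin_l[OF l] representation_space(2)[OF MD(1)]])
          (use z y l in \<open>simp_all add: family_def\<close>)
    qed
    also have "\<dots> = inflow N (\<lambda>l. f l (?z l)) - inflow N (\<lambda>l. f l (y l))"
      by (rule inflow_diff[OF ND(1)]) (use fam z y in auto)
    finally show ?thesis using vanish[OF d] by (simp add: g_def)
  qed
  have ex: "\<exists>y. family M y \<and> x = inflow M y" if "x \<in> space_at M k" for x
    using MD(5) that by (simp add: onto_at_def)
  have lin_g: "linear_between (space_at M k) (space_at N k) g"
    unfolding linear_between_def
  proof (intro conjI ballI allI)
    fix x assume "x \<in> space_at M k"
    then obtain y where "family M y" "x = inflow M y" using ex by blast
    then show "g x \<in> space_at N k" using g_eq inflow_in[OF ND(1) fam] by simp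
  next
    fix x x' assume "x \<in> space_at M k" "x' \<in> space_at M k"
    then obtain y y' where y: "family M y" "x = inflow M y" "family M y'" "x' = inflow M y'" using ex by metis
    have "g (x + x') = inflow N (\<lambda>l. f l (y l + y' l))"
      by (rule g_eq) (use y family_add[OF MD(1)] inflow_add[OF MD(1)] in auto)
    also have "\<dots> = inflow N (\<lambda>l. f l (y l) + f l (y' l))"
      using linear_betweenD(2)[OF lin_l] y by (intro inflow_cong) (simp add: family_def)
    also have "\<dots> = g x + g x'" using inflow_add[OF ND(1) fam fam] g_eq y by simp
    finally show "g (x + x') = g x + g x'" .
  next
    fix c x assume "x \<in> space_at M k"
    then obtain y where y: "family M y" "x = inflow M y" using ex by blast
    have "g (cscale c x) = inflow N (\<lambda>l. f l (cscale c (y l)))"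
      by (rule g_eq) (use y family_scale[OF MD(1)] inflow_scale[OF MD(1)] in auto)
    also have "\<dots> = inflow N (\<lambda>l. cscale c (f l (y l)))"
      using linear_betweenD(3)[OF lin_l] y by (intro inflow_cong) (simp add: family_def)
    also have "\<dots> = cscale c (g x)" using inflow_scale[OF ND(1) fam] g_eq y by simp
    finally show "g (cscale c x) = cscale c (g x)" .
  qed
  let ?f' = "f(k := g)"
  have "morphism Q M N ?f'"
  proof (rule morphismI)
    fix i show "linear_between (space_at M i) (space_at N i) (?f' i)"
      using lin_g morphism_linear[OF f, of i] MD(3)[of i] ND(3)[of i] by (cases "i = k") auto
  next
    fix i j x assume ij: "(i, j) \<in> Q" and x: "x \<in> space_at M i"
    have i: "i \<noteq> k" using ij not_out by auto
    show "?f' j (map_along M (i, j) x) = map_along N (i, j) (?f' i x)"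
    proof (cases "j = k")
      case True
      then have ik: "(i, k) \<in> Q" using ij by simp
      \<comment> \<open>For an arrow from \<open>i\<close> to \<open>k\<close>, the family with the
        single entry \<open>x\<close> is a lift of the image of \<open>x\<close>.\<close>
      let ?y = "single i x"
      have fy: "family M ?y" using x representation_zero[OF MD(1)] by (simp add: family_def single_def)
      have sum1: "inflow L (\<lambda>l. h l (?y l)) = map_along L (i, k) (h i x)"
        if L: "representation Q L" and h0: "\<And>l. (l, k) \<in> Q \<Longrightarrow> h l 0 = 0" for L h
      proof -
        have "inflow L (\<lambda>l. h l (?y l)) = inflow L (single i (h i x))"
          by (rule inflow_cong) (simp add: single_def h0)
        also have "\<dots> = map_along L (i, k) (h i x)" by (rule inflow_single[OF L ik])
        finally show ?thesis .
      qed
      have "inflow M ?y = map_along M (i, k) x" using sum1[OF MD(1), of "\<lambda>l. id"] by simp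
      moreover have "inflow N (\<lambda>l. f l (?y l)) = map_along N (i, k) (f i x)"
        by (rule sum1[OF ND(1)]) (rule linear_between_zero[OF lin_l representation_space(2)[OF MD(1)]])
      ultimately show ?thesis using g_eq[OF fy, of "map_along M (i, k) x"] True i by simp
    next
      case False
      have ij': "(i, j) \<in> Q'" using ij i False by (simp add: Q'_iff)
      have x': "x \<in> space_at M' i" using x MD(3)[OF i] by simp
      have fx: "f i x \<in> space_at N i" using morphism_in[OF f x'] ND(3)[OF i] by simp
      show ?thesis using morphism_commute[OF f ij' x'] MD(4)[OF ij False x] ND(4)[OF ij False fx] i False by simp
    qed
  qed
  moreover have "agree_off k M ?f' f" by (simp add: agree_off_def)
  ultimately show ?thesis by blast
qed

end

context sink_reflection
begin

section \<open>Construction of reflections and the change of dimension\<close>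

text \<open>Families are free at vertices without an arrow into \<open>k\<close>; setting these
  values to 0 gives the representative that is packed.\<close>

definition restrict_preds :: "('i \<Rightarrow> cvec) \<Rightarrow> 'i \<Rightarrow> cvec" where
  "restrict_preds y = (\<lambda>l. if (l, k) \<in> Q then y l else 0)"

lemma restrict_preds_simps [simp]:
  "(l, k) \<in> Q \<Longrightarrow> restrict_preds y l = y l" "(l, k) \<notin> Q \<Longrightarrow> restrict_preds y l = 0"
  by (simp_all add: restrict_preds_def)

lemma pack_restrict: "family M y \<Longrightarrow> pack (restrict_preds y) \<in> sum_space preds (space_at M)"
  by (simp add: pack_in_sum_space family_def)

lemma inflow_restrict: "inflow M (restrict_preds y) = inflow M y"
  by (rule inflow_cong) simp

lemma family_unpack: "x \<in> sum_space preds (space_at M) \<Longrightarrow> family M (unpack x)"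
  unfolding sum_space_def family_def by auto

lemma sum_space_eqI:
  assumes "x \<in> sum_space preds V" "y \<in> sum_space preds W" "\<And>l. (l, k) \<in> Q \<Longrightarrow> unpack x l = unpack y l"
  shows "x = y"
proof -
  obtain a b :: "'i \<Rightarrow> cvec" where ab: "x = pack a" "y = pack b" using assms(1,2) sum_spaceE by metis
  have "a l = b l" for l
  proof (cases "(l, k) \<in> Q")
    case True
    then show ?thesis using assms(3)[OF True] ab by simp
  next
    case False
    then show ?thesis using assms(1,2) ab by (simp add: pack_in_sum_space)
  qed
  then show ?thesis using ab by (simp add: fun_eq_iff[of a b])
qed

lemma fin_dim_sum: "representation Q0 M \<Longrightarrow> fin_dim_space (sum_space preds (space_at M))"
  by (rule fin_dim_sum_space) (rule representation_space)

lemma linear_inflow: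
  assumes "representation Q M"
  shows "linear_between (sum_space preds (space_at M)) (space_at M k) (\<lambda>x. inflow M (unpack x))"
  unfolding linear_between_def
proof (intro conjI ballI allI)
  fix x assume "x \<in> sum_space preds (space_at M)"
  then show "inflow M (unpack x) \<in> space_at M k" by (rule inflow_in[OF assms family_unpack])
next
  fix x y assume x: "x \<in> sum_space preds (space_at M)" and y: "y \<in> sum_space preds (space_at M)"
  have "inflow M (unpack (x + y)) = inflow M (\<lambda>l. unpack x l + unpack y l)"
    by (rule inflow_cong) (rule cvec_pair.linear_add[OF clinear_unpack])
  also have "\<dots> = inflow M (unpack x) + inflow M (unpack y)"
    by (rule inflow_add[OF assms family_unpack[OF x] family_unpack[OF y]])
  finally show "inflow M (unpack (x + y)) = inflow M (unpack x) + inflow M (unpack y)" .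
next
  fix c x assume x: "x \<in> sum_space preds (space_at M)"
  have "inflow M (unpack (cscale c x)) = inflow M (\<lambda>l. cscale c (unpack x l))"
    by (rule inflow_cong) (rule cvec_pair.linear_scale[OF clinear_unpack])
  also have "\<dots> = cscale c (inflow M (unpack x))"
    by (rule inflow_scale[OF assms family_unpack[OF x]])
  finally show "inflow M (unpack (cscale c x)) = cscale c (inflow M (unpack x))" .
qed

lemma inflow_image: "(\<lambda>x. inflow M (unpack x)) ` sum_space preds (space_at M) = {inflow M y | y. family M y}"
proof (intro equalityI subsetI)
  fix v assume "v \<in> (\<lambda>x. inflow M (unpack x)) ` sum_space preds (space_at M)"
  then show "v \<in> {inflow M y | y. family M y}" using family_unpack by blast
next
  fix v assume "v \<in> {inflow M y | y. family M y}"
  then obtain y where y: "v = inflow M y" "family M y" by blast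
  have "v = inflow M (unpack (pack (restrict_preds y)))" using y by (simp add: inflow_restrict)
  then show "v \<in> (\<lambda>x. inflow M (unpack x)) ` sum_space preds (space_at M)"
    using pack_restrict[OF y(2)] by blast
qed

text \<open>The canonical map from the source \<open>k\<close> into the direct sum of its
  neighbours, with value a single packed vector.\<close>

definition embed :: "'i rep \<Rightarrow> cvec \<Rightarrow> cvec" where
  "embed M' x = pack (restrict_preds (\<lambda>l. map_along M' (k, l) x))"

lemma unpack_embed: "(l, k) \<in> Q \<Longrightarrow> unpack (embed M' x) l = map_along M' (k, l) x"
  by (simp add: embed_def)

lemma linear_embed:
  assumes M': "representation Q' M'" and eq: "\<And>l. (l, k) \<in> Q \<Longrightarrow> V l = space_at M' l"
  shows "linear_between (space_at M' k) (sum_space preds V) (embed M')"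
proof -
  have map_k: "linear_between (space_at M' k) (space_at M' l) (map_along M' (k, l))" if "(l, k) \<in> Q" for l
    using representation_map[OF M', of k l] that by (simp add: Q'_iff)
  show ?thesis
    unfolding linear_between_def
  proof (intro conjI ballI allI)
    fix x assume "x \<in> space_at M' k"
    then show "embed M' x \<in> sum_space preds V"
      using linear_betweenD(1)[OF map_k] by (simp add: embed_def pack_in_sum_space eq)
  next
    fix x y assume x: "x \<in> space_at M' k" and y: "y \<in> space_at M' k"
    have "restrict_preds (\<lambda>l. map_along M' (k, l) (x + y)) =
        (\<lambda>l. restrict_preds (\<lambda>l. map_along M' (k, l) x) l + restrict_preds (\<lambda>l. map_along M' (k, l) y) l)"
      using linear_betweenD(2)[OF map_k x y] by (auto simp: restrict_preds_def)
    then show "embed M' (x + y) = embed M' x + embed M' y" by (simp only: embed_def pack_add)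
  next
    fix c x assume x: "x \<in> space_at M' k"
    have "restrict_preds (\<lambda>l. map_along M' (k, l) (cscale c x)) =
        (\<lambda>l. cscale c (restrict_preds (\<lambda>l. map_along M' (k, l) x) l))"
      using linear_betweenD(3)[OF map_k x] by (auto simp: restrict_preds_def)
    then show "embed M' (cscale c x) = cscale c (embed M' x)" by (simp only: embed_def pack_scale)
  qed
qed

text \<open>The space at \<open>k\<close> is replaced by the kernel of the inflow map, and the new
  arrows read off the components.\<close>

lemma reflect_exists:
  assumes M: "representation Q M" and onto: "onto_at M" shows "\<exists>M'. reflects M M'"
proof -
  let ?S = "sum_space preds (space_at M)"
  define K where "K = {x \<in> ?S. inflow M (unpack x) = 0}"
  define M' where "M' = \<lparr>space_at = (space_at M)(k := K),
    map_along = (\<lambda>(i, j) x. if i = k then unpack x j else map_along M (i, j) x)\<rparr>"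
  have fS: "fin_dim_space ?S" using fin_dim_sum[OF M] .
  have fK: "fin_dim_space K" unfolding K_def
    by (rule fin_dim_subspace[OF fS linear_between_kernel[OF linear_inflow[OF M] fin_dim_spaceD[OF fS]]]) auto
  have sp: "space_at M' i = space_at M i" if "i \<noteq> k" for i using that by (simp add: M'_def)
  have spk: "space_at M' k = K" by (simp add: M'_def)
  have mpk: "map_along M' (k, j) x = unpack x j" for j x by (simp add: M'_def)
  have mp: "map_along M' (i, j) x = map_along M (i, j) x" if "i \<noteq> k" for i j x using that by (simp add: M'_def)
  have mem: "unpack x l \<in> space_at M l" if "x \<in> K" "(l, k) \<in> Q" for x l
    using family_unpack[of x M] that by (simp add: K_def family_def)
  have "representation Q' M'"
    unfolding representation_def
  proof (intro conjI allI ballI)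
    fix i show "fin_dim_space (space_at M' i)"
      using fK representation_space(1)[OF M] by (cases "i = k") (simp_all add: sp spk)
  next
    fix a assume a: "a \<in> Q'"
    obtain i j where ij: "a = (i, j)" by (cases a) auto
    have "linear_between (space_at M' i) (space_at M' j) (map_along M' (i, j))"
    proof (cases "i = k")
      case True
      then have jk: "(j, k) \<in> Q" using a ij by (auto simp: Q'_iff)
      have "linear_between K (space_at M j) (\<lambda>x. unpack x j)"
        by (rule clinear_between[OF clinear_unpack]) (rule mem[OF _ jk])
      moreover have "map_along M' (k, j) = (\<lambda>x. unpack x j)" using mpk by (rule ext)
      ultimately show ?thesis using True sp[OF pred_neq[OF jk]] by (simp add: spk)
    next
      case False
      then have "(i, j) \<in> Q" "j \<noteq> k" using a ij by (auto simp: Q'_iff)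
      moreover have "map_along M' (i, j) = map_along M (i, j)" using mp[OF False] by (rule ext)
      ultimately show ?thesis using representation_map[OF M] False by (simp add: sp)
    qed
    then show "case a of (i, j) \<Rightarrow> linear_between (space_at M' i) (space_at M' j) (map_along M' (i, j))"
      using ij by simp
  qed
  moreover have "into_at M'"
    unfolding into_at_def
  proof (intro ballI impI)
    fix x assume "x \<in> space_at M' k" and z: "\<forall>l. (l, k) \<in> Q \<longrightarrow> map_along M' (k, l) x = 0"
    then have x: "x \<in> ?S" by (simp add: spk K_def)
    have "0 \<in> ?S" using cvec.subspace_0[OF fin_dim_spaceD[OF fS]] .
    then show "x = 0" by (rule sum_space_eqI[OF x]) (use z mpk cvec_pair.linear_0[OF clinear_unpack] in simp)
  qed
  moreover have "inflow M y = 0 \<longleftrightarrow> (\<exists>x\<in>space_at M' k. \<forall>l. (l, k) \<in> Q \<longrightarrow> map_along M' (k, l) x = y l)"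
    if y: "family M y" for y
  proof
    assume "inflow M y = 0"
    then have "pack (restrict_preds y) \<in> K" using pack_restrict[OF y] by (simp add: K_def inflow_restrict)
    then show "\<exists>x\<in>space_at M' k. \<forall>l. (l, k) \<in> Q \<longrightarrow> map_along M' (k, l) x = y l"
      using mpk by (intro bexI[of _ "pack (restrict_preds y)"]) (simp_all add: spk)
  next
    assume "\<exists>x\<in>space_at M' k. \<forall>l. (l, k) \<in> Q \<longrightarrow> map_along M' (k, l) x = y l"
    then obtain x where x: "x \<in> K" "\<And>l. (l, k) \<in> Q \<Longrightarrow> unpack x l = y l" by (auto simp: spk mpk)
    then show "inflow M y = 0" using inflow_cong[of "unpack x" y M] by (simp add: K_def)
  qed
  moreover have "space_at M i = space_at M' i" if "i \<noteq> k" for i using sp[OF that] by simp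
  moreover have "map_along M (i, j) x = map_along M' (i, j) x" if "(i, j) \<in> Q" for i j x
  proof -
    have "i \<noteq> k" using that not_out by blast
    then show ?thesis by (simp add: mp)
  qed
  ultimately have "reflects M M'"
    unfolding reflects_def using M onto by blast
  then show ?thesis by blast
qed

text \<open>The new space at \<open>k\<close> is the cokernel of the embedding. It has to be a
  subspace of the space of sequences, so it is realized as the image of \<open>C\<close>, the
  identity minus a projection onto the image of the embedding.\<close>

lemma coreflect_exists:
  assumes M': "representation Q' M'" and into: "into_at M'" shows "\<exists>M. reflects M M'"
proof -
  let ?S = "sum_space preds (space_at M')"
  have fS: "fin_dim_space ?S" using fin_dim_sum[OF M'] .
  have sub: "cvec.subspace (space_at M' i)" for i using representation_space(2)[OF M'] .
  have lin_emb: "linear_between (space_at M' k) ?S (embed M')" by (rule linear_embed[OF M']) simp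
  obtain p where p: "clinear p" "\<And>x. p x \<in> embed M' ` space_at M' k" "\<And>x. x \<in> embed M' ` space_at M' k \<Longrightarrow> p x = x"
    using projection_exists[OF linear_between_image[OF lin_emb sub]] by blast
  define C where "C v = v - p v" for v
  have linC: "clinear C"
    by (rule clinearI) (simp_all add: C_def cvec_pair.linear_add[OF p(1)] cvec_pair.linear_scale[OF p(1)]
        cvec.scale_right_diff_distrib)
  have lin_C: "linear_between ?S (C ` ?S) C" by (rule clinear_between[OF linC]) simp
  define M where "M = \<lparr>space_at = (space_at M')(k := C ` ?S),
    map_along = (\<lambda>(i, j) x. if j = k then C (pack (single i x)) else map_along M' (i, j) x)\<rparr>"
  have sp: "space_at M i = space_at M' i" if "i \<noteq> k" for i using that by (simp add: M_def)
  have spk: "space_at M k = C ` ?S" by (simp add: M_def)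
  have mpk: "map_along M (i, k) x = C (pack (single i x))" for i x by (simp add: M_def)
  have mp: "map_along M (i, j) x = map_along M' (i, j) x" if "j \<noteq> k" for i j x using that by (simp add: M_def)
  have fam: "family M y \<longleftrightarrow> family M' y" for y
    using sp[OF pred_neq] by (auto simp: family_def)
  have single_S: "pack (single i x) \<in> ?S" if "(i, k) \<in> Q" "x \<in> space_at M' i" for i x
    using that representation_zero[OF M'] by (auto simp: pack_in_sum_space single_def)
  have inflow_C: "inflow M y = C (pack (restrict_preds y))" for y
  proof -
    have "pack (restrict_preds y) = (\<Sum>l\<in>preds. pack (single l (restrict_preds y l)))"
      by (rule pack_singles) simp
    then have "C (pack (restrict_preds y)) = (\<Sum>l\<in>preds. C (pack (single l (restrict_preds y l))))"
      by (simp only: cvec_pair.linear_sum[OF linC])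
    also have "\<dots> = inflow M y" unfolding inflow_def by (rule sum.cong) (simp_all add: mpk)
    finally show ?thesis by simp
  qed
  have rep: "representation Q M"
    unfolding representation_def
  proof (intro conjI allI ballI)
    have "fin_dim_space (C ` ?S)" by (rule fin_dim_image[OF lin_C fS])
    then show "fin_dim_space (space_at M i)" for i
      using representation_space(1)[OF M'] by (cases "i = k") (simp_all add: sp spk)
  next
    fix a assume a: "a \<in> Q"
    obtain i j where ij: "a = (i, j)" by (cases a) auto
    have i: "i \<noteq> k" using a ij not_out by auto
    have "linear_between (space_at M i) (space_at M j) (map_along M (i, j))"
    proof (cases "j = k")
      case True
      have "linear_between (space_at M' i) ?S (\<lambda>x. pack (single i x))"
        by (rule clinear_between[OF clinear_pack_single]) (rule single_S, use a ij True in auto)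
      then have "linear_between (space_at M' i) (C ` ?S) (\<lambda>x. C (pack (single i x)))"
        by (rule linear_between_compose[OF _ lin_C])
      moreover have "map_along M (i, k) = (\<lambda>x. C (pack (single i x)))" using mpk by (rule ext)
      ultimately show ?thesis using True sp[OF i] by (simp add: spk)
    next
      case False
      then have "(i, j) \<in> Q'" using a ij i by (simp add: Q'_iff)
      moreover have "map_along M (i, j) = map_along M' (i, j)" using mp[OF False] by (rule ext)
      ultimately show ?thesis using representation_map[OF M'] i False by (simp add: sp)
    qed
    then show "case a of (i, j) \<Rightarrow> linear_between (space_at M i) (space_at M j) (map_along M (i, j))"
      using ij by simp
  qed
  have "onto_at M"
    unfolding onto_at_def
  proof
    fix x assume "x \<in> space_at M k"
    then obtain v where v: "v \<in> ?S" "x = C v" by (auto simp: spk)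
    have "pack (restrict_preds (unpack v)) = v"
      by (rule sum_space_eqI[OF pack_restrict[OF family_unpack[OF v(1)]] v(1)]) simp
    then have "x = inflow M (unpack v)" using v inflow_C by simp
    then show "\<exists>y. family M y \<and> x = inflow M y" using family_unpack[OF v(1)] fam by blast
  qed
  moreover have "inflow M y = 0 \<longleftrightarrow> (\<exists>x\<in>space_at M' k. \<forall>l. (l, k) \<in> Q \<longrightarrow> map_along M' (k, l) x = y l)"
    if y: "family M y" for y
  proof -
    let ?v = "pack (restrict_preds y)"
    have v: "?v \<in> ?S" using pack_restrict y fam by blast
    \<comment> \<open>The kernel of \<open>C\<close> is the fixed space of \<open>p\<close>, which
      is the image of the embedding.\<close>
    have "inflow M y = 0 \<longleftrightarrow> p ?v = ?v" unfolding inflow_C C_def by auto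
    also have "\<dots> \<longleftrightarrow> ?v \<in> embed M' ` space_at M' k" using p(2)[of ?v] p(3)[of ?v] by metis
    also have "\<dots> \<longleftrightarrow> (\<exists>x\<in>space_at M' k. \<forall>l. (l, k) \<in> Q \<longrightarrow> map_along M' (k, l) x = y l)"
    proof
      assume "?v \<in> embed M' ` space_at M' k"
      then obtain x where x: "?v = embed M' x" "x \<in> space_at M' k" by (rule imageE)
      have eq: "restrict_preds y = restrict_preds (\<lambda>l. map_along M' (k, l) x)" using x(1) by (simp add: embed_def)
      have "map_along M' (k, l) x = y l" if "(l, k) \<in> Q" for l
        using fun_cong[OF eq, of l] that by simp
      then show "\<exists>x\<in>space_at M' k. \<forall>l. (l, k) \<in> Q \<longrightarrow> map_along M' (k, l) x = y l" using x(2) by blast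
    next
      assume "\<exists>x\<in>space_at M' k. \<forall>l. (l, k) \<in> Q \<longrightarrow> map_along M' (k, l) x = y l"
      then obtain x where x: "x \<in> space_at M' k" "\<And>l. (l, k) \<in> Q \<Longrightarrow> map_along M' (k, l) x = y l" by blast
      then have "restrict_preds y = restrict_preds (\<lambda>l. map_along M' (k, l) x)"
        by (intro ext) (simp add: restrict_preds_def)
      then have "?v = embed M' x" by (simp add: embed_def)
      then show "?v \<in> embed M' ` space_at M' k" using x(1) by (rule image_eqI)
    qed
    finally show ?thesis .
  qed
  ultimately have "reflects M M'"
    unfolding reflects_def using rep M' into sp mp by blast
  then show ?thesis by blast
qed

text \<open>Rank and nullity for the exact sequence: inflow is onto, the embedding is injective, and
  its image is the kernel of inflow.\<close>

lemma reflects_dim: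
  assumes "reflects M M'"
  shows "cvec.dim (space_at M k) + cvec.dim (space_at M' k) = (\<Sum>l\<in>preds. cvec.dim (space_at M l))"
proof -
  note MD = reflectsD[OF assms]
  let ?S = "sum_space preds (space_at M)" and ?F = "\<lambda>x. inflow M (unpack x)"
  have "?F ` ?S = space_at M k"
    unfolding inflow_image using MD(5) inflow_in[OF MD(1)] unfolding onto_at_def by blast
  then have 1: "cvec.dim ?S = cvec.dim {x \<in> ?S. ?F x = 0} + cvec.dim (space_at M k)"
    using rank_nullity[OF fin_dim_sum[OF MD(1)] linear_inflow[OF MD(1)]] by simp
  have map_k: "linear_between (space_at M' k) (space_at M l) (map_along M' (k, l))" if "(l, k) \<in> Q" for l
    using representation_map[OF MD(2), of k l] MD(3)[OF pred_neq[OF that]] that by (simp add: Q'_iff)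
  have fam: "family M (\<lambda>l. map_along M' (k, l) x)" if "x \<in> space_at M' k" for x
    using linear_betweenD(1)[OF map_k that] by (simp add: family_def)
  have lin: "linear_between (space_at M' k) ?S (embed M')"
    by (rule linear_embed[OF MD(2) MD(3)[OF pred_neq]])
  have "x = 0" if x: "x \<in> space_at M' k" "embed M' x = 0" for x
  proof -
    have "map_along M' (k, l) x = 0" if "(l, k) \<in> Q" for l
      using unpack_embed[OF that, of M' x] x(2) cvec_pair.linear_0[OF clinear_unpack] by metis
    then show ?thesis using MD(6) x(1) unfolding into_at_def by blast
  qed
  moreover have "embed M' 0 = 0" by (rule linear_between_zero[OF lin representation_space(2)[OF MD(2)]])
  ultimately have "{x \<in> space_at M' k. embed M' x = 0} = {0}" using representation_zero[OF MD(2), of k] by auto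
  then have 2: "cvec.dim (space_at M' k) = cvec.dim (embed M' ` space_at M' k)"
    using rank_nullity[OF representation_space(1)[OF MD(2)] lin] by (simp add: dim_zero)
  have "embed M' ` space_at M' k = {x \<in> ?S. ?F x = 0}"
  proof (intro equalityI subsetI)
    fix v assume "v \<in> embed M' ` space_at M' k"
    then obtain x where x: "x \<in> space_at M' k" "v = embed M' x" by auto
    have "?F v = inflow M (\<lambda>l. map_along M' (k, l) x)" by (rule inflow_cong) (simp add: unpack_embed x(2))
    also have "\<dots> = 0" using MD(7)[OF fam[OF x(1)]] x(1) by blast
    finally show "v \<in> {x \<in> ?S. ?F x = 0}" using linear_betweenD(1)[OF lin x(1)] x(2) by simp
  next
    fix v assume "v \<in> {x \<in> ?S. ?F x = 0}"
    then have v: "v \<in> ?S" "?F v = 0" by auto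
    then obtain x where x: "x \<in> space_at M' k" "\<And>l. (l, k) \<in> Q \<Longrightarrow> map_along M' (k, l) x = unpack v l"
      using MD(7)[OF family_unpack[OF v(1)]] by auto
    have "v = embed M' x" by (rule sum_space_eqI[OF v(1) linear_betweenD(1)[OF lin x(1)]]) (simp add: unpack_embed x(2))
    then show "v \<in> embed M' ` space_at M' k" using x(1) by blast
  qed
  moreover have "cvec.dim ?S = (\<Sum>l\<in>preds. cvec.dim (space_at M l))"
    by (rule dim_sum_space) (rule representation_space[OF MD(1)])
  ultimately show ?thesis using 1 2 by simp
qed

section \<open>Splitting off the summands concentrated at the reflected vertex\<close>

text \<open>The space at \<open>k\<close> is cut down to the image of inflow. All arrows at the sink
  land in this image, so a projection onto it, extended by the identity, is a morphism.\<close>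

lemma onto_summand:
  assumes L: "representation Q L"
  obtains L1 p where "representation Q L1" "onto_at L1" "\<And>i. i \<noteq> k \<Longrightarrow> space_at L1 i = space_at L i"
    "space_at L1 k \<subseteq> space_at L k" "map_along L1 = map_along L"
    "morphism Q L1 L (\<lambda>i. id)" "morphism Q L L1 (\<lambda>i. if i = k then p else id)"
    "\<And>x. x \<in> space_at L1 k \<Longrightarrow> p x = x"
proof -
  let ?S = "sum_space preds (space_at L)"
  define T where "T = (\<lambda>x. inflow L (unpack x)) ` ?S"
  have T: "T = {inflow L y | y. family L y}" unfolding T_def inflow_image ..
  define L1 where "L1 = L\<lparr>space_at := (space_at L)(k := T)\<rparr>"
  have fT: "fin_dim_space T" unfolding T_def by (rule fin_dim_image[OF linear_inflow[OF L] fin_dim_sum[OF L]])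
  obtain p where p: "clinear p" "\<And>x. p x \<in> T" "\<And>x. x \<in> T \<Longrightarrow> p x = x"
    using projection_exists[OF fin_dim_spaceD[OF fT]] by blast
  have sp: "space_at L1 i = space_at L i" if "i \<noteq> k" for i using that by (simp add: L1_def)
  have spk: "space_at L1 k = T" by (simp add: L1_def)
  have mp: "map_along L1 = map_along L" by (simp add: L1_def)
  have sub: "T \<subseteq> space_at L k" using inflow_in[OF L] T by auto
  have le: "space_at L1 i \<subseteq> space_at L i" for i using sp spk sub by (cases "i = k") auto
  have map_T: "map_along L (i, k) x \<in> T" if "(i, k) \<in> Q" "x \<in> space_at L i" for i x
  proof -
    have "map_along L (i, k) x = inflow L (single i x)" using inflow_single[OF L that(1)] by simp
    moreover have "family L (single i x)" using that representation_zero[OF L] by (simp add: family_def single_def)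
    ultimately show ?thesis unfolding T by blast
  qed
  have rep: "representation Q L1"
    unfolding representation_def
  proof (intro conjI allI ballI)
    fix i show "fin_dim_space (space_at L1 i)"
      using fT representation_space(1)[OF L] by (cases "i = k") (simp_all add: sp spk)
  next
    fix a assume a: "a \<in> Q"
    obtain i j where ij: "a = (i, j)" by (cases a) auto
    have i: "i \<noteq> k" using a ij not_out by auto
    have "linear_between (space_at L1 i) (space_at L1 j) (map_along L1 (i, j))"
      unfolding mp
    proof (rule linear_between_mono[OF representation_map[OF L] le])
      show "(i, j) \<in> Q" using a ij by simp
      fix x assume "x \<in> space_at L1 i"
      then have x: "x \<in> space_at L i" using sp[OF i] by simp
      show "map_along L (i, j) x \<in> space_at L1 j"
        using map_T[of i x] linear_betweenD(1)[OF representation_map[OF L, of i j] x] a ij x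
        by (cases "j = k") (simp_all add: spk sp)
    qed
    then show "case a of (i, j) \<Rightarrow> linear_between (space_at L1 i) (space_at L1 j) (map_along L1 (i, j))"
      using ij by simp
  qed
  have fam: "family L1 y \<longleftrightarrow> family L y" for y using sp[OF pred_neq] by (auto simp: family_def)
  have onto: "onto_at L1"
    unfolding onto_at_def
  proof
    fix x assume "x \<in> space_at L1 k"
    then show "\<exists>y. family L1 y \<and> x = inflow L1 y" using fam by (auto simp: spk T inflow_def mp)
  qed
  have incl: "morphism Q L1 L (\<lambda>i. id)"
    by (rule morphismI) (use le mp in \<open>auto simp: linear_between_def\<close>)
  have proj: "morphism Q L L1 (\<lambda>i. if i = k then p else id)"
  proof (rule morphismI)
    fix i show "linear_between (space_at L i) (space_at L1 i) (if i = k then p else id)"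
      using clinear_between[OF p(1), of "space_at L k" T] p(2) sp[of i] spk
      by (auto simp: linear_between_def)
  next
    fix i j x assume ij: "(i, j) \<in> Q" and x: "x \<in> space_at L i"
    have "i \<noteq> k" using ij not_out by auto
    then show "(if j = k then p else id) (map_along L (i, j) x) = map_along L1 (i, j) ((if i = k then p else id) x)"
      using p(3)[OF map_T] ij x by (auto simp: mp)
  qed
  show ?thesis using that[OF rep onto sp _ mp incl proj] sub p(3) by (simp add: spk)
qed

text \<open>Here \<open>q\<close> projects onto the common kernel of the maps leaving
  \<open>k\<close>, and \<open>T\<close> is the complement cut out by \<open>q\<close>. The map
  \<open>p\<close> removes the part in the common kernel, which the arrows do not see.\<close>

lemma into_summand:
  assumes L: "representation Q' L"
  obtains L1 p where "representation Q' L1" "into_at L1" "\<And>i. i \<noteq> k \<Longrightarrow> space_at L1 i = space_at L i"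
    "space_at L1 k \<subseteq> space_at L k" "map_along L1 = map_along L"
    "morphism Q' L1 L (\<lambda>i. id)" "morphism Q' L L1 (\<lambda>i. if i = k then p else id)"
    "\<And>x. x \<in> space_at L1 k \<Longrightarrow> p x = x"
proof -
  note subL = representation_space(2)[OF L, of k]
  define K where "K = {x \<in> space_at L k. \<forall>l. (l, k) \<in> Q \<longrightarrow> map_along L (k, l) x = 0}"
  have lin: "linear_between (space_at L k) (space_at L l) (map_along L (k, l))" if "(l, k) \<in> Q" for l
    using representation_map[OF L, of k l] that by (simp add: Q'_iff)
  have K: "cvec.subspace K"
    unfolding cvec.subspace_def K_def
    using cvec.subspace_0[OF subL] cvec.subspace_add[OF subL] cvec.subspace_scale[OF subL]
      linear_between_zero[OF lin subL] linear_betweenD(2)[OF lin] linear_betweenD(3)[OF lin] by simp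
  obtain q where q: "clinear q" "\<And>x. q x \<in> K" "\<And>x. x \<in> K \<Longrightarrow> q x = x"
    using projection_exists[OF K] by blast
  define p where "p x = x - q x" for x
  have linp: "clinear p"
    by (rule clinearI) (simp_all add: p_def cvec_pair.linear_add[OF q(1)] cvec_pair.linear_scale[OF q(1)]
        cvec.scale_right_diff_distrib)
  define T where "T = {x \<in> space_at L k. q x = 0}"
  define L1 where "L1 = L\<lparr>space_at := (space_at L)(k := T)\<rparr>"
  have sp: "space_at L1 i = space_at L i" if "i \<noteq> k" for i using that by (simp add: L1_def)
  have spk: "space_at L1 k = T" by (simp add: L1_def)
  have mp: "map_along L1 = map_along L" by (simp add: L1_def)
  have le: "space_at L1 i \<subseteq> space_at L i" for i using sp spk by (cases "i = k") (auto simp: T_def)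
  have q_L: "q x \<in> space_at L k" for x using q(2)[of x] by (simp add: K_def)
  have pT: "p x \<in> T" if "x \<in> space_at L k" for x
    using cvec.subspace_diff[OF subL that q_L] q(3)[OF q(2)] cvec_pair.linear_diff[OF q(1)]
    by (simp add: p_def T_def)
  have fT: "fin_dim_space T"
    unfolding T_def
    by (rule fin_dim_subspace[OF representation_space(1)[OF L]])
      (rule linear_between_kernel[OF clinear_between[OF q(1)] subL, of UNIV], auto)
  have rep: "representation Q' L1"
    unfolding representation_def
  proof (intro conjI allI ballI)
    fix i show "fin_dim_space (space_at L1 i)"
      using fT representation_space(1)[OF L] by (cases "i = k") (simp_all add: sp spk)
  next
    fix a assume a: "a \<in> Q'"
    obtain i j where ij: "a = (i, j)" by (cases a) auto
    have j: "j \<noteq> k" using a ij not_out by (auto simp: Q'_iff)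
    have "linear_between (space_at L1 i) (space_at L1 j) (map_along L1 (i, j))"
      unfolding mp
    proof (rule linear_between_mono[OF representation_map[OF L] le])
      show Q': "(i, j) \<in> Q'" using a ij by simp
      fix x assume "x \<in> space_at L1 i"
      then have "x \<in> space_at L i" using le by auto
      then show "map_along L (i, j) x \<in> space_at L1 j"
        using linear_betweenD(1)[OF representation_map[OF L Q']] sp[OF j] by simp
    qed
    then show "case a of (i, j) \<Rightarrow> linear_between (space_at L1 i) (space_at L1 j) (map_along L1 (i, j))"
      using ij by simp
  qed
  have into: "into_at L1"
    unfolding into_at_def
  proof (intro ballI impI)
    fix x assume x: "x \<in> space_at L1 k" and "\<forall>l. (l, k) \<in> Q \<longrightarrow> map_along L1 (k, l) x = 0"
    then have "x \<in> K" using le by (auto simp: K_def mp)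
    then show "x = 0" using q(3) x by (simp add: spk T_def)
  qed
  have incl: "morphism Q' L1 L (\<lambda>i. id)"
    by (rule morphismI) (use le mp in \<open>auto simp: linear_between_def\<close>)
  have proj: "morphism Q' L L1 (\<lambda>i. if i = k then p else id)"
  proof (rule morphismI)
    fix i show "linear_between (space_at L i) (space_at L1 i) (if i = k then p else id)"
      using clinear_between[OF linp, of "space_at L k" T] pT sp[of i] spk
      by (auto simp: linear_between_def)
  next
    fix i j x assume ij: "(i, j) \<in> Q'" and x: "x \<in> space_at L i"
    have j: "j \<noteq> k" using ij not_out by (auto simp: Q'_iff)
    show "(if j = k then p else id) (map_along L (i, j) x) = map_along L1 (i, j) ((if i = k then p else id) x)"
    proof (cases "i = k")
      case True
      then have jk: "(j, k) \<in> Q" using ij by (auto simp: Q'_iff)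
      have "map_along L (k, j) (p x) = map_along L (k, j) x - map_along L (k, j) (q x)"
        unfolding p_def using linear_between_diff[OF lin[OF jk] subL] x True q_L by simp
      also have "map_along L (k, j) (q x) = 0" using q(2)[of x] jk by (simp add: K_def)
      finally show ?thesis using True j by (simp add: mp)
    qed (use j mp in simp)
  qed
  have "p x = x" if "x \<in> T" for x using that by (simp add: p_def T_def)
  moreover have "T \<subseteq> space_at L k" by (auto simp: T_def)
  ultimately show ?thesis using that[OF rep into sp _ mp incl proj] by (simp add: spk)
qed

lemma equivalence: "rep_equivalence Q Q' k reflects"
proof
  fix M M' assume "reflects M M'"
  then show "representation Q M" "representation Q' M'" by (rule reflectsD)+
next
  fix M M' i assume "reflects M M'" "i \<noteq> k"
  then show "space_at M i = space_at M' i" by (rule reflectsD)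
next
  fix M M' N N' f assume "reflects M M'" "reflects N N'" "morphism Q M N f"
  then show "\<exists>f'. morphism Q' M' N' f' \<and> agree_off k M f f'" by (rule reflect_forward)
next
  fix M M' N N' f assume M: "reflects M M'" and "reflects N N'" "morphism Q' M' N' f"
  then show "\<exists>f'. morphism Q M N f' \<and> agree_off k M f' f" by (rule reflect_backward)
next
  fix M M' N N' f g
  assume M: "reflects M M'" and "reflects N N'" "morphism Q M N f" "morphism Q M N g" "agree_off k M f g"
  then show "equal_on M f g" by (intro unique_onto[OF reflectsD(1,5)[OF M]])
next
  fix M M' N N' f g
  assume M: "reflects M M'" and N: "reflects N N'" and "morphism Q' M' N' f" "morphism Q' M' N' g" "agree_off k M' f g"
  then show "equal_on M' f g" by (intro unique_into[OF reflectsD(2,6)[OF N] _ _ _ reflectsD(2)[OF M]])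
next
  fix L assume L: "representation Q L"
  obtain L1 p where L1: "representation Q L1" "onto_at L1" "\<And>i. i \<noteq> k \<Longrightarrow> space_at L1 i = space_at L i"
    "space_at L1 k \<subseteq> space_at L k" "map_along L1 = map_along L"
    "morphism Q L1 L (\<lambda>i. id)" "morphism Q L L1 (\<lambda>i. if i = k then p else id)"
    "\<And>x. x \<in> space_at L1 k \<Longrightarrow> p x = x" by (rule onto_summand[OF L]) (rule that)
  let ?p = "\<lambda>i. if i = k then p else id"
  obtain L1' where "reflects L1 L1'" using reflect_exists[OF L1(1,2)] by blast
  moreover have "equal_on L1 (compose_mor ?p (\<lambda>i. id)) (\<lambda>i. id)"
    using L1(8) by (intro equal_onI) auto
  \<comment> \<open>Away from \<open>k\<close> inclusion and projection are identities, so the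
    composites agree there; surjectivity of inflow settles the values at \<open>k\<close>.\<close>
  moreover have "equal_on M (compose_mor g h) (compose_mor (compose_mor g (\<lambda>i. id)) (compose_mor ?p h))"
    if M: "reflects M M'" and h: "morphism Q M L h" and g: "morphism Q L N g" for M M' N g h
    by (rule unique_onto[OF reflectsD(1,5)[OF M] morphism_compose[OF h g]
          morphism_compose[OF morphism_compose[OF h L1(7)] morphism_compose[OF L1(6) g]]])
       (simp add: agree_off_def)
  ultimately show "\<exists>L1 L1' \<iota> \<pi>. reflects L1 L1' \<and> morphism Q L1 L \<iota> \<and> morphism Q L L1 \<pi> \<and>
      equal_on L1 (compose_mor \<pi> \<iota>) (\<lambda>i. id) \<and> (\<forall>M M' N N' g h. reflects M M' \<longrightarrow> reflects N N' \<longrightarrow>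
        morphism Q M L h \<longrightarrow> morphism Q L N g \<longrightarrow>
        equal_on M (compose_mor g h) (compose_mor (compose_mor g \<iota>) (compose_mor \<pi> h)))"
    using L1(6,7) by (intro exI[of _ L1] exI[of _ L1'] exI[of _ "\<lambda>i. id"] exI[of _ ?p]) simp
next
  fix L assume L: "representation Q' L"
  obtain L1 p where L1: "representation Q' L1" "into_at L1" "\<And>i. i \<noteq> k \<Longrightarrow> space_at L1 i = space_at L i"
    "space_at L1 k \<subseteq> space_at L k" "map_along L1 = map_along L"
    "morphism Q' L1 L (\<lambda>i. id)" "morphism Q' L L1 (\<lambda>i. if i = k then p else id)"
    "\<And>x. x \<in> space_at L1 k \<Longrightarrow> p x = x" by (rule into_summand[OF L]) (rule that)
  let ?p = "\<lambda>i. if i = k then p else id"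
  obtain L0 where "reflects L0 L1" using coreflect_exists[OF L1(1,2)] by blast
  moreover have "equal_on L1 (compose_mor ?p (\<lambda>i. id)) (\<lambda>i. id)"
    using L1(8) by (intro equal_onI) auto
  moreover have "equal_on M' (compose_mor g h) (compose_mor (compose_mor g (\<lambda>i. id)) (compose_mor ?p h))"
    if M: "reflects M M'" and N: "reflects N N'" and h: "morphism Q' M' L h" and g: "morphism Q' L N' g" for M M' N N' g h
    by (rule unique_into[OF reflectsD(2,6)[OF N] morphism_compose[OF h g]
          morphism_compose[OF morphism_compose[OF h L1(7)] morphism_compose[OF L1(6) g]] _ reflectsD(2)[OF M]])
       (simp add: agree_off_def)
  ultimately show "\<exists>L0 L1 \<iota> \<pi>. reflects L0 L1 \<and> morphism Q' L1 L \<iota> \<and> morphism Q' L L1 \<pi> \<and>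
      equal_on L1 (compose_mor \<pi> \<iota>) (\<lambda>i. id) \<and> (\<forall>M M' N N' g h. reflects M M' \<longrightarrow> reflects N N' \<longrightarrow>
        morphism Q' M' L h \<longrightarrow> morphism Q' L N' g \<longrightarrow>
        equal_on M' (compose_mor g h) (compose_mor (compose_mor g \<iota>) (compose_mor \<pi> h)))"
    using L1(6,7) by (intro exI[of _ L0] exI[of _ L1] exI[of _ "\<lambda>i. id"] exI[of _ ?p]) simp
qed

text \<open>The projection to the summand that is onto at \<open>k\<close> is an idempotent
  endomorphism. If it is zero, \<open>M\<close> lives only at \<open>k\<close>; if it is the
  identity, the summand is all of \<open>M\<close>.\<close>

lemma indecomposable_onto_or_concentrated:
  assumes M: "indecomposable Q M" shows "onto_at M \<or> concentrated k M"
proof -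
  have rep: "representation Q M" using M by (simp add: indecomposable_def)
  obtain L1 p where L1: "representation Q L1" "onto_at L1" "\<And>i. i \<noteq> k \<Longrightarrow> space_at L1 i = space_at M i"
    "space_at L1 k \<subseteq> space_at M k" "map_along L1 = map_along M"
    "morphism Q L1 M (\<lambda>i. id)" "morphism Q M L1 (\<lambda>i. if i = k then p else id)"
    "\<And>x. x \<in> space_at L1 k \<Longrightarrow> p x = x" by (rule onto_summand[OF rep]) (rule that)
  let ?p = "\<lambda>i. if i = k then p else id"
  have pL: "p x \<in> space_at L1 k" if "x \<in> space_at M k" for x
    using morphism_in[OF L1(7) that] by simp
  have "morphism Q M M (compose_mor (\<lambda>i. id) ?p)" by (rule morphism_compose[OF L1(7,6)])
  moreover have "compose_mor (\<lambda>i. id) ?p i (compose_mor (\<lambda>i. id) ?p i x) = compose_mor (\<lambda>i. id) ?p i x"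
    if "x \<in> space_at M i" for i x
    using that L1(8)[OF pL] by auto
  ultimately have "(\<forall>i. \<forall>x\<in>space_at M i. compose_mor (\<lambda>i. id) ?p i x = 0) \<or>
      (\<forall>i. \<forall>x\<in>space_at M i. compose_mor (\<lambda>i. id) ?p i x = x)"
    by (rule indecomposable_idempotent[OF M])
  then consider "\<forall>i. \<forall>x\<in>space_at M i. compose_mor (\<lambda>i. id) ?p i x = 0"
    | "\<forall>i. \<forall>x\<in>space_at M i. compose_mor (\<lambda>i. id) ?p i x = x"
    by blast
  then show ?thesis
  proof cases
    case 1
    have "space_at M i = {0}" if "i \<noteq> k" for i
      using 1[rule_format, of _ i] that representation_zero[OF rep, of i] by auto
    then show ?thesis using concentrated_indecomposable[OF M not_out] by blast
  next
    case 2
    have "space_at M k \<subseteq> space_at L1 k"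
      using 2[rule_format, of _ k] pL by fastforce
    then have "space_at L1 i = space_at M i" for i using L1(3,4) by (cases "i = k") auto
    then have "onto_at M" using L1(2) unfolding onto_at_def family_def inflow_def L1(5) by simp
    then show ?thesis by blast
  qed
qed

lemma indecomposable_into_or_concentrated:
  assumes M: "indecomposable Q' M" shows "into_at M \<or> concentrated k M"
proof -
  have rep: "representation Q' M" using M by (simp add: indecomposable_def)
  obtain L1 p where L1: "representation Q' L1" "into_at L1" "\<And>i. i \<noteq> k \<Longrightarrow> space_at L1 i = space_at M i"
    "space_at L1 k \<subseteq> space_at M k" "map_along L1 = map_along M"
    "morphism Q' L1 M (\<lambda>i. id)" "morphism Q' M L1 (\<lambda>i. if i = k then p else id)"
    "\<And>x. x \<in> space_at L1 k \<Longrightarrow> p x = x" by (rule into_summand[OF rep]) (rule that)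
  let ?p = "\<lambda>i. if i = k then p else id"
  have pL: "p x \<in> space_at L1 k" if "x \<in> space_at M k" for x
    using morphism_in[OF L1(7) that] by simp
  have "morphism Q' M M (compose_mor (\<lambda>i. id) ?p)" by (rule morphism_compose[OF L1(7,6)])
  moreover have "compose_mor (\<lambda>i. id) ?p i (compose_mor (\<lambda>i. id) ?p i x) = compose_mor (\<lambda>i. id) ?p i x"
    if "x \<in> space_at M i" for i x
    using that L1(8)[OF pL] by auto
  ultimately have "(\<forall>i. \<forall>x\<in>space_at M i. compose_mor (\<lambda>i. id) ?p i x = 0) \<or>
      (\<forall>i. \<forall>x\<in>space_at M i. compose_mor (\<lambda>i. id) ?p i x = x)"
    by (rule indecomposable_idempotent[OF M])
  then consider "\<forall>i. \<forall>x\<in>space_at M i. compose_mor (\<lambda>i. id) ?p i x = 0"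
    | "\<forall>i. \<forall>x\<in>space_at M i. compose_mor (\<lambda>i. id) ?p i x = x"
    by blast
  then show ?thesis
  proof cases
    case 1
    have "space_at M i = {0}" if "i \<noteq> k" for i
      using 1[rule_format, of _ i] that representation_zero[OF rep, of i] by auto
    moreover have "(k, k) \<notin> Q'" using not_out by (simp add: Q'_iff)
    ultimately show ?thesis using concentrated_indecomposable[OF M] by blast
  next
    case 2
    have "space_at M k \<subseteq> space_at L1 k"
      using 2[rule_format, of _ k] pL by fastforce
    then have "space_at L1 k = space_at M k" using L1(4) by auto
    then have "into_at M" using L1(2) unfolding into_at_def L1(5) by simp
    then show ?thesis by blast
  qed
qed

end


section \<open>Representations concentrated at a vertex\<close>

lemma representation_of_concentrated_exists:
  obtains M where "representation Q M" "concentrated k M"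
proof -
  define x :: cvec where "x = (\<lambda>n. 1)"
  have "x 0 \<noteq> (0 :: cvec) 0" by (simp add: x_def zero_fun_apply)
  then have x: "x \<noteq> 0" by auto
  let ?M = "\<lparr>space_at = (\<lambda>i. if i = k then cvec.span {x} else {0}), map_along = (\<lambda>_ _. 0)\<rparr>"
  have "representation Q ?M"
    using fin_dim_span1 fin_dim_zero cvec.span_zero by (auto simp: representation_def linear_between_def)
  moreover have "concentrated k ?M" using x by (auto simp: concentrated_def)
  ultimately show ?thesis using that by blast
qed

lemma concentratedE:
  assumes "concentrated k M"
  obtains x where "x \<noteq> 0" "space_at M k = cvec.span {x}" "x \<in> space_at M k"
  using assms cvec.span_base[of _ "{_}"] unfolding concentrated_def by blast

lemma concentrated_off: "concentrated k M \<Longrightarrow> i \<noteq> k \<Longrightarrow> space_at M i = {0}"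
  by (simp add: concentrated_def)

lemma concentrated_morphism_unique:
  assumes M: "representation Q M" "concentrated k M" and x: "space_at M k = cvec.span {x}"
    and f: "morphism Q M N f" and g: "morphism Q M N g" and eq: "f k x = g k x"
  shows "equal_on M f g"
proof (rule equal_onI)
  fix i v assume v: "v \<in> space_at M i"
  show "f i v = g i v"
  proof (cases "i = k")
    case True
    then obtain c where c: "v = cscale c x" using v x span1_iff by auto
    have "x \<in> space_at M k" using x cvec.span_base by simp
    then show ?thesis
      using linear_betweenD(3)[OF morphism_linear[OF f]] linear_betweenD(3)[OF morphism_linear[OF g]] eq c True by simp
  next
    case False
    then have "v = 0" using v concentrated_off[OF M(2)] by simp
    then show ?thesis
      using linear_between_zero[OF morphism_linear[OF f] representation_space(2)[OF M(1)]]
        linear_between_zero[OF morphism_linear[OF g] representation_space(2)[OF M(1)]] by simp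
  qed
qed

text \<open>All arrows start at vertices where \<open>M\<close> is 0, and none starts at the sink,
  so any linear map on the line at \<open>k\<close> extends by zero to a morphism.\<close>

lemma concentrated_morphism_exists:
  assumes "sink Q k" and M: "representation Q M" "concentrated k M" and x: "x \<noteq> 0" "space_at M k = cvec.span {x}"
    and N: "representation Q N" and y: "y \<in> space_at N k"
  obtains f where "morphism Q M N f" "f k x = y" "\<And>i v. i \<noteq> k \<Longrightarrow> f i v = 0"
proof -
  obtain h where h: "clinear h" "h x = y" using line_map_exists[OF x(1)] by blast
  have hN: "h v \<in> space_at N k" if v: "v \<in> space_at M k" for v
  proof -
    obtain c where "v = cscale c x" using v x(2) span1_iff by auto
    then show ?thesis
      using cvec_pair.linear_scale[OF h(1)] cvec.subspace_scale[OF representation_space(2)[OF N] y] h(2) by simp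
  qed
  let ?f = "\<lambda>i. if i = k then h else zero_mor i"
  have "morphism Q M N ?f"
  proof (rule morphismI)
    fix i show "linear_between (space_at M i) (space_at N i) (?f i)"
      using clinear_between[OF h(1) hN] representation_zero[OF N, of i]
      by (cases "i = k") (simp_all add: linear_between_def)
  next
    fix i j v assume ij: "(i, j) \<in> Q" and v: "v \<in> space_at M i"
    have i: "i \<noteq> k" using ij assms(1) by (auto simp: sink_def)
    then have "v = 0" using v concentrated_off[OF M(2)] by simp
    then have "map_along M (i, j) v = 0"
      using linear_between_zero[OF representation_map[OF M(1) ij] representation_space(2)[OF M(1)]] by simp
    moreover have "map_along N (i, j) 0 = 0"
      by (rule linear_between_zero[OF representation_map[OF N ij] representation_space(2)[OF N]])
    ultimately show "?f j (map_along M (i, j) v) = map_along N (i, j) (?f i v)"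
      using i cvec_pair.linear_0[OF h(1)] by simp
  qed
  then show ?thesis using that[of ?f] h(2) by simp
qed

lemma concentrated_isomorphic:
  assumes "sink Q k" and M: "representation Q M" "concentrated k M" and N: "representation Q N" "concentrated k N"
  shows "isomorphic_reps Q M N"
proof -
  obtain x where x: "x \<noteq> 0" "space_at M k = cvec.span {x}" "x \<in> space_at M k" by (rule concentratedE[OF M(2)])
  obtain y where y: "y \<noteq> 0" "space_at N k = cvec.span {y}" "y \<in> space_at N k" by (rule concentratedE[OF N(2)])
  obtain f where f: "morphism Q M N f" "f k x = y"
    by (rule concentrated_morphism_exists[OF assms(1) M x(1,2) N(1) y(3)])
  obtain g where g: "morphism Q N M g" "g k y = x"
    by (rule concentrated_morphism_exists[OF assms(1) N y(1,2) M(1) x(3)])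
  have "equal_on M (compose_mor g f) (\<lambda>i. id)"
    by (rule concentrated_morphism_unique[OF M x(2) morphism_compose[OF f(1) g(1)] morphism_id]) (simp add: f g)
  moreover have "equal_on N (compose_mor f g) (\<lambda>i. id)"
    by (rule concentrated_morphism_unique[OF N y(2) morphism_compose[OF g(1) f(1)] morphism_id]) (simp add: f g)
  ultimately show ?thesis using f(1) g(1) unfolding isomorphic_reps_def by blast
qed

text \<open>An endomorphism acts on the line at \<open>k\<close> by a scalar \<open>c\<close>, and
  idempotence means \<open>c * c = c\<close>.\<close>

lemma concentrated_is_indecomposable:
  assumes M: "representation Q M" "concentrated k M" shows "indecomposable Q M"
proof (rule trivial_idempotents_imp_indecomposable[OF M(1)])
  obtain x where x: "x \<noteq> 0" "space_at M k = cvec.span {x}" "x \<in> space_at M k" by (rule concentratedE[OF M(2)])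
  then show "\<exists>i. space_at M i \<noteq> {0}" by auto
  show "trivial_idempotents Q M"
    unfolding trivial_idempotents_def
  proof (intro allI impI, elim conjE)
    fix e assume e: "morphism Q M M e" and idem: "equal_on M (compose_mor e e) e"
    obtain c where c: "e k x = cscale c x" using morphism_in[OF e x(3)] x(2) span1_iff by auto
    have "e k (e k x) = e k x" using equal_onD[OF idem x(3)] by simp
    then have "cscale (c * c) x = cscale c x"
      using c linear_betweenD(3)[OF morphism_linear[OF e] x(3)] by (simp add: cvec.scale_scale)
    then have "c * c = c" using x(1) by simp
    then have "c = 0 \<or> c = 1" by simp
    then show "equal_on M e zero_mor \<or> equal_on M e (\<lambda>i. id)"
    proof
      assume "c = 0"
      then have "equal_on M e zero_mor"
        by (intro concentrated_morphism_unique[OF M x(2) e morphism_zero[OF M(1)]]) (simp add: c)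
      then show ?thesis by blast
    next
      assume "c = 1"
      then have "equal_on M e (\<lambda>i. id)"
        by (intro concentrated_morphism_unique[OF M x(2) e morphism_id]) (simp add: c)
      then show ?thesis by blast
    qed
  qed
qed

section \<open>Irreducible morphisms at a representation concentrated at the sink\<close>

text \<open>The zero morphism factors through the zero representation; a split factor would force
  \<open>M\<close> or \<open>N\<close> to vanish.\<close>

lemma irreducible_nonzero:
  assumes f: "irreducible_morphism Q M N f" and M: "\<exists>i. space_at M i \<noteq> {0}" "representation Q M"
    and N: "\<exists>i. space_at N i \<noteq> {0}" "representation Q N"
  shows "\<not> equal_on M f zero_mor"
proof
  assume zero: "equal_on M f zero_mor"
  let ?L = "\<lparr>space_at = (\<lambda>i. {0}), map_along = (\<lambda>_ _. 0)\<rparr> :: 'a rep"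
  have L: "representation Q ?L"
    using fin_dim_zero by (auto simp: representation_def linear_between_def)
  have "f i x = zero_mor i (zero_mor i x)" if "x \<in> space_at M i" for i x
    using equal_onD[OF zero that] by simp
  from irreducibleD(4)[OF f L morphism_zero[OF L] morphism_zero[OF N(2)] this]
  consider "split_mono Q M ?L zero_mor" | "split_epi Q ?L N zero_mor" by blast
  then show False
  proof cases
    case 1
    then obtain r where r: "morphism Q ?L M r" "\<And>i x. x \<in> space_at M i \<Longrightarrow> r i (zero_mor i x) = x"
      by (blast dest: split_monoD)
    have "x = 0" if x: "x \<in> space_at M i" for i x
      using r(2)[OF x] linear_between_zero[OF morphism_linear[OF r(1)] representation_space(2)[OF L]] by simp
    then show False using M(1) representation_zero[OF M(2)] by blast
  next
    case 2
    then obtain s where "\<And>i x. x \<in> space_at N i \<Longrightarrow> zero_mor i (s i x) = x"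
      by (blast dest: split_epiD)
    then have "x = 0" if "x \<in> space_at N i" for i x using that zero_mor_apply by metis
    then show False using N(1) representation_zero[OF N(2)] by blast
  qed
qed

context sink_reflection
begin

lemma zero_to_concentrated:
  assumes X: "representation Q X" "onto_at X" and M: "representation Q M" "concentrated k M"
    and r: "morphism Q X M r"
  shows "equal_on X r zero_mor"
proof (rule unique_onto[OF X r morphism_zero[OF M(1)]])
  have "r i v = 0" if "i \<noteq> k" "v \<in> space_at X i" for i v
    using morphism_in[OF r that(2)] concentrated_off[OF M(2) that(1)] by simp
  then show "agree_off k X r zero_mor" by (simp add: agree_off_def)
qed

lemma not_split_mono_from_concentrated:
  assumes X: "representation Q X" "onto_at X" and M: "representation Q M" "concentrated k M"
  shows "\<not> split_mono Q M X f"
proof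
  assume *: "split_mono Q M X f"
  then obtain r where r: "morphism Q X M r" "\<And>i v. v \<in> space_at M i \<Longrightarrow> r i (f i v) = v"
    by (blast dest: split_monoD)
  have f: "morphism Q M X f" using * by (simp add: split_mono_def)
  obtain x where x: "x \<noteq> 0" "space_at M k = cvec.span {x}" "x \<in> space_at M k" by (rule concentratedE[OF M(2)])
  have "r k (f k x) = 0"
    using equal_onD[OF zero_to_concentrated[OF X M r(1)] morphism_in[OF f x(3)]] by simp
  then show False using r(2)[OF x(3)] x(1) by simp
qed

text \<open>From a representation that is onto at \<open>k\<close> there is only the zero morphism,
  since the target vanishes away from \<open>k\<close>. Between representations concentrated at
  \<open>k\<close> a nonzero morphism is an isomorphism and so splits.\<close>

lemma no_irreducible_to_concentrated:
  assumes M: "indecomposable Q M" and N: "representation Q N" "concentrated k N"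
  shows "\<not> irreducible_morphism Q M N f"
proof
  assume f: "irreducible_morphism Q M N f"
  note fD = irreducibleD[OF f]
  have rep: "representation Q M" and nz: "\<exists>i. space_at M i \<noteq> {0}" using M by (auto simp: indecomposable_def)
  obtain y where y: "y \<noteq> 0" "space_at N k = cvec.span {y}" "y \<in> space_at N k" by (rule concentratedE[OF N(2)])
  then have nzN: "\<exists>i. space_at N i \<noteq> {0}" by auto
  note nonzero = irreducible_nonzero[OF f nz rep nzN N(1)]
  consider "onto_at M" | "concentrated k M" using indecomposable_onto_or_concentrated[OF M] by blast
  then show False
  proof cases
    case 1
    then show False using zero_to_concentrated[OF rep 1 N fD(1)] nonzero by blast
  next
    case 2
    obtain x where x: "x \<noteq> 0" "space_at M k = cvec.span {x}" "x \<in> space_at M k" by (rule concentratedE[OF 2])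
    have "f k x \<noteq> 0"
    proof
      assume "f k x = 0"
      then have "equal_on M f zero_mor"
        by (intro concentrated_morphism_unique[OF rep 2 x(2) fD(1) morphism_zero[OF N(1)]]) simp
      then show False using nonzero by blast
    qed
    moreover from this have "space_at N k = cvec.span {f k x}"
      using span1_eq morphism_in[OF fD(1) x(3)] y(2) by simp
    ultimately obtain r where r: "morphism Q N M r" "r k (f k x) = x"
      using concentrated_morphism_exists[OF sink_k N _ _ rep x(3)] by metis
    have "equal_on M (compose_mor r f) (\<lambda>i. id)"
      by (rule concentrated_morphism_unique[OF rep 2 x(2) morphism_compose[OF fD(1) r(1)] morphism_id]) (simp add: r)
    then have "split_mono Q M N f" using fD(1) r(1) unfolding split_mono_def by blast
    then show False using fD(2) by blast
  qed
qed

text \<open>The representation used to test irreducibility is \<open>N\<close> with the space at \<open>k\<close> replaced by the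
  direct sum of the neighbouring spaces.\<close>

lemma irreducible_from_concentrated_injective:
  assumes M: "representation Q M" "concentrated k M" and N: "representation Q N" "onto_at N"
    and f: "irreducible_morphism Q M N f"
    and y: "family N y" "inflow N y = 0" and l: "(l, k) \<in> Q"
  shows "y l = 0"
proof -
  note fD = irreducibleD[OF f]
  let ?S = "sum_space preds (space_at N)"
  define L where "L = \<lparr>space_at = (space_at N)(k := ?S),
    map_along = (\<lambda>(i, j) v. if j = k then pack (single i v) else map_along N (i, j) v)\<rparr>"
  have sp: "space_at L i = space_at N i" if "i \<noteq> k" for i using that by (simp add: L_def)
  have spk: "space_at L k = ?S" by (simp add: L_def)
  have mpk: "map_along L (i, k) v = pack (single i v)" for i v by (simp add: L_def)
  have mp: "map_along L (i, j) v = map_along N (i, j) v" if "j \<noteq> k" for i j v using that by (simp add: L_def)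
  have fam: "family L y \<longleftrightarrow> family N y" for y using sp[OF pred_neq] by (auto simp: family_def)
  have single_S: "pack (single i v) \<in> ?S" if "(i, k) \<in> Q" "v \<in> space_at N i" for i v
    using that representation_zero[OF N(1)] by (auto simp: pack_in_sum_space single_def)
  have L: "representation Q L"
    unfolding representation_def
  proof (intro conjI allI ballI)
    fix i show "fin_dim_space (space_at L i)"
      using fin_dim_sum[OF N(1)] representation_space(1)[OF N(1)] by (cases "i = k") (simp_all add: sp spk)
  next
    fix a assume a: "a \<in> Q"
    obtain i j where ij: "a = (i, j)" by (cases a) auto
    have i: "i \<noteq> k" using a ij not_out by auto
    have "linear_between (space_at L i) (space_at L j) (map_along L (i, j))"
    proof (cases "j = k")
      case True
      have "linear_between (space_at N i) ?S (\<lambda>x. pack (single i x))"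
        by (rule clinear_between[OF clinear_pack_single]) (rule single_S, use a ij True in auto)
      moreover have "map_along L (i, k) = (\<lambda>x. pack (single i x))" using mpk by (rule ext)
      ultimately show ?thesis using True sp[OF i] by (simp add: spk)
    next
      case False
      have "map_along L (i, j) = map_along N (i, j)" using mp[OF False] by (rule ext)
      then show ?thesis using representation_map[OF N(1)] i False a ij by (simp add: sp)
    qed
    then show "case a of (i, j) \<Rightarrow> linear_between (space_at L i) (space_at L j) (map_along L (i, j))"
      using ij by simp
  qed
  have inflow_L: "inflow L y = pack (restrict_preds y)" for y
  proof -
    have "pack (restrict_preds y) = (\<Sum>l\<in>preds. pack (single l (restrict_preds y l)))"
      by (rule pack_singles) simp
    also have "\<dots> = inflow L y" unfolding inflow_def by (rule sum.cong) (simp_all add: mpk)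
    finally show ?thesis by simp
  qed
  have onto: "onto_at L"
    unfolding onto_at_def
  proof
    fix v assume "v \<in> space_at L k"
    then have v: "v \<in> ?S" by (simp add: spk)
    have "v = inflow L (unpack v)" unfolding inflow_L
      by (rule sum_space_eqI[OF v pack_restrict[OF family_unpack[OF v]]]) simp
    then show "\<exists>y. family L y \<and> v = inflow L y" using family_unpack[OF v] fam by blast
  qed
  let ?g = "\<lambda>i. if i = k then (\<lambda>v. inflow N (unpack v)) else id"
  have g: "morphism Q L N ?g"
  proof (rule morphismI)
    fix i show "linear_between (space_at L i) (space_at N i) (?g i)"
      using linear_inflow[OF N(1)] spk sp[of i] by (auto simp: linear_between_def)
  next
    fix i j v assume ij: "(i, j) \<in> Q" and v: "v \<in> space_at L i"
    have i: "i \<noteq> k" using ij not_out by auto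
    show "?g j (map_along L (i, j) v) = map_along N (i, j) (?g i v)"
      using i ij inflow_single[OF N(1), of i v] by (cases "j = k") (simp_all add: mpk mp)
  qed
  obtain x where x: "x \<noteq> 0" "space_at M k = cvec.span {x}" "x \<in> space_at M k" by (rule concentratedE[OF M(2)])
  \<comment> \<open>A family with inflow \<open>f k x\<close> lifts the image of the generator to
    \<open>L\<close>, so that \<open>f\<close> factors through \<open>?g\<close>.\<close>
  obtain z where z: "family N z" "f k x = inflow N z"
    using N(2) morphism_in[OF fD(1) x(3)] unfolding onto_at_def by blast
  have "pack (restrict_preds z) \<in> space_at L k" using pack_restrict[OF z(1)] by (simp add: spk)
  then obtain h where h: "morphism Q M L h" "h k x = pack (restrict_preds z)"
    by (rule concentrated_morphism_exists[OF sink_k M x(1,2) L])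
  have "equal_on M f (compose_mor ?g h)"
    by (rule concentrated_morphism_unique[OF M x(2) fD(1) morphism_compose[OF h(1) g]])
      (simp add: h z inflow_restrict)
  then have "f i v = ?g i (h i v)" if "v \<in> space_at M i" for i v using equal_onD[OF _ that] by fastforce
  from fD(4)[OF L h(1) g this] have "split_mono Q M L h \<or> split_epi Q L N ?g" by blast
  \<comment> \<open>\<open>L\<close> is onto at the sink, which excludes a retraction to the
    concentrated \<open>M\<close>. The remaining section is the identity away from \<open>k\<close>,
    and its compatibility with the arrows turns zero inflow of \<open>y\<close> into vanishing of
    the packed family.\<close>
  then have "split_epi Q L N ?g" using not_split_mono_from_concentrated[OF L onto M] by blast
  then obtain t where t: "morphism Q N L t" "\<And>i v. v \<in> space_at N i \<Longrightarrow> ?g i (t i v) = v"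
    by (blast dest: split_epiD)
  have "t k (inflow N y) = inflow L (\<lambda>l. t l (y l))" by (rule inflow_morphism[OF N(1) t(1) y(1)])
  also have "\<dots> = inflow L y"
  proof (rule inflow_cong)
    fix l assume l: "(l, k) \<in> Q"
    then have "y l \<in> space_at N l" using y(1) by (simp add: family_def)
    from t(2)[OF this] show "t l (y l) = y l" using pred_neq[OF l] by simp
  qed
  also have "\<dots> = pack (restrict_preds y)" by (rule inflow_L)
  finally have "pack (restrict_preds y) = 0"
    using y(2) linear_between_zero[OF morphism_linear[OF t(1)] representation_space(2)[OF N(1)]] by simp
  then have "restrict_preds y l = 0" unfolding pack_eq_0 by blast
  then show ?thesis using l by simp
qed

end


section \<open>Indecomposables and roots\<close>

context simply_laced_system
begin

abbreviation dimv :: "'i rep \<Rightarrow> 'e" where "dimv \<equiv> dimension_vector \<alpha>"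

lemma coord_dim: "coord i (dimv M) = real (cvec.dim (space_at M i))"
  by (simp add: dimension_vector_def coord_simple if_distrib cong: if_cong)

lemma dim_coord:
  assumes "dimv M = v" "coord i v = real n" shows "cvec.dim (space_at M i) = n"
  using coord_dim[of i M] assms by simp

lemma iso_dimv: "representation Q M \<Longrightarrow> isomorphic_reps Q M N \<Longrightarrow> dimv M = dimv N"
  by (intro coord_eqI) (simp add: coord_dim iso_dim)

lemma dim_simple_concentrated:
  assumes "representation Q M" "dimv M = \<alpha> k" shows "concentrated k M"
proof -
  have "cvec.dim (space_at M i) = (if i = k then 1 else 0)" for i
    by (rule dim_coord[OF assms(2)]) (simp add: coord_simple)
  then have "space_at M i = {0}" if "i \<noteq> k" for i
    using dim_eq_0D[OF representation_space(1)[OF assms(1)]] that by simp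
  moreover obtain x where "x \<noteq> 0" "space_at M k = cvec.span {x}"
    using dim_eq_1D[OF representation_space(1)[OF assms(1), of k]] \<open>\<And>i. cvec.dim (space_at M i) = _ i\<close> by auto
  ultimately show ?thesis by (auto simp: concentrated_def)
qed

lemma dim_reflects:
  assumes Q: "orientation_of D Q" "sink Q k" and M: "sink_reflection.reflects Q k M M'"
  shows "dimv M' = s k (dimv M)"
proof (rule coord_eqI)
  interpret sink_reflection Q k by unfold_locales (fact Q(2))
  fix i
  have D: "{j. (j, k) \<in> D} = preds" using Q by (auto simp: orientation_linked sink_def)
  show "coord i (dimv M') = coord i (s k (dimv M))"
  proof (cases "i = k")
    case True
    have "real (cvec.dim (space_at M k) + cvec.dim (space_at M' k)) = real (\<Sum>l\<in>preds. cvec.dim (space_at M l))"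
      using reflects_dim[OF M] by simp
    then show ?thesis using True by (simp add: coord_s coord_dim D)
  next
    case False
    then show ?thesis using reflectsD(3)[OF M, of i] by (simp add: coord_s coord_dim)
  qed
qed

lemma reflect_indecomposable:
  assumes Q: "orientation_of D Q" "sink Q k" and M: "indecomposable Q M" "dimv M \<noteq> \<alpha> k"
  obtains M' where "sink_reflection.reflects Q k M M'" "indecomposable (reverse_at k Q) M'" "dimv M' = s k (dimv M)"
proof -
  interpret sink_reflection Q k by unfold_locales (fact Q(2))
  have "onto_at M"
    using indecomposable_onto_or_concentrated[OF M(1)] dimension_concentrated M(2) by blast
  moreover have rep: "representation Q M" using M(1) by (simp add: indecomposable_def)
  ultimately obtain M' where M': "reflects M M'" using reflect_exists by blast
  have "indecomposable Q' M'"
    using rep_equivalence.indecomposable_transfer[OF rep_equivalence.opposite[OF equivalence] M' M(1)] .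
  then show ?thesis using that M' dim_reflects[OF Q M'] by blast
qed

lemma coreflect_indecomposable:
  assumes Q: "orientation_of D Q" "sink Q k" and M': "indecomposable (reverse_at k Q) M'" "dimv M' \<noteq> \<alpha> k"
  obtains M where "sink_reflection.reflects Q k M M'" "indecomposable Q M" "dimv M = s k (dimv M')"
proof -
  interpret sink_reflection Q k by unfold_locales (fact Q(2))
  have "into_at M'"
    using indecomposable_into_or_concentrated[OF M'(1)] dimension_concentrated M'(2) by blast
  moreover have rep: "representation Q' M'" using M'(1) by (simp add: indecomposable_def)
  ultimately obtain M where M: "reflects M M'" using coreflect_exists by blast
  have "indecomposable Q M"
    using rep_equivalence.indecomposable_transfer[OF equivalence M M'(1)] .
  moreover have "dimv M = s k (dimv M')" using dim_reflects[OF Q M] by simp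
  ultimately show ?thesis using that M by blast
qed

lemma shifted_root_not_simple:
  assumes "s k b \<in> pos" shows "b \<noteq> \<alpha> k"
proof
  assume "b = \<alpha> k"
  then have "- \<alpha> k \<in> pos" using assms s_simple[of k] by simp
  then show False using negative_not_positive[OF simple_positive[of k]] by simp
qed

lemma positive_word_step:
  assumes "positive_word (k # u @ i # x)"
  shows "word u (\<alpha> i) \<in> pos" "word u (\<alpha> i) \<noteq> \<alpha> k" "s k (word u (\<alpha> i)) \<in> pos" "s k (word u (\<alpha> i)) \<noteq> \<alpha> k"
proof -
  show 1: "word u (\<alpha> i) \<in> pos" using positive_wordD[of "[k]" u i x] assms by simp
  show 2: "s k (word u (\<alpha> i)) \<in> pos" using positive_wordD[of "[]" "k # u" i x] assms by simp
  show "word u (\<alpha> i) \<noteq> \<alpha> k" by (rule shifted_root_not_simple[OF 2])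
  show "s k (word u (\<alpha> i)) \<noteq> \<alpha> k"
    by (rule shifted_root_not_simple) (use 1 in simp)
qed

text \<open>Starting from the simple representation at the last letter, the prefix is undone by
  reverse reflections. Positivity of the word ensures that the simple root on which the reflection
  is not defined is never met.\<close>

lemma root_representation_exists:
  "orientation_of D Q \<Longrightarrow> adapted Q (u @ [i]) \<Longrightarrow> positive_word (u @ [i]) \<Longrightarrow>
    \<exists>M. indecomposable Q M \<and> dimv M = word u (\<alpha> i)"
proof (induction u arbitrary: Q)
  case Nil
  obtain M where "representation Q M" "concentrated i M" by (rule representation_of_concentrated_exists)
  then show ?case using concentrated_is_indecomposable dimension_concentrated by fastforce
next
  case (Cons k u)
  have Q: "orientation_of D Q" "sink Q k" using Cons.prems by auto
  have "positive_word (u @ [i])" using positive_word_Cons Cons.prems(3) by simp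
  then obtain M' where M': "indecomposable (reverse_at k Q) M'" "dimv M' = word u (\<alpha> i)"
    using Cons.IH[OF orientation_reverse_at[OF Q(1)]] Cons.prems(2) by auto
  have "dimv M' \<noteq> \<alpha> k" using positive_word_step[of k u i "[]"] Cons.prems(3) M'(2) by simp
  then obtain M where "indecomposable Q M" "dimv M = s k (dimv M')" by (rule coreflect_indecomposable[OF Q M'(1)])
  then show ?case using M'(2) by auto
qed

text \<open>Reflecting along \<open>u\<close> turns both representations into ones concentrated at
  the same sink.\<close>

lemma root_representation_unique:
  "orientation_of D Q \<Longrightarrow> adapted Q (u @ [i]) \<Longrightarrow> positive_word (u @ [i]) \<Longrightarrow>
    indecomposable Q M \<Longrightarrow> dimv M = word u (\<alpha> i) \<Longrightarrow>
    indecomposable Q N \<Longrightarrow> dimv N = word u (\<alpha> i) \<Longrightarrow> isomorphic_reps Q M N"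
proof (induction u arbitrary: Q M N)
  case Nil
  have reps: "representation Q M" "representation Q N" using Nil.prems by (auto simp: indecomposable_def)
  then have "concentrated i M" "concentrated i N" using Nil.prems dim_simple_concentrated by auto
  moreover have "sink Q i" using Nil.prems(2) by simp
  ultimately show ?case using concentrated_isomorphic[of Q i M N] reps by blast
next
  case (Cons k u)
  have Q: "orientation_of D Q" "sink Q k" using Cons.prems by auto
  interpret sink_reflection Q k by unfold_locales (fact Q(2))
  have pw: "positive_word (u @ [i])" using positive_word_Cons Cons.prems(3) by simp
  have "s k (word u (\<alpha> i)) \<noteq> \<alpha> k" using positive_word_step[of k u i "[]"] Cons.prems(3) by simp
  then have ne: "dimv M \<noteq> \<alpha> k" "dimv N \<noteq> \<alpha> k" using Cons.prems by auto
  obtain M' where M': "reflects M M'" "indecomposable Q' M'" "dimv M' = s k (dimv M)"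
    by (rule reflect_indecomposable[OF Q Cons.prems(4) ne(1)])
  obtain N' where N': "reflects N N'" "indecomposable Q' N'" "dimv N' = s k (dimv N)"
    by (rule reflect_indecomposable[OF Q Cons.prems(6) ne(2)])
  have "dimv M' = word u (\<alpha> i)" "dimv N' = word u (\<alpha> i)"
    using M'(3) N'(3) Cons.prems(5,7) by simp_all
  then have "isomorphic_reps Q' M' N'"
    using Cons.IH[OF orientation_reverse_at[OF Q(1)] _ pw M'(2) _ N'(2)] Cons.prems(2) by simp
  then show ?case by (rule rep_equivalence.iso_transfer[OF equivalence M'(1) N'(1)])
qed

text \<open>The representations whose position in the word is the first occurrence of \<open>i\<close> behave like the
  indecomposable projective at \<open>i\<close>: morphisms out of them are determined by the image of \<open>e\<close>.\<close>

lemma projective_universal: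
  "orientation_of D Q \<Longrightarrow> adapted Q (u @ [i]) \<Longrightarrow> positive_word (u @ [i]) \<Longrightarrow> i \<notin> set u \<Longrightarrow>
    indecomposable Q X \<Longrightarrow> dimv X = word u (\<alpha> i) \<Longrightarrow>
    \<exists>e\<in>space_at X i. (\<forall>L. representation Q L \<longrightarrow>
      (\<forall>y\<in>space_at L i. \<exists>g. morphism Q X L g \<and> g i e = y) \<and>
      (\<forall>g g'. morphism Q X L g \<longrightarrow> morphism Q X L g' \<longrightarrow> g i e = g' i e \<longrightarrow> equal_on X g g'))"
proof (induction u arbitrary: Q X)
  case Nil
  have rep: "representation Q X" using Nil.prems by (simp add: indecomposable_def)
  then have X: "concentrated i X" using dim_simple_concentrated Nil.prems(6) by simp
  have snk: "sink Q i" using Nil.prems(2) by simp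
  obtain x where x: "x \<noteq> 0" "space_at X i = cvec.span {x}" "x \<in> space_at X i" by (rule concentratedE[OF X])
  have "\<exists>g. morphism Q X L g \<and> g i x = y" if "representation Q L" "y \<in> space_at L i" for L y
    using concentrated_morphism_exists[OF snk rep X x(1,2) that] by metis
  moreover have "equal_on X g g'" if "morphism Q X L g" "morphism Q X L g'" "g i x = g' i x" for L g g'
    by (rule concentrated_morphism_unique[OF rep X x(2) that])
  ultimately show ?case using x(3) by blast
next
  case (Cons k u)
  have Q: "orientation_of D Q" "sink Q k" using Cons.prems by auto
  interpret sink_reflection Q k by unfold_locales (fact Q(2))
  interpret equiv: rep_equivalence Q Q' k reflects by (rule equivalence)
  have ik: "i \<noteq> k" "i \<notin> set u" using Cons.prems(4) by auto
  have pw: "positive_word (u @ [i])" using positive_word_Cons Cons.prems(3) by simp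
  have "s k (word u (\<alpha> i)) \<noteq> \<alpha> k" using positive_word_step[of k u i "[]"] Cons.prems(3) by simp
  then have ne: "dimv X \<noteq> \<alpha> k" using Cons.prems by auto
  obtain X' where X': "reflects X X'" "indecomposable Q' X'" "dimv X' = s k (dimv X)"
    by (rule reflect_indecomposable[OF Q Cons.prems(5) ne])
  note XD = reflectsD[OF X'(1)]
  have "dimv X' = word u (\<alpha> i)" using X'(3) Cons.prems(6) by simp
  then obtain e where e: "e \<in> space_at X' i" "\<And>L y. representation Q' L \<Longrightarrow> y \<in> space_at L i \<Longrightarrow> \<exists>g. morphism Q' X' L g \<and> g i e = y"
    "\<And>L g g'. representation Q' L \<Longrightarrow> morphism Q' X' L g \<Longrightarrow> morphism Q' X' L g' \<Longrightarrow> g i e = g' i e \<Longrightarrow> equal_on X' g g'"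
    using Cons.IH[OF orientation_reverse_at[OF Q(1)] _ pw ik(2) X'(2)] Cons.prems(2) by auto
  have eX: "e \<in> space_at X i" using e(1) XD(3)[OF ik(1)] by simp
  {
    fix L assume L: "representation Q L"
    \<comment> \<open>An arbitrary target is replaced by its summand that can be reflected. As
      \<open>i \<noteq> k\<close>, the space at \<open>i\<close> is the same, so the prescribed
      value at \<open>e\<close> is not affected.\<close>
    obtain L1 p where L1: "representation Q L1" "onto_at L1" "\<And>i. i \<noteq> k \<Longrightarrow> space_at L1 i = space_at L i"
      "space_at L1 k \<subseteq> space_at L k" "map_along L1 = map_along L"
      "morphism Q L1 L (\<lambda>i. id)" "morphism Q L L1 (\<lambda>i. if i = k then p else id)"
      "\<And>x. x \<in> space_at L1 k \<Longrightarrow> p x = x" by (rule onto_summand[OF L]) (rule that)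
    obtain L1' where L1': "reflects L1 L1'" using reflect_exists[OF L1(1,2)] by blast
    have exist: "\<exists>g. morphism Q X L g \<and> g i e = y" if y: "y \<in> space_at L i" for y
    proof -
      have "y \<in> space_at L1' i" using y L1(3)[OF ik(1)] reflectsD(3)[OF L1' ik(1)] by simp
      then obtain g' where g': "morphism Q' X' L1' g'" "g' i e = y" using e(2)[OF reflectsD(2)[OF L1']] by blast
      obtain g where g: "morphism Q X L1 g" "agree_off k X g g'" using equiv.backward[OF X'(1) L1' g'(1)] by blast
      have "compose_mor (\<lambda>i. id) g i e = y" using g(2) g'(2) ik(1) eX by (simp add: agree_off_def)
      then show ?thesis using morphism_compose[OF g(1) L1(6)] by blast
    qed
    have unique: "equal_on X g h" if g: "morphism Q X L g" and h: "morphism Q X L h" and eq: "g i e = h i e" for g h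
    proof -
      let ?p = "\<lambda>i. if i = k then p else id"
      obtain g' where g': "morphism Q' X' L1' g'" "agree_off k X (compose_mor ?p g) g'"
        using equiv.forward[OF X'(1) L1' morphism_compose[OF g L1(7)]] by blast
      obtain h' where h': "morphism Q' X' L1' h'" "agree_off k X (compose_mor ?p h) h'"
        using equiv.forward[OF X'(1) L1' morphism_compose[OF h L1(7)]] by blast
      have g'g: "g' j v = g j v" and h'h: "h' j v = h j v" if "j \<noteq> k" "v \<in> space_at X j" for j v
        using g'(2) h'(2) that by (auto simp: agree_off_def)
      have "g' i e = h' i e" using g'g[OF ik(1) eX] h'h[OF ik(1) eX] eq by simp
      then have eq': "equal_on X' g' h'" by (rule e(3)[OF reflectsD(2)[OF L1'] g'(1) h'(1)])
      have "agree_off k X g h"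
        unfolding agree_off_def
      proof (intro allI impI ballI)
        fix j v assume j: "j \<noteq> k" and v: "v \<in> space_at X j"
        then have "v \<in> space_at X' j" using XD(3) by simp
        then have "g' j v = h' j v" by (rule equal_onD[OF eq'])
        then show "g j v = h j v" using g'g[OF j v] h'h[OF j v] by simp
      qed
      then show ?thesis by (rule unique_onto[OF XD(1,5) g h])
    qed
    note exist unique
  }
  then show ?case using eX by blast
qed

section \<open>Irreducible morphisms out of the simple representation at a sink\<close>

text \<open>Nonnegative coefficients with sum at most 1, one of which is at least 1, leave nothing
  for the other neighbours.\<close>

lemma word_neighbour_unique:
  assumes pos: "word u (\<alpha> b) \<in> pos" and zero: "coord k (word u (\<alpha> b)) = 0"
    and i: "(i, k) \<in> D" "coord i (word u (\<alpha> b)) \<ge> 1" and l: "(l, k) \<in> D" "l \<noteq> i"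
  shows "coord l (word u (\<alpha> b)) = 0"
proof -
  let ?c = "\<lambda>l. coord l (word u (\<alpha> b))"
  have nonneg: "?c j \<ge> 0" for j using positive_rootD(2)[OF pos] .
  have "?c i + ?c l = sum ?c {i, l}" using l(2) by simp
  also have "\<dots> \<le> (\<Sum>l | (l, k) \<in> D. ?c l)"
    using i(1) l(1) nonneg by (intro sum_mono2) auto
  also have "\<dots> \<le> 1" by (rule neighbour_sum_le_1[OF pos zero])
  finally show ?thesis using i(2) nonneg[of l] by simp
qed

text \<open>Injectivity of inflow makes the reflected space at \<open>k\<close> zero, so the root
  \<open>word u (\<alpha> b)\<close> has coefficient 0 at \<open>k\<close> and a single neighbour
  \<open>i\<close> of \<open>k\<close> in its support. Were \<open>i\<close> a letter of
  \<open>u\<close>, the projective \<open>X\<close> at its first occurrence would come strictly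
  before \<open>N\<close> and \<open>f\<close> would factor through it; irreducibility would make
  \<open>X\<close> and \<open>N\<close> isomorphic in spite of their different roots.\<close>

lemma irreducible_from_simple:
  assumes Q: "orientation_of D Q" and ad: "adapted Q (k # u @ [b])" and pw: "positive_word (k # u @ [b])"
    and M: "indecomposable Q M" "dimv M = \<alpha> k" and N: "indecomposable Q N" "dimv N = s k (word u (\<alpha> b))"
    and f: "irreducible_morphism Q M N f"
  shows "(k, b) \<in> D \<and> b \<notin> set u"
proof -
  have snk: "sink Q k" using ad by simp
  interpret sink_reflection Q k by unfold_locales (fact snk)
  let ?c = "word u (\<alpha> b)"
  have c: "?c \<in> pos" "s k ?c \<noteq> \<alpha> k" using positive_word_step[of k u b "[]"] pw by auto
  have repM: "representation Q M" and repN: "representation Q N" and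
    nzM: "\<exists>i. space_at M i \<noteq> {0}" and nzN: "\<exists>i. space_at N i \<noteq> {0}"
    using M N by (auto simp: indecomposable_def)
  have concM: "concentrated k M" using dim_simple_concentrated[OF repM M(2)] .
  have ontoN: "onto_at N"
    using indecomposable_onto_or_concentrated[OF N(1)] dimension_concentrated[of k N \<alpha>] N(2) c(2) by auto
  note fD = irreducibleD[OF f]
  obtain x where x: "x \<noteq> 0" "space_at M k = cvec.span {x}" "x \<in> space_at M k" by (rule concentratedE[OF concM])
  have "f k x \<noteq> 0"
  proof
    assume "f k x = 0"
    then have "equal_on M f zero_mor"
      by (intro concentrated_morphism_unique[OF repM concM x(2) fD(1) morphism_zero[OF repN]]) simp
    then show False using irreducible_nonzero[OF f nzM repM nzN repN] by blast
  qed
  moreover obtain y where y: "family N y" "f k x = inflow N y"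
    using ontoN morphism_in[OF fD(1) x(3)] unfolding onto_at_def by blast
  ultimately have "(\<Sum>l\<in>preds. map_along N (l, k) (y l)) \<noteq> 0" by (simp add: inflow_def)
  then obtain i where i: "(i, k) \<in> Q" "map_along N (i, k) (y i) \<noteq> 0"
    by (metis (no_types, lifting) mem_Collect_eq sum.neutral)
  have yi: "y i \<in> space_at N i" using y(1) i(1) by (simp add: family_def)
  have "y i \<noteq> 0"
    using i(2) linear_between_zero[OF representation_map[OF repN i(1)] representation_space(2)[OF repN]] by auto
  obtain N' where N': "reflects N N'" "indecomposable Q' N'" "dimv N' = s k (dimv N)"
    by (rule reflect_indecomposable[OF Q snk N(1)]) (use N(2) c(2) in auto)
  have dimN': "dimv N' = ?c" using N'(3) N(2) by simp
  note ND = reflectsD[OF N'(1)]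
  have "v = 0" if v: "v \<in> space_at N' k" for v
  proof -
    have map_k: "linear_between (space_at N' k) (space_at N l) (map_along N' (k, l))" if "(l, k) \<in> Q" for l
      using representation_map[OF ND(2), of k l] ND(3)[OF pred_neq[OF that]] that by (simp add: Q'_iff)
    have fam: "family N (\<lambda>l. map_along N' (k, l) v)"
      using linear_betweenD(1)[OF map_k v] by (simp add: family_def)
    then have "inflow N (\<lambda>l. map_along N' (k, l) v) = 0" using ND(7) v by blast
    then have "map_along N' (k, l) v = 0" if "(l, k) \<in> Q" for l
      using irreducible_from_concentrated_injective[OF repM concM repN ontoN f fam _ that] by blast
    then show ?thesis using ND(6) v unfolding into_at_def by blast
  qed
  then have "space_at N' k = {0}" using representation_zero[OF ND(2), of k] by blast
  then have ck: "coord k ?c = 0" using coord_dim[of k N'] dimN' dim_zero by simp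
  have coord_pred: "coord l ?c = real (cvec.dim (space_at N l))" if "l \<noteq> k" for l
    using coord_dim[of l N'] dimN' ND(3)[OF that] by simp
  have "cvec.dim (space_at N i) \<noteq> 0"
    using dim_eq_0D[OF representation_space(1)[OF repN, of i]] yi \<open>y i \<noteq> 0\<close> by auto
  then have ci: "coord i ?c \<ge> 1" using coord_pred[OF pred_neq[OF i(1)]] by simp
  have iD: "(i, k) \<in> D" using i(1) orientation_linked[OF Q] by blast
  have only_i: "space_at N l = {0}" if "(l, k) \<in> Q" "l \<noteq> i" for l
  proof -
    have "coord l ?c = 0"
      using word_neighbour_unique[OF c(1) ck iD ci _ that(2)] that(1) orientation_linked[OF Q] by blast
    then show ?thesis
      using dim_eq_0D[OF representation_space(1)[OF repN, of l]] coord_pred[OF pred_neq[OF that(1)]] by simp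
  qed
  have "inflow N y = inflow N (single i (y i))"
    using only_i y(1) by (intro inflow_cong) (auto simp: family_def single_def)
  then have fx: "f k x = map_along N (i, k) (y i)" using y(2) inflow_single[OF repN i(1)] by simp
  have "i \<notin> set u"
  proof
    assume "i \<in> set u"
    then obtain u1 u2 where u: "u = u1 @ i # u2" "i \<notin> set u1" by (meson split_list_first)
    have adX: "adapted Q ((k # u1) @ [i])"
      using ad adapted_append[of Q "(k # u1) @ [i]" "u2 @ [b]"] by (simp add: u(1))
    have pwX: "positive_word ((k # u1) @ [i])"
      using positive_word_infix[of "[]" "(k # u1) @ [i]" "u2 @ [b]"] pw by (simp add: u(1))
    obtain X where X: "indecomposable Q X" "dimv X = word (k # u1) (\<alpha> i)"
      using root_representation_exists[OF Q adX pwX] by blast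
    have repX: "representation Q X" using X(1) by (simp add: indecomposable_def)
    have "dimv X \<noteq> \<alpha> k" using positive_word_step[of k u1 i "[]"] pwX X(2) by simp
    then have ontoX: "onto_at X"
      using indecomposable_onto_or_concentrated[OF X(1)] dimension_concentrated[of k X \<alpha>] by auto
    have "i \<notin> set (k # u1)" using u(2) pred_neq[OF i(1)] by simp
    from projective_universal[OF Q adX pwX this X]
    obtain e where e: "e \<in> space_at X i" "\<And>L y. representation Q L \<Longrightarrow> y \<in> space_at L i \<Longrightarrow> \<exists>g. morphism Q X L g \<and> g i e = y"
      by auto
    obtain g where g: "morphism Q X N g" "g i e = y i" using e(2)[OF repN yi] by blast
    have "map_along X (i, k) e \<in> space_at X k"
      using linear_betweenD(1)[OF representation_map[OF repX i(1)] e(1)] .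
    then obtain h where h: "morphism Q M X h" "h k x = map_along X (i, k) e"
      by (rule concentrated_morphism_exists[OF snk repM concM x(1,2) repX])
    \<comment> \<open>The generator goes under \<open>h\<close> to the image of \<open>e\<close>
      along the arrow into \<open>k\<close>, and \<open>g\<close> sends this to the image of
      \<open>y i\<close>, which is \<open>f k x\<close>.\<close>
    have "equal_on M f (compose_mor g h)"
      by (rule concentrated_morphism_unique[OF repM concM x(2) fD(1) morphism_compose[OF h(1) g(1)]])
        (simp add: h(2) fx morphism_commute[OF g(1) i(1) e(1)] g(2))
    then have "f j v = g j (h j v)" if "v \<in> space_at M j" for j v using equal_onD[OF _ that] by fastforce
    from fD(4)[OF repX h(1) g(1) this] have "split_mono Q M X h \<or> split_epi Q X N g" by blast
    then have "split_epi Q X N g" using not_split_mono_from_concentrated[OF repX ontoX repM concM] by blast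
    then obtain t where t: "morphism Q N X t" "\<And>j v. v \<in> space_at N j \<Longrightarrow> g j (t j v) = v"
      by (blast dest: split_epiD)
    \<comment> \<open>This idempotent is zero or the identity; the former makes \<open>N\<close>
      vanish, the latter makes \<open>g\<close> an isomorphism.\<close>
    let ?e = "compose_mor t g"
    have "morphism Q X X ?e" by (rule morphism_compose[OF g(1) t(1)])
    moreover have "?e j (?e j v) = ?e j v" if "v \<in> space_at X j" for j v
      using t(2)[OF morphism_in[OF g(1) that]] by simp
    ultimately have "(\<forall>j. \<forall>v\<in>space_at X j. ?e j v = 0) \<or> (\<forall>j. \<forall>v\<in>space_at X j. ?e j v = v)"
      by (rule indecomposable_idempotent[OF X(1)])
    then show False
    proof
      assume z: "\<forall>j. \<forall>v\<in>space_at X j. ?e j v = 0"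
      have "v = 0" if v: "v \<in> space_at N j" for j v
      proof -
        have tv: "t j v \<in> space_at X j" by (rule morphism_in[OF t(1) v])
        have "t j (g j (t j v)) = 0" using z tv by simp
        then have "t j v = 0" using t(2)[OF v] by simp
        then have "v = g j 0" using t(2)[OF v] by simp
        then show ?thesis using linear_between_zero[OF morphism_linear[OF g(1)] representation_space(2)[OF repX]] by simp
      qed
      then show False using nzN representation_zero[OF repN] by blast
    next
      assume idt: "\<forall>j. \<forall>v\<in>space_at X j. ?e j v = v"
      have "isomorphic_reps Q X N"
        by (rule isomorphic_repsI[OF g(1) t(1)]) (use idt t(2) in auto)
      then have "dimv X = dimv N" by (rule iso_dimv[OF repX])
      then have "word (k # u1) (\<alpha> i) = word ((k # u1) @ i # u2) (\<alpha> b)" using X(2) N(2) u(1) by simp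
      moreover have "positive_word ((k # u1) @ i # u2 @ b # [])" using pw u(1) by simp
      ultimately show False using roots_distinct by blast
    qed
  qed
  \<comment> \<open>With \<open>i\<close> absent from \<open>u\<close>, the coefficient of the root
    at \<open>i\<close> is that of \<open>\<alpha> b\<close>, and it is nonzero.\<close>
  moreover have "i = b"
  proof (rule ccontr)
    assume "i \<noteq> b"
    then have "coord i ?c = 0" using coord_word[OF \<open>i \<notin> set u\<close>] by (simp add: coord_simple)
    then show False using ci by simp
  qed
  ultimately show ?thesis using iD D_sym by blast
qed

text \<open>Here \<open>N\<close> is projective with generator \<open>e\<close> at \<open>b\<close>,
  its space at \<open>k\<close> is the line through the image \<open>z\<close> of \<open>e\<close>,
  and \<open>f\<close> sends the generator of \<open>M\<close> to \<open>z\<close>. In a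
  factorization the second factor either vanishes at \<open>b\<close>, which yields a retraction of
  the first, or reaches \<open>e\<close>, which yields a section.\<close>

lemma irreducible_from_simple_exists:
  assumes Q: "orientation_of D Q" and ad: "adapted Q (k # u @ [b])" and pw: "positive_word (k # u @ [b])"
    and M: "indecomposable Q M" "dimv M = \<alpha> k" and N: "indecomposable Q N" "dimv N = s k (word u (\<alpha> b))"
    and kb: "(k, b) \<in> D" and bu: "b \<notin> set u"
  shows "\<exists>f. irreducible_morphism Q M N f"
proof -
  have snk: "sink Q k" using ad by simp
  interpret sink_reflection Q k by unfold_locales (fact snk)
  let ?c = "word u (\<alpha> b)"
  have c: "?c \<in> pos" "s k ?c \<noteq> \<alpha> k" using positive_word_step[of k u b "[]"] pw by auto
  have bk: "(b, k) \<in> Q" using kb orientation_linked[OF Q] not_out by blast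
  then have neq: "b \<noteq> k" by (rule pred_neq)
  have ku: "k \<notin> set u" using gap_symmetric[OF Q ad kb] bu by simp
  have ck: "coord k ?c = 0" using coord_word[OF ku] neq by (simp add: coord_simple)
  have cb: "coord b ?c = 1" using coord_word[OF bu] by (simp add: coord_simple)
  have bD: "(b, k) \<in> D" by (rule D_sym[OF kb])
  have repM: "representation Q M" and repN: "representation Q N" and nzN: "\<exists>i. space_at N i \<noteq> {0}"
    using M N by (auto simp: indecomposable_def)
  have concM: "concentrated k M" using dim_simple_concentrated[OF repM M(2)] .
  have ontoN: "onto_at N"
    using indecomposable_onto_or_concentrated[OF N(1)] dimension_concentrated[of k N \<alpha>] N(2) c(2) by auto
  obtain x where x: "x \<noteq> 0" "space_at M k = cvec.span {x}" "x \<in> space_at M k" by (rule concentratedE[OF concM])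
  have zero_l: "space_at N l = {0}" if l: "(l, k) \<in> Q" "l \<noteq> b" for l
  proof -
    have "coord l ?c = 0"
      using word_neighbour_unique[OF c(1) ck bD _ _ l(2)] cb l(1) orientation_linked[OF Q] by auto
    then have "coord l (dimv N) = 0" using N(2) pred_neq[OF l(1)] by (simp add: coord_s)
    then show ?thesis using dim_eq_0D[OF representation_space(1)[OF repN, of l]] coord_dim[of l N] by simp
  qed
  have "coord b (dimv N) = 1" using N(2) cb neq by (simp add: coord_s)
  then have dimb: "cvec.dim (space_at N b) = 1" using coord_dim[of b N] by simp
  \<comment> \<open>The reflection turns the coefficient 0 at \<open>k\<close> into the neighbour
    sum, which is at least the coefficient 1 at \<open>b\<close>.\<close>
  have "coord k (dimv N) \<noteq> 0"
  proof -
    have "coord b ?c \<le> (\<Sum>j | (j, k) \<in> D. coord j ?c)"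
      using bD positive_rootD(2)[OF c(1)] by (intro member_le_sum) auto
    then show ?thesis using N(2) ck cb by (simp add: coord_s)
  qed
  then have "cvec.dim (space_at N k) \<noteq> 0" using coord_dim[of k N] by simp
  then have Nk: "space_at N k \<noteq> {0}" by (intro notI) (simp add: dim_zero)
  have adN: "adapted Q ((k # u) @ [b])" and pwN: "positive_word ((k # u) @ [b])" and bku: "b \<notin> set (k # u)"
    and dN: "dimv N = word (k # u) (\<alpha> b)" using ad pw bu neq N(2) by simp_all
  from projective_universal[OF Q adN pwN bku N(1) dN]
  obtain e where e1: "e \<in> space_at N b" and univ: "\<forall>L. representation Q L \<longrightarrow>
      (\<forall>y\<in>space_at L b. \<exists>g. morphism Q N L g \<and> g b e = y) \<and>
      (\<forall>g g'. morphism Q N L g \<longrightarrow> morphism Q N L g' \<longrightarrow> g b e = g' b e \<longrightarrow> equal_on N g g')"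
    by (rule bexE)
  have e: "e \<in> space_at N b" "\<And>L y. representation Q L \<Longrightarrow> y \<in> space_at L b \<Longrightarrow> \<exists>g. morphism Q N L g \<and> g b e = y"
    "\<And>L g g'. representation Q L \<Longrightarrow> morphism Q N L g \<Longrightarrow> morphism Q N L g' \<Longrightarrow> g b e = g' b e \<Longrightarrow> equal_on N g g'"
    using e1 univ by simp_all
  have "e \<noteq> 0"
  proof
    assume "e = 0"
    then have "equal_on N (\<lambda>i. id) zero_mor"
      by (intro e(3)[OF repN morphism_id morphism_zero[OF repN]]) simp
    then have "v = 0" if "v \<in> space_at N j" for j v using equal_onD[OF _ that] by fastforce
    then show False using nzN representation_zero[OF repN] by blast
  qed
  have Nb: "space_at N b = cvec.span {e}"
  proof -
    obtain w where "space_at N b = cvec.span {w}" using dim_eq_1D[OF representation_space(1)[OF repN] dimb] by blast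
    then show ?thesis using span1_eq[of e w] e(1) \<open>e \<noteq> 0\<close> by simp
  qed
  note map_b = representation_map[OF repN bk]
  define z where "z = map_along N (b, k) e"
  have zN: "z \<in> space_at N k" unfolding z_def by (rule linear_betweenD(1)[OF map_b e(1)])
  have sub: "space_at N k \<subseteq> cvec.span {z}"
  proof
    fix v assume "v \<in> space_at N k"
    then obtain y where y: "family N y" "v = inflow N y" using ontoN unfolding onto_at_def by blast
    have "y b \<in> space_at N b" using y(1) bk by (simp add: family_def)
    then obtain d where d: "y b = cscale d e" using Nb span1_iff by auto
    have "inflow N y = inflow N (single b (y b))"
      using zero_l y(1) by (intro inflow_cong) (auto simp: family_def single_def)
    then have "v = cscale d z"
      using y(2) inflow_single[OF repN bk] linear_betweenD(3)[OF map_b e(1)] d by (simp add: z_def)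
    then show "v \<in> cvec.span {z}" unfolding span1_iff by blast
  qed
  have "z \<noteq> 0"
  proof
    assume "z = 0"
    then have "space_at N k \<subseteq> {0}" using sub by (simp add: cvec.span_singleton)
    then show False using Nk representation_zero[OF repN, of k] by auto
  qed
  obtain f where f: "morphism Q M N f" "f k x = z" "\<And>i v. i \<noteq> k \<Longrightarrow> f i v = 0"
    by (rule concentrated_morphism_exists[OF snk repM concM x(1,2) repN zN]) (rule that)
  have "irreducible_morphism Q M N f"
  proof (rule irreducibleI[OF f(1)])
    show "\<not> split_mono Q M N f" by (rule not_split_mono_from_concentrated[OF repN ontoN repM concM])
    show "\<not> split_epi Q M N f"
    proof
      assume "split_epi Q M N f"
      then obtain t where "\<And>i v. v \<in> space_at N i \<Longrightarrow> f i (t i v) = v" by (blast dest: split_epiD)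
      then have "f b (t b e) = e" using e(1) by blast
      then show False using f(3)[OF neq] \<open>e \<noteq> 0\<close> by simp
    qed
    fix L g h assume L: "representation Q L" and h: "morphism Q M L h" and g: "morphism Q L N g"
      and eq: "\<And>i v. v \<in> space_at M i \<Longrightarrow> f i v = g i (h i v)"
    show "split_mono Q M L h \<or> split_epi Q L N g"
    proof (cases "\<forall>v\<in>space_at L b. g b v = 0")
      case True
      \<comment> \<open>As \<open>g\<close> is zero at \<open>b\<close> and \<open>N\<close>
        vanishes at the other neighbours of \<open>k\<close>, the map \<open>g k\<close> kills
        everything arriving at \<open>k\<close>. Following it by \<open>t\<close> and extending by
        zero gives a morphism to \<open>M\<close>.\<close>
      obtain t where t: "clinear t" "t z = x" using line_map_exists[OF \<open>z \<noteq> 0\<close>] by blast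
      have tM: "t v \<in> space_at M k" if v: "v \<in> space_at N k" for v
      proof -
        obtain d where "v = cscale d z" using sub v span1_iff by blast
        then have "t v = cscale d x" using cvec_pair.linear_scale[OF t(1)] t(2) by simp
        then show ?thesis using x(2) span1_iff by auto
      qed
      let ?r = "\<lambda>i. if i = k then (\<lambda>v. t (g k v)) else zero_mor i"
      have r: "morphism Q L M ?r"
      proof (rule morphismI)
        fix i show "linear_between (space_at L i) (space_at M i) (?r i)"
        proof (cases "i = k")
          case True
          then show ?thesis
            using linear_between_compose[OF morphism_linear[OF g, of k] clinear_between[OF t(1) tM]] by simp
        qed (use representation_zero[OF repM, of i] in \<open>simp add: linear_between_def\<close>)
      next
        fix i j v assume ij: "(i, j) \<in> Q" and v: "v \<in> space_at L i"
        have i: "i \<noteq> k" using ij not_out by blast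
        have rhs: "map_along M (i, j) (?r i v) = 0"
          using i linear_between_zero[OF representation_map[OF repM ij] representation_space(2)[OF repM]] by simp
        show "?r j (map_along L (i, j) v) = map_along M (i, j) (?r i v)"
        proof (cases "j = k")
          case jk: True
          have "g i v = 0"
            using True v zero_l[of i] morphism_in[OF g v] ij jk by (cases "i = b") auto
          then have "g k (map_along L (i, k) v) = 0"
            using morphism_commute[OF g ij v] jk
              linear_between_zero[OF representation_map[OF repN ij] representation_space(2)[OF repN]] by simp
          then show ?thesis using rhs jk cvec_pair.linear_0[OF t(1)] by simp
        next
          case False
          then show ?thesis using rhs by simp
        qed
      qed
      have "equal_on M (compose_mor ?r h) (\<lambda>i. id)"
        by (rule concentrated_morphism_unique[OF repM concM x(2) morphism_compose[OF h r] morphism_id])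
          (simp add: eq[OF x(3), symmetric] f(2) t(2))
      then have "split_mono Q M L h" using h r unfolding split_mono_def by blast
      then show ?thesis by blast
    next
      case False
      then obtain v where v: "v \<in> space_at L b" "g b v \<noteq> 0" by blast
      have "g b v \<in> space_at N b" by (rule morphism_in[OF g v(1)])
      then obtain d where d: "g b v = cscale d e" using Nb span1_iff by auto
      then have "d \<noteq> 0" using v(2) by auto
      \<comment> \<open>A preimage of \<open>e\<close>; by projectivity a morphism can send
        \<open>e\<close> to it, and this is the section.\<close>
      let ?v = "cscale (1 / d) v"
      have v': "?v \<in> space_at L b" by (rule cvec.subspace_scale[OF representation_space(2)[OF L] v(1)])
      have gv: "g b ?v = e"
        using linear_betweenD(3)[OF morphism_linear[OF g] v(1)] d \<open>d \<noteq> 0\<close> by (simp add: cvec.scale_scale)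
      obtain t where t: "morphism Q N L t" "t b e = ?v" using e(2)[OF L v'] by blast
      have "equal_on N (compose_mor g t) (\<lambda>i. id)"
        by (rule e(3)[OF repN morphism_compose[OF t(1) g] morphism_id]) (simp add: t(2) gv)
      then have "split_epi Q L N g" using g t(1) unfolding split_epi_def by blast
      then show ?thesis by blast
    qed
  qed
  then show ?thesis by blast
qed

end


section \<open>Comparison of the two quivers\<close>

context simply_laced_system
begin

lemma irreducible_reflects_iff:
  assumes "sink Q k" "sink_reflection.reflects Q k M M'" "sink_reflection.reflects Q k N N'"
  shows "(\<exists>f. irreducible_morphism Q M N f) \<longleftrightarrow> (\<exists>f. irreducible_morphism (reverse_at k Q) M' N' f)"
proof -
  interpret sink_reflection Q k by unfold_locales (fact assms(1))
  interpret equiv: rep_equivalence Q Q' k reflects by (rule equivalence)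
  interpret op: rep_equivalence Q' Q k "\<lambda>M' M. reflects M M'" by (rule equiv.opposite)
  show ?thesis
    using equiv.irreducible_transfer[OF assms(2,3)] op.irreducible_transfer[OF assms(2,3)] by blast
qed

lemma irreducible_forward_iff:
  "orientation_of D Q \<Longrightarrow> adapted Q (w @ a # u @ [b]) \<Longrightarrow> positive_word (w @ a # u @ [b]) \<Longrightarrow>
    indecomposable Q M \<Longrightarrow> dimv M = word w (\<alpha> a) \<Longrightarrow>
    indecomposable Q N \<Longrightarrow> dimv N = word (w @ a # u) (\<alpha> b) \<Longrightarrow>
    (\<exists>f. irreducible_morphism Q M N f) \<longleftrightarrow> (a, b) \<in> D \<and> b \<notin> set u"
proof (induction w arbitrary: Q M N)
  case Nil
  then have *: "adapted Q (a # u @ [b])" "positive_word (a # u @ [b])" "dimv M = \<alpha> a" "dimv N = s a (word u (\<alpha> b))"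
    by simp_all
  show ?case
    using irreducible_from_simple[OF Nil.prems(1) *(1,2) Nil.prems(4) *(3) Nil.prems(6) *(4)]
      irreducible_from_simple_exists[OF Nil.prems(1) *(1,2) Nil.prems(4) *(3) Nil.prems(6) *(4)] by blast
next
  case (Cons k w)
  have Q: "orientation_of D Q" "sink Q k" using Cons.prems by auto
  have pw: "positive_word (w @ a # u @ [b])" using positive_word_Cons Cons.prems(3) by simp
  have "dimv M \<noteq> \<alpha> k" using positive_word_step[of k w a "u @ [b]"] Cons.prems(3,5) by simp
  then obtain M' where M': "sink_reflection.reflects Q k M M'" "indecomposable (reverse_at k Q) M'" "dimv M' = s k (dimv M)"
    by (rule reflect_indecomposable[OF Q Cons.prems(4)])
  have "dimv N \<noteq> \<alpha> k" using positive_word_step[of k "w @ a # u" b "[]"] Cons.prems(3,7) by simp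
  then obtain N' where N': "sink_reflection.reflects Q k N N'" "indecomposable (reverse_at k Q) N'" "dimv N' = s k (dimv N)"
    by (rule reflect_indecomposable[OF Q Cons.prems(6)])
  have "dimv M' = word w (\<alpha> a)" "dimv N' = word (w @ a # u) (\<alpha> b)"
    using M'(3) N'(3) Cons.prems(5,7) by simp_all
  then have "(\<exists>f. irreducible_morphism (reverse_at k Q) M' N' f) \<longleftrightarrow> (a, b) \<in> D \<and> b \<notin> set u"
    using Cons.IH[OF orientation_reverse_at[OF Q(1)] _ pw M'(2) _ N'(2)] Cons.prems(2) by simp
  then show ?case using irreducible_reflects_iff[OF Q(2) M'(1) N'(1)] by simp
qed

text \<open>Once the common prefix is reflected away, the target is concentrated at a sink, where no
  irreducible morphism ends. The word \<open>v\<close> may be empty, which excludes arrows from a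
  position to itself.\<close>

lemma no_irreducible_backward:
  "orientation_of D Q \<Longrightarrow> adapted Q (w @ [b]) \<Longrightarrow> positive_word (w @ [b]) \<Longrightarrow> positive_word (w @ v @ [a]) \<Longrightarrow>
    indecomposable Q M \<Longrightarrow> dimv M = word (w @ v) (\<alpha> a) \<Longrightarrow>
    indecomposable Q N \<Longrightarrow> dimv N = word w (\<alpha> b) \<Longrightarrow> \<not> irreducible_morphism Q M N f"
proof (induction w arbitrary: Q M N f)
  case Nil
  interpret sink_reflection Q b by unfold_locales (use Nil.prems in simp)
  have rep: "representation Q N" using Nil.prems by (simp add: indecomposable_def)
  then have "concentrated b N" using dim_simple_concentrated Nil.prems by simp
  then show ?case using no_irreducible_to_concentrated[OF Nil.prems(5) rep] by blast
next
  case (Cons k w)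
  have Q: "orientation_of D Q" "sink Q k" using Cons.prems by auto
  have pw: "positive_word (w @ [b])" "positive_word (w @ v @ [a])"
    using positive_word_Cons Cons.prems(3,4) by simp_all
  have "dimv M \<noteq> \<alpha> k" using positive_word_step[of k "w @ v" a "[]"] Cons.prems(4,6) by simp
  then obtain M' where M': "sink_reflection.reflects Q k M M'" "indecomposable (reverse_at k Q) M'" "dimv M' = s k (dimv M)"
    by (rule reflect_indecomposable[OF Q Cons.prems(5)])
  have "dimv N \<noteq> \<alpha> k" using positive_word_step[of k w b "[]"] Cons.prems(3,8) by simp
  then obtain N' where N': "sink_reflection.reflects Q k N N'" "indecomposable (reverse_at k Q) N'" "dimv N' = s k (dimv N)"
    by (rule reflect_indecomposable[OF Q Cons.prems(7)])
  have "dimv M' = word (w @ v) (\<alpha> a)" "dimv N' = word w (\<alpha> b)"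
    using M'(3) N'(3) Cons.prems(6,8) by simp_all
  then have "\<not> irreducible_morphism (reverse_at k Q) M' N' f'" for f'
    using Cons.IH[OF orientation_reverse_at[OF Q(1)] _ pw M'(2) _ N'(2)] Cons.prems(2) by simp
  then show ?case using irreducible_reflects_iff[OF Q(2) M'(1) N'(1)] by blast
qed

text \<open>Either a reflection meets the simple dimension vector of the current sink, or all
  reflections of the word can be performed. In the second case only the existence of some
  \<open>M'\<close> is recorded, which suffices because dimension vectors have nonnegative
  coordinates.\<close>

lemma dim_root_or_reflected:
  "orientation_of D Q \<Longrightarrow> adapted Q w \<Longrightarrow> indecomposable Q M \<Longrightarrow>
    (\<exists>u i x. w = u @ i # x \<and> dimv M = word u (\<alpha> i)) \<or> (\<exists>M'. dimv M = word w (dimv M'))"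
proof (induction w arbitrary: Q M)
  case Nil
  then show ?case by auto
next
  case (Cons k w)
  have Q: "orientation_of D Q" "sink Q k" using Cons.prems by auto
  show ?case
  proof (cases "dimv M = \<alpha> k")
    case True
    then have "k # w = [] @ k # w \<and> dimv M = word [] (\<alpha> k)" by simp
    then show ?thesis by blast
  next
    case False
    then obtain M' where M': "indecomposable (reverse_at k Q) M'" "dimv M' = s k (dimv M)"
      by (rule reflect_indecomposable[OF Q Cons.prems(3)])
    then have dM: "dimv M = s k (dimv M')" by simp
    consider u i x where "w = u @ i # x" "dimv M' = word u (\<alpha> i)" | M'' where "dimv M' = word w (dimv M'')"
      using Cons.IH[OF orientation_reverse_at[OF Q(1)] _ M'(1)] Cons.prems(2) by auto
    then show ?thesis
    proof cases
      case 1
      then have "k # w = (k # u) @ i # x \<and> dimv M = word (k # u) (\<alpha> i)" using dM by simp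
      then show ?thesis by blast
    next
      case 2
      then have "dimv M = word (k # w) (dimv M'')" using dM by simp
      then show ?thesis by blast
    qed
  qed
qed

end

locale adapted_longest_word = simply_laced_system D \<Phi> \<alpha> \<omega>
  for D :: "'i::finite rel" and \<Phi> :: "'e::euclidean_space set" and \<alpha> \<omega> :: "'i \<Rightarrow> 'e" +
  fixes Q :: "'i rel" and w :: "'i list"
  assumes orientation: "orientation_of D Q"
    and reduced: "reduced_expression \<alpha> w (longest_element \<alpha>)"
    and adapted: "adapted Q w"
begin

lemma longest: "longest_element \<alpha> = word w"
  using reduced by (simp add: reduced_expression_def)

lemma positive: "positive_word w"
  by (rule reduced_positive) (use reduced in \<open>simp add: reduced_expression_def\<close>)

lemma split_prefix:
  assumes "w = u @ i # x" shows "adapted Q (u @ [i])" "positive_word (u @ [i])"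
proof -
  have w: "w = (u @ [i]) @ x" using assms by simp
  show "adapted Q (u @ [i])" using adapted unfolding w adapted_append by blast
  show "positive_word (u @ [i])" by (rule positive_word_infix[of "[]" _ x]) (use positive w in simp)
qed

text \<open>The preimage of \<open>b\<close> under the longest element is not positive, since a
  positive one would be sent to a negative root.\<close>

lemma positive_root_in_word:
  assumes "b \<in> pos" obtains u i x where "w = u @ i # x" "b = word u (\<alpha> i)"
proof -
  have "word (rev w) b \<notin> pos"
  proof
    assume "word (rev w) b \<in> pos"
    from longest_negative[OF this] have "- b \<in> pos" by (simp add: longest)
    then show False using negative_not_positive assms by blast
  qed
  then show ?thesis using root_in_word[OF assms] that by blast
qed

lemma word_root_positive: "w = u @ i # x \<Longrightarrow> word u (\<alpha> i) \<in> pos"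
  using positive_wordD[of "[]" u i x] positive by simp

text \<open>The simple root \<open>\<alpha> i\<close> occurs among the roots of the word, and a
  nonzero coefficient at \<open>i\<close> can arise only through the letter
  \<open>i\<close>.\<close>

lemma all_letters: "i \<in> set w"
proof -
  obtain u j x where w: "w = u @ j # x" "\<alpha> i = word u (\<alpha> j)" by (rule positive_root_in_word[OF simple_positive])
  have "coord i (\<alpha> i) \<noteq> 0" by (simp add: coord_simple)
  then have "coord i (word u (\<alpha> j)) \<noteq> 0" using w(2) by simp
  then have "i \<in> set u \<or> i = j"
    using coord_word[of i u "\<alpha> j"] by (cases "i \<in> set u") (simp_all add: coord_simple split: if_splits)
  then show ?thesis using w(1) by auto
qed

lemma inj_ringel: "inj (ringel Q)"
proof (rule linear_injective_0[THEN iffD2, OF ringel_linear, rule_format])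
  fix v assume "ringel Q v = 0"
  then show "v = 0" using ringel_kernel[OF orientation adapted _ all_letters] by (intro coord_eqI) simp
qed

lemma dim_indecomposable: assumes M: "indecomposable Q M" shows "dimv M \<in> pos"
proof -
  consider u i x where "w = u @ i # x" "dimv M = word u (\<alpha> i)" | M' where "dimv M = word w (dimv M')"
    using dim_root_or_reflected[OF orientation adapted M] by blast
  then show ?thesis
  proof cases
    case 1
    then show ?thesis using word_root_positive by simp
  next
    case 2
    have rep: "representation Q M" using M by (simp add: indecomposable_def)
    have nonpos: "coord i (dimv M) \<le> 0" for i
    proof -
      have "coord i (dimv M) = (\<Sum>j\<in>UNIV. coord j (dimv M') * coord i (word w (\<alpha> j)))"
        unfolding 2 using arg_cong[OF expand[of "dimv M'"], of "\<lambda>v. coord i (word w v)"]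
        by (simp add: linear_sum[OF linear_word] linear_cmul[OF linear_word])
      also have "\<dots> \<le> 0"
      proof (intro sum_nonpos mult_nonneg_nonpos)
        fix j show "0 \<le> coord j (dimv M')" by (simp add: coord_dim)
        have "- word w (\<alpha> j) \<in> pos" using longest_negative[OF simple_positive, of j] by (simp add: longest)
        from positive_rootD(2)[OF this, of i] show "coord i (word w (\<alpha> j)) \<le> 0" by simp
      qed
      finally show ?thesis .
    qed
    have "cvec.dim (space_at M i) = 0" for i using nonpos[of i] coord_dim[of i M] by simp
    then have "space_at M i = {0}" for i by (rule dim_eq_0D[OF representation_space(1)[OF rep]])
    then show ?thesis using M by (auto simp: indecomposable_def)
  qed
qed

lemma indecomposable_of_root:
  assumes "b \<in> pos" obtains M where "indecomposable Q M" "dimv M = b"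
proof -
  obtain u i x where w: "w = u @ i # x" "b = word u (\<alpha> i)" by (rule positive_root_in_word[OF assms])
  show ?thesis using root_representation_exists[OF orientation split_prefix[OF w(1)]] w(2) that by blast
qed

lemma indecomposable_unique:
  assumes M: "indecomposable Q M" and N: "indecomposable Q N" and eq: "dimv M = dimv N"
  shows "isomorphic_reps Q M N"
proof -
  obtain u i x where w: "w = u @ i # x" "dimv M = word u (\<alpha> i)"
    by (rule positive_root_in_word[OF dim_indecomposable[OF M]])
  show ?thesis
    by (rule root_representation_unique[OF orientation split_prefix[OF w(1)] M w(2) N]) (use w eq in simp)
qed

text \<open>The isomorphism conjugates an idempotent of \<open>N\<close> into one of
  \<open>M\<close>.\<close>

lemma iso_indecomposable:
  assumes M: "indecomposable Q M" and N: "representation Q N" and iso: "isomorphic_reps Q M N"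
  shows "indecomposable Q N"
proof (rule trivial_idempotents_imp_indecomposable[OF N])
  obtain f g where fg: "morphism Q M N f" "morphism Q N M g"
    "\<And>i x. x \<in> space_at M i \<Longrightarrow> g i (f i x) = x" "\<And>i x. x \<in> space_at N i \<Longrightarrow> f i (g i x) = x"
    using isomorphic_repsE[OF iso] by blast
  have rep: "representation Q M" using M by (simp add: indecomposable_def)
  obtain i where "space_at M i \<noteq> {0}" using M by (auto simp: indecomposable_def)
  then obtain x where x: "x \<in> space_at M i" "x \<noteq> 0" using representation_zero[OF rep, of i] by auto
  have "f i x \<noteq> 0"
  proof
    assume "f i x = 0"
    then have "x = g i 0" using fg(3)[OF x(1)] by simp
    then show False using x(2) linear_between_zero[OF morphism_linear[OF fg(2)] representation_space(2)[OF N]] by simp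
  qed
  then show "\<exists>i. space_at N i \<noteq> {0}" using morphism_in[OF fg(1) x(1)] by auto
  show "trivial_idempotents Q N"
    unfolding trivial_idempotents_def
  proof (intro allI impI, elim conjE)
    fix e assume e: "morphism Q N N e" and idem: "equal_on N (compose_mor e e) e"
    let ?e = "compose_mor g (compose_mor e f)"
    have "morphism Q M M ?e" by (rule morphism_compose[OF morphism_compose[OF fg(1) e] fg(2)])
    moreover have "?e j (?e j v) = ?e j v" if v: "v \<in> space_at M j" for j v
    proof -
      have fv: "f j v \<in> space_at N j" by (rule morphism_in[OF fg(1) v])
      show ?thesis using fg(4)[OF morphism_in[OF e fv]] equal_onD[OF idem fv] by simp
    qed
    ultimately have "(\<forall>j. \<forall>v\<in>space_at M j. ?e j v = 0) \<or> (\<forall>j. \<forall>v\<in>space_at M j. ?e j v = v)"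
      by (rule indecomposable_idempotent[OF M])
    then show "equal_on N e zero_mor \<or> equal_on N e (\<lambda>i. id)"
    proof
      assume z: "\<forall>j. \<forall>v\<in>space_at M j. ?e j v = 0"
      have "e j v = 0" if v: "v \<in> space_at N j" for j v
      proof -
        have "g j (e j v) = 0" using z[rule_format, OF morphism_in[OF fg(2) v]] fg(4)[OF v] by simp
        then have "e j v = f j 0" using fg(4)[OF morphism_in[OF e v]] by simp
        then show ?thesis using linear_between_zero[OF morphism_linear[OF fg(1)] representation_space(2)[OF rep]] by simp
      qed
      then show ?thesis by (simp add: equal_on_def)
    next
      assume z: "\<forall>j. \<forall>v\<in>space_at M j. ?e j v = v"
      have "e j v = v" if v: "v \<in> space_at N j" for j v
      proof -
        have "g j (e j v) = g j v" using z[rule_format, OF morphism_in[OF fg(2) v]] fg(4)[OF v] by simp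
        then show ?thesis using fg(4)[OF morphism_in[OF e v]] fg(4)[OF v] by metis
      qed
      then show ?thesis by (simp add: equal_on_def)
    qed
  qed
qed

text \<open>One inclusion is invariance of dimension under isomorphism, the other is uniqueness of
  the indecomposable with a given root.\<close>

lemma iso_class_eq_root_class:
  assumes M: "indecomposable Q M" shows "iso_class Q M = root_class Q \<alpha> (dimv M)"
proof (intro equalityI subsetI)
  have rep: "representation Q M" using M by (simp add: indecomposable_def)
  fix N
  {
    assume "N \<in> iso_class Q M"
    then have N: "representation Q N" "isomorphic_reps Q M N" by (auto simp: iso_class_def)
    have "indecomposable Q N" by (rule iso_indecomposable[OF M N])
    moreover have "dimv M = dimv N" by (rule iso_dimv[OF rep N(2)])
    ultimately show "N \<in> root_class Q \<alpha> (dimv M)" by (simp add: root_class_def)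
  next
    assume "N \<in> root_class Q \<alpha> (dimv M)"
    then have N: "indecomposable Q N" "dimv N = dimv M" by (auto simp: root_class_def)
    have "isomorphic_reps Q M N" by (rule indecomposable_unique[OF M N(1)]) (use N in simp)
    then show "N \<in> iso_class Q M" using N(1) by (auto simp: iso_class_def indecomposable_def)
  }
qed

lemma inj_root_class: "inj_on (root_class Q \<alpha>) pos"
proof (rule inj_onI)
  fix a b assume a: "a \<in> pos" and "b \<in> pos" and eq: "root_class Q \<alpha> a = root_class Q \<alpha> b"
  obtain M where M: "indecomposable Q M" "dimv M = a" by (rule indecomposable_of_root[OF a])
  then have "M \<in> root_class Q \<alpha> a" by (simp add: root_class_def)
  then have "M \<in> root_class Q \<alpha> b" using eq by simp
  then show "a = b" using M(2) by (simp add: root_class_def)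
qed

lemma AR_vertices: "pverts (AR_quiver Q) = root_class Q \<alpha> ` pos"
proof (intro equalityI subsetI)
  fix v assume "v \<in> pverts (AR_quiver Q)"
  then obtain M where "v = iso_class Q M" "indecomposable Q M" by (auto simp: AR_quiver_def)
  then show "v \<in> root_class Q \<alpha> ` pos" using iso_class_eq_root_class dim_indecomposable by auto
next
  fix v assume "v \<in> root_class Q \<alpha> ` pos"
  then obtain b where b: "b \<in> pos" "v = root_class Q \<alpha> b" by auto
  obtain M where M: "indecomposable Q M" "dimv M = b" by (rule indecomposable_of_root[OF b(1)])
  then have "v = iso_class Q M" using iso_class_eq_root_class b(2) by simp
  then show "v \<in> pverts (AR_quiver Q)" using M(1) by (auto simp: AR_quiver_def)
qed

section \<open>Positions of the word as common index of both quivers\<close>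

text \<open>The prefix taken here stops before the letter at position \<open>j\<close>, whereas the
  one in \<open>prefix_weight\<close> includes it; \<open>ringel_word\<close> supplies the extra
  reflection.\<close>

definition root_at :: "nat \<Rightarrow> 'e" where
  "root_at j = word (take j w) (\<alpha> (w ! j))"

lemma split_at: "j < length w \<Longrightarrow> w = take j w @ w ! j # drop (Suc j) w"
  by (rule id_take_nth_drop)

lemma split_at_two:
  assumes "j < k" "k < length w"
  obtains v where "w = take j w @ w ! j # v @ w ! k # drop (Suc k) w" "take k w = take j w @ w ! j # v"
proof -
  obtain v where v: "take k w = take j w @ w ! j # v"
    using id_take_nth_drop[of j "take k w"] assms by (simp add: min_def)
  have "take k w @ w ! k # drop (Suc k) w = w" using split_at[OF assms(2)] by (rule sym)
  then have "w = take j w @ w ! j # v @ w ! k # drop (Suc k) w" unfolding v by simp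
  then show ?thesis using v by (rule that)
qed

lemma root_at_positive: "j < length w \<Longrightarrow> root_at j \<in> pos"
  unfolding root_at_def by (rule word_root_positive[OF split_at])

lemma root_at_surj: assumes "b \<in> pos" obtains j where "j < length w" "b = root_at j"
proof -
  obtain u i x where "w = u @ i # x" "b = word u (\<alpha> i)" by (rule positive_root_in_word[OF assms])
  then have "length u < length w" "take (length u) w = u" "w ! length u = i" by simp_all
  moreover from this have "b = root_at (length u)" using \<open>b = word u (\<alpha> i)\<close> by (simp only: root_at_def)
  ultimately show ?thesis by (intro that)
qed

lemma root_at_distinct: assumes "j < k" "k < length w" shows "root_at j \<noteq> root_at k"
proof -
  obtain v where v: "w = take j w @ w ! j # v @ w ! k # drop (Suc k) w" "take k w = take j w @ w ! j # v"
    by (rule split_at_two[OF assms])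
  have "positive_word (take j w @ w ! j # v @ w ! k # drop (Suc k) w)" using positive v(1) by simp
  from roots_distinct[OF this] show ?thesis unfolding root_at_def v(2) .
qed

lemma root_at_eq_iff: "j < length w \<Longrightarrow> k < length w \<Longrightarrow> root_at j = root_at k \<longleftrightarrow> j = k"
  using root_at_distinct[of j k] root_at_distinct[of k j] by (cases j k rule: linorder_cases) auto

lemma prefix_weight_root: assumes "j < length w" shows "prefix_weight \<alpha> \<omega> w j = - ringel Q (root_at j)"
proof -
  have "adapted Q (take j w @ [w ! j])" by (rule split_prefix(1)[OF split_at[OF assms]])
  from ringel_word[OF orientation this] show ?thesis
    by (simp add: prefix_weight_def prefix_element_def root_at_def take_Suc_conv_app_nth[OF assms])
qed

lemma irreducible_iff:
  assumes M: "indecomposable Q M" "dimv M = root_at j" and N: "indecomposable Q N" "dimv N = root_at k"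
    and jk: "j < length w" "k < length w"
  shows "(\<exists>f. irreducible_morphism Q M N f) \<longleftrightarrow>
    j < k \<and> (w ! j, w ! k) \<in> D \<and> prefix_coset \<alpha> w j \<inter> prefix_coset \<alpha> w k \<noteq> {}"
proof (cases "j < k")
  case True
  obtain v where v: "w = take j w @ w ! j # v @ w ! k # drop (Suc k) w" "take k w = take j w @ w ! j # v"
    by (rule split_at_two[OF True jk(2)])
  let ?u = "take j w" and ?a = "w ! j" and ?b = "w ! k" and ?x = "drop (Suc k) w"
  have len: "length ?u = j" "length (?u @ ?a # v) = k" using jk v(2)[symmetric] by simp_all
  have ad: "adapted Q (?u @ ?a # v @ ?b # ?x)" and pw: "positive_word (?u @ ?a # v @ ?b # ?x)"
    using adapted positive v(1) by simp_all
  have w': "w = (?u @ ?a # v) @ ?b # ?x" using v(1) by simp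
  note pre = split_prefix[OF w']
  have "(\<exists>f. irreducible_morphism Q M N f) \<longleftrightarrow> (?a, ?b) \<in> D \<and> ?b \<notin> set v"
    by (rule irreducible_forward_iff[OF orientation _ _ M(1) _ N(1)])
      (use pre M(2) N(2) v(2) in \<open>simp_all add: root_at_def\<close>)
  \<comment> \<open>Alternation of linked letters leads from the criterion for irreducible morphisms
    to the one for cosets.\<close>
  also have "\<dots> \<longleftrightarrow> (?a, ?b) \<in> D \<and> ?a \<notin> set v"
  proof -
    have "adapted (fold reverse_at ?u Q) (?a # v @ ?b # ?x)" using ad adapted_append by blast
    from gap_symmetric[OF orientation_fold[OF orientation] this] show ?thesis by blast
  qed
  also have "\<dots> \<longleftrightarrow> (?a, ?b) \<in> D \<and> prefix_coset \<alpha> w j \<inter> prefix_coset \<alpha> w k \<noteq> {}"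
    using prefix_cosets_meet[OF orientation ad pw] unfolding len v(1)[symmetric] by blast
  finally show ?thesis using True by simp
next
  case False
  \<comment> \<open>Here \<open>k \<le> j\<close>, and the case of equality gives the empty
    \<open>v\<close>.\<close>
  then obtain v where v: "take j w = take k w @ v"
    using append_take_drop_id[of k "take j w"] by (metis take_take min.absorb1 linorder_not_less)
  note pk = split_prefix[OF split_at[OF jk(2)]] and pj = split_prefix(2)[OF split_at[OF jk(1)]]
  have "\<not> irreducible_morphism Q M N f" for f
    by (rule no_irreducible_backward[OF orientation pk _ M(1) _ N(1), of v "w ! j"])
      (use M(2) N(2) v pj in \<open>simp_all add: root_at_def\<close>)
  then show ?thesis using False by blast
qed

text \<open>An arrow is given through arbitrary representatives of its end points; their classes
  determine their dimension vectors, so \<open>irreducible_iff\<close> applies to any of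
  them.\<close>

lemma AR_arrow_iff:
  assumes jk: "j < length w" "k < length w"
  shows "(root_class Q \<alpha> (root_at j), root_class Q \<alpha> (root_at k)) \<in> parcs (AR_quiver Q) \<longleftrightarrow>
    j < k \<and> (w ! j, w ! k) \<in> D \<and> prefix_coset \<alpha> w j \<inter> prefix_coset \<alpha> w k \<noteq> {}"
proof -
  have cls: "iso_class Q M = root_class Q \<alpha> (root_at i) \<longleftrightarrow> dimv M = root_at i"
    if "indecomposable Q M" "i < length w" for M i
    using iso_class_eq_root_class[OF that(1)] inj_root_class dim_indecomposable[OF that(1)] root_at_positive[OF that(2)]
    by (simp add: inj_on_eq_iff)
  have cls_j: "root_class Q \<alpha> (root_at j) = iso_class Q M \<longleftrightarrow> dimv M = root_at j" if "indecomposable Q M" for M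
    using cls[OF that jk(1)] by auto
  have cls_k: "root_class Q \<alpha> (root_at k) = iso_class Q M \<longleftrightarrow> dimv M = root_at k" if "indecomposable Q M" for M
    using cls[OF that jk(2)] by auto
  have AR: "(root_class Q \<alpha> (root_at j), root_class Q \<alpha> (root_at k)) \<in> parcs (AR_quiver Q) \<longleftrightarrow>
    (\<exists>M N. root_class Q \<alpha> (root_at j) = iso_class Q M \<and> root_class Q \<alpha> (root_at k) = iso_class Q N \<and>
      indecomposable Q M \<and> indecomposable Q N \<and> (\<exists>f. irreducible_morphism Q M N f))"
    by (simp add: AR_quiver_def)
  obtain M where M: "indecomposable Q M" "dimv M = root_at j"
    by (rule indecomposable_of_root[OF root_at_positive[OF jk(1)]])
  obtain N where N: "indecomposable Q N" "dimv N = root_at k"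
    by (rule indecomposable_of_root[OF root_at_positive[OF jk(2)]])
  show ?thesis
  proof
    assume "(root_class Q \<alpha> (root_at j), root_class Q \<alpha> (root_at k)) \<in> parcs (AR_quiver Q)"
    then obtain M N where *: "root_class Q \<alpha> (root_at j) = iso_class Q M" "root_class Q \<alpha> (root_at k) = iso_class Q N"
      "indecomposable Q M" "indecomposable Q N" and irr: "\<exists>f. irreducible_morphism Q M N f"
      unfolding AR by (elim exE conjE) (rule that, assumption+, rule exI)
    have "dimv M = root_at j" "dimv N = root_at k" using cls_j[OF *(3)] cls_k[OF *(4)] *(1,2) by simp_all
    from irreducible_iff[OF *(3) this(1) *(4) this(2) jk] irr
    show "j < k \<and> (w ! j, w ! k) \<in> D \<and> prefix_coset \<alpha> w j \<inter> prefix_coset \<alpha> w k \<noteq> {}" by (rule iffD1)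
  next
    assume "j < k \<and> (w ! j, w ! k) \<in> D \<and> prefix_coset \<alpha> w j \<inter> prefix_coset \<alpha> w k \<noteq> {}"
    with irreducible_iff[OF M N jk] have irr: "\<exists>f. irreducible_morphism Q M N f" by (rule iffD2)
    have "root_class Q \<alpha> (root_at j) = iso_class Q M" "root_class Q \<alpha> (root_at k) = iso_class Q N"
      using cls_j[OF M(1)] cls_k[OF N(1)] M(2) N(2) by simp_all
    then show "(root_class Q \<alpha> (root_at j), root_class Q \<alpha> (root_at k)) \<in> parcs (AR_quiver Q)"
      unfolding AR using M(1) N(1) irr by (intro exI[of _ M] exI[of _ N] conjI)
  qed
qed

text \<open>Distinct positions carry distinct weights, because the roots of the word are distinct
  and the Ringel map is injective. The positions witnessing an arrow are therefore \<open>j\<close>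
  and \<open>k\<close> themselves.\<close>

lemma abstract_arrow_iff:
  assumes jk: "j < length w" "k < length w"
  shows "(- ringel Q (root_at j), - ringel Q (root_at k)) \<in> parcs (abstract_AR_quiver D \<alpha> \<omega> w) \<longleftrightarrow>
    j < k \<and> (w ! j, w ! k) \<in> D \<and> prefix_coset \<alpha> w j \<inter> prefix_coset \<alpha> w k \<noteq> {}"
proof -
  have eq: "- ringel Q (root_at i) = prefix_weight \<alpha> \<omega> w l \<longleftrightarrow> i = l" if "i < length w" "l < length w" for i l
    using that by (simp add: prefix_weight_root inj_eq[OF inj_ringel] root_at_eq_iff)
  have "(- ringel Q (root_at j), - ringel Q (root_at k)) \<in> parcs (abstract_AR_quiver D \<alpha> \<omega> w) \<longleftrightarrow>
    (\<exists>j' k'. - ringel Q (root_at j) = prefix_weight \<alpha> \<omega> w j' \<and> - ringel Q (root_at k) = prefix_weight \<alpha> \<omega> w k' \<and>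
      j' < k' \<and> k' < length w \<and> (w ! j', w ! k') \<in> D \<and> prefix_coset \<alpha> w j' \<inter> prefix_coset \<alpha> w k' \<noteq> {})"
    by (simp add: abstract_AR_quiver_def)
  also have "\<dots> \<longleftrightarrow> j < k \<and> (w ! j, w ! k) \<in> D \<and> prefix_coset \<alpha> w j \<inter> prefix_coset \<alpha> w k \<noteq> {}"
  proof (intro iffI; (elim exE conjE)?)
    fix j' k' assume "- ringel Q (root_at j) = prefix_weight \<alpha> \<omega> w j'"
      "- ringel Q (root_at k) = prefix_weight \<alpha> \<omega> w k'"
      and *: "j' < k'" "k' < length w" "(w ! j', w ! k') \<in> D" "prefix_coset \<alpha> w j' \<inter> prefix_coset \<alpha> w k' \<noteq> {}"
    then have "j = j'" "k = k'" using eq[OF jk(1), of j'] eq[OF jk(2), of k'] by simp_all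
    then show "j < k \<and> (w ! j, w ! k) \<in> D \<and> prefix_coset \<alpha> w j \<inter> prefix_coset \<alpha> w k \<noteq> {}"
      using * by simp
  qed (use eq[OF jk(1,1)] eq[OF jk(2,2)] jk(2) in blast)
  finally show ?thesis .
qed

lemma vertex_bijection:
  "bij_betw (\<lambda>v. - ringel Q (class_root Q \<Phi> \<alpha> v)) (pverts (AR_quiver Q)) (pverts (abstract_AR_quiver D \<alpha> \<omega> w))"
proof -
  have "bij_betw (class_root Q \<Phi> \<alpha>) (root_class Q \<alpha> ` pos) pos"
    unfolding class_root_def using inj_root_class by (intro bij_betw_the_inv_into) (simp add: bij_betw_def)
  moreover have "bij_betw (\<lambda>b. - ringel Q b) pos (pverts (abstract_AR_quiver D \<alpha> \<omega> w))"
    unfolding bij_betw_def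
  proof
    show "inj_on (\<lambda>b. - ringel Q b) pos" by (rule inj_onI) (simp add: inj_eq[OF inj_ringel])
    have "pos = root_at ` {..<length w}"
    proof (intro equalityI subsetI)
      fix b assume "b \<in> pos"
      then obtain j where "j < length w" "b = root_at j" by (rule root_at_surj)
      then show "b \<in> root_at ` {..<length w}" by simp
    qed (auto intro: root_at_positive)
    then have "(\<lambda>b. - ringel Q b) ` pos = (\<lambda>j. - ringel Q (root_at j)) ` {..<length w}" by (simp only: image_image)
    also have "\<dots> = prefix_weight \<alpha> \<omega> w ` {..<length w}"
      by (rule image_cong[OF refl]) (simp add: prefix_weight_root)
    finally show "(\<lambda>b. - ringel Q b) ` pos = pverts (abstract_AR_quiver D \<alpha> \<omega> w)"
      by (simp add: abstract_AR_quiver_def)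
  qed
  ultimately have "bij_betw ((\<lambda>b. - ringel Q b) \<circ> class_root Q \<Phi> \<alpha>) (root_class Q \<alpha> ` pos)
      (pverts (abstract_AR_quiver D \<alpha> \<omega> w))" by (rule bij_betw_trans)
  then show ?thesis by (simp add: AR_vertices comp_def)
qed

lemma arrow_iff:
  assumes "a \<in> pos" "b \<in> pos"
  shows "(root_class Q \<alpha> a, root_class Q \<alpha> b) \<in> parcs (AR_quiver Q) \<longleftrightarrow>
    (- ringel Q a, - ringel Q b) \<in> parcs (abstract_AR_quiver D \<alpha> \<omega> w)"
proof -
  obtain j where j: "j < length w" "a = root_at j" by (rule root_at_surj[OF assms(1)])
  obtain k where k: "k < length w" "b = root_at k" by (rule root_at_surj[OF assms(2)])
  show ?thesis unfolding j(2) k(2) AR_arrow_iff[OF j(1) k(1)] abstract_arrow_iff[OF j(1) k(1)] ..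
qed

end

theorem theorem3p7:
  fixes D Q :: "'i::finite rel"
    and \<Phi> :: "'e::euclidean_space set"
    and \<alpha> \<omega> :: "'i \<Rightarrow> 'e"
    and R :: "'e \<Rightarrow> 'e \<Rightarrow> real"
    and \<phi> :: "'e \<Rightarrow> 'e"
    and "is" :: "'i list"
  assumes "ADE_diagram D"
    and "root_system \<Phi>" and "simple_system \<Phi> \<alpha>" and "has_Dynkin_diagram \<alpha> D"
    and "fundamental_weights \<alpha> \<omega>"
    and "orientation_of D Q"
    and "ringel_form Q \<alpha> R" and "ringel_map \<alpha> \<omega> R \<phi>"
    and "reduced_expression \<alpha> is (longest_element \<alpha>)" and "adapted Q is"
  shows "bij_betw (\<lambda>v. - \<phi> (class_root Q \<Phi> \<alpha> v))
           (pverts (AR_quiver Q)) (pverts (abstract_AR_quiver D \<alpha> \<omega> is)) \<and>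
         (\<forall>a\<in>positive_roots \<Phi> \<alpha>. \<forall>b\<in>positive_roots \<Phi> \<alpha>.
           (root_class Q \<alpha> a, root_class Q \<alpha> b) \<in> parcs (AR_quiver Q) \<longleftrightarrow>
           (- \<phi> a, - \<phi> b) \<in> parcs (abstract_AR_quiver D \<alpha> \<omega> is))"
proof -
  interpret adapted_longest_word D \<Phi> \<alpha> \<omega> Q "is"
  proof
    show "(i, j) \<in> D \<Longrightarrow> (j, i) \<in> D" "(i, i) \<notin> D" for i j
      using assms(6) by (auto simp: orientation_of_def)
  qed (use assms in auto)
  have "\<phi> = ringel Q" by (rule ringel_map_unique[OF assms(6-8)])
  then show ?thesis using vertex_bijection arrow_iff by blast
qed

end
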